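(* Let $p$ be any prime number and let $F$ be any field containing a primitive $p$-th root of unity, with absolute Galois group $G_F$. Then $G_F$ has the Vanishing triple Massey product property (with respect to $p$): for all $\chi_a,\chi_b,\chi_c\in H^1(G_F,\mathbb{Z}/p\mathbb{Z})$ with $\chi_a\cup\chi_b=0$ and $\chi_b\cup\chi_c=0$ in $H^2(G_F,\mathbb{Z}/p\mathbb{Z})$, the triple Massey product $\langle\chi_a,\chi_b,\chi_c\rangle\subseteq H^2(G_F,\mathbb{Z}/p\mathbb{Z})$ contains $0$.
   Context: $\mathbb{Z}/p\mathbb{Z}$ is a trivial discrete $G_F$-module. $C^\bullet(G_F)=C^\bullet(G_F,\mathbb{Z}/p\mathbb{Z})$ is the differential graded algebra of inhomogeneous continuous cochains, with differential $\partial$ (for $\varphi\in C^1$: $\partial(\varphi)(g_1,g_2)=\varphi(g_1)+\varphi(g_2)-\varphi(g_1g_2)$) and cup product (for $\varphi,\psi\in C^1$: $(\varphi\cup\psi)(g_1,g_2)=\varphi(g_1)\psi(g_2)$). Elements of $H^1(G_F,\mathbb{Z}/p\mathbb{Z})$ are continuous homomorphisms $G_F\to\mathbb{Z}/p\mathbb{Z}$. Let $\chi_a,\chi_b,\chi_c\in H^1(G_F,\mathbb{Z}/p\mathbb{Z})$ with $\chi_a\cup\chi_b=\chi_b\cup\chi_c=0$ in $H^2$. A defining system is a pair $\varphi=\{\varphi_{a,b},\varphi_{b,c}\}\subset C^1(G_F)$ with $\partial(\varphi_{a,b})=\chi_a\cup\chi_b$ and $\partial(\varphi_{b,c})=\chi_b\cup\chi_c$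 in $C^2(G_F)$. Then $\chi_a\cup\varphi_{b,c}+\varphi_{a,b}\cup\chi_c$ is a $2$-cocycle; its class in $H^2(G_F,\mathbb{Z}/p\mathbb{Z})$ is denoted $\langle\chi_a,\chi_b,\chi_c\rangle_\varphi$. The triple Massey product is $$\langle\chi_a,\chi_b,\chi_c\rangle=\{\langle\chi_a,\chi_b,\chi_c\rangle_\varphi \mid \varphi \text{ is a defining system}\}\subseteq H^2(G_F,\mathbb{Z}/p\mathbb{Z}).$$ *)

theory Defs
  imports
    "HOL-Analysis.Analysis"
    "HOL-Algebra.Algebraic_Closure_Type"
    "HOL-Number_Theory.Residues"
begin

section \<open>Absolute Galois groups\<close>

definition primitive_root_of_unity :: "nat \<Rightarrow> 'a::field \<Rightarrow> bool" where
  "primitive_root_of_unity n z \<longleftrightarrow> z ^ n = 1 \<and> (\<forall>k. 0 < k \<and> k < n \<longrightarrow> z ^ k \<noteq> 1)"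

text \<open>
  The base field \<open>F\<close> is a type \<open>'a\<close> of class \<open>field\<close>; it is identified with the subfield
  \<open>range to_ac\<close> of its algebraic closure \<open>'a alg_closure\<close>. As \<open>F\<close> may be imperfect, the
  separable closure has to be cut out: an element is separable over \<open>F\<close> iff its minimal
  polynomial (up to a unit, the irreducible polynomial vanishing at it) has only simple roots
  in the algebraic closure.
\<close>

definition sep_closure :: "'a::field alg_closure set" where
  "sep_closure = {x. \<exists>f :: 'a poly. Factorial_Ring.irreducible f \<and>
     poly (map_poly to_ac f) x = 0 \<and> rsquarefree (map_poly to_ac f)}"

definition sep_closure_ring :: "'a::field alg_closure ring" where
  "sep_closure_ring = ring_of_type_algebra\<lparr>carrier := sep_closure\<rparr>"

text \<open>Automorphisms are made extensional, so that equal maps on the separable closure are equal.\<close>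

definition absolute_galois_group ::
    "('a::field alg_closure \<Rightarrow> 'a alg_closure) monoid" where
  "absolute_galois_group =
     \<lparr>carrier = {\<sigma> \<in> extensional sep_closure.
        \<sigma> \<in> ring_iso sep_closure_ring sep_closure_ring \<and> (\<forall>a. \<sigma> (to_ac a) = to_ac a)},
      monoid.mult = compose sep_closure,
      one = (\<lambda>x\<in>sep_closure. x)\<rparr>"

definition finite_separable_subextension :: "'a::field alg_closure set \<Rightarrow> bool" where
  "finite_separable_subextension L \<longleftrightarrow>
     subfield L ring_of_type_algebra \<and> range to_ac \<subseteq> L \<and> L \<subseteq> sep_closure \<and>
     ring.finite_dimension ring_of_type_algebra (range to_ac) L"

definition galois_subgroup ::
    "'a::field alg_closure set \<Rightarrow> ('a alg_closure \<Rightarrow> 'a alg_closure) set" where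
  "galois_subgroup L = {\<sigma> \<in> carrier absolute_galois_group. \<forall>x\<in>L. \<sigma> x = x}"

definition krull_topology :: "('a::field alg_closure \<Rightarrow> 'a alg_closure) topology" where
  "krull_topology = topology_generated_by
     {\<sigma> <#\<^bsub>absolute_galois_group\<^esub> galois_subgroup L | \<sigma> L.
        \<sigma> \<in> carrier absolute_galois_group \<and> finite_separable_subextension L}"

section \<open>Continuous cohomology with trivial mod p coefficients\<close>

text \<open>
  Throughout, \<open>G\<close> is a group, \<open>T\<close> a group topology on its carrier and \<open>Z/p\<close> is
  \<open>residue_ring (int p)\<close>, with carrier \<open>{0..p-1}\<close> and the discrete topology.
  The group of continuous \<open>n\<close>-cochains is \<open>cochain_group p\<close> of the \<open>n\<close>-fold
  product topology; only the degrees up to \<open>3\<close> occur.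
\<close>

definition cochain_group :: "nat \<Rightarrow> 'x topology \<Rightarrow> ('x \<Rightarrow> int) monoid" where
  "cochain_group p U =
     \<lparr>carrier = {f \<in> extensional (topspace U).
        continuous_map U (discrete_topology (carrier (residue_ring (int p)))) f},
      monoid.mult = (\<lambda>f g. \<lambda>x\<in>topspace U. f x \<oplus>\<^bsub>residue_ring (int p)\<^esub> g x),
      one = (\<lambda>x\<in>topspace U. \<zero>\<^bsub>residue_ring (int p)\<^esub>)\<rparr>"

abbreviation C1 :: "nat \<Rightarrow> 'g topology \<Rightarrow> ('g \<Rightarrow> int) monoid" where
  "C1 p T \<equiv> cochain_group p T"

abbreviation C2 :: "nat \<Rightarrow> 'g topology \<Rightarrow> ('g \<times> 'g \<Rightarrow> int) monoid" where
  "C2 p T \<equiv> cochain_group p (prod_topology T T)"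

abbreviation C3 :: "nat \<Rightarrow> 'g topology \<Rightarrow> ('g \<times> 'g \<times> 'g \<Rightarrow> int) monoid" where
  "C3 p T \<equiv> cochain_group p (prod_topology T (prod_topology T T))"

definition coboundary1 :: "nat \<Rightarrow> 'g monoid \<Rightarrow> ('g \<Rightarrow> int) \<Rightarrow> ('g \<times> 'g \<Rightarrow> int)" where
  "coboundary1 p G \<phi> = (\<lambda>(g1, g2) \<in> carrier G \<times> carrier G.
     (\<phi> g1 + \<phi> g2 - \<phi> (g1 \<otimes>\<^bsub>G\<^esub> g2)) mod int p)"

definition coboundary2 ::
    "nat \<Rightarrow> 'g monoid \<Rightarrow> ('g \<times> 'g \<Rightarrow> int) \<Rightarrow> ('g \<times> 'g \<times> 'g \<Rightarrow> int)" where
  "coboundary2 p G \<psi> = (\<lambda>(g1, g2, g3) \<in> carrier G \<times> carrier G \<times> carrier G.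
     (\<psi> (g2, g3) - \<psi> (g1 \<otimes>\<^bsub>G\<^esub> g2, g3) + \<psi> (g1, g2 \<otimes>\<^bsub>G\<^esub> g3) - \<psi> (g1, g2)) mod int p)"

definition cup11 ::
    "nat \<Rightarrow> 'g monoid \<Rightarrow> ('g \<Rightarrow> int) \<Rightarrow> ('g \<Rightarrow> int) \<Rightarrow> ('g \<times> 'g \<Rightarrow> int)" where
  "cup11 p G \<phi> \<psi> = (\<lambda>(g1, g2) \<in> carrier G \<times> carrier G.
     \<phi> g1 \<otimes>\<^bsub>residue_ring (int p)\<^esub> \<psi> g2)"

text \<open>The action is trivial, so degree-one coboundaries vanish and classes are homomorphisms.\<close>

definition H1 :: "nat \<Rightarrow> 'g monoid \<Rightarrow> 'g topology \<Rightarrow> ('g \<Rightarrow> int) set" where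
  "H1 p G T = carrier (C1 p T) \<inter> hom G (add_monoid (residue_ring (int p)))"

definition cocycles2 :: "nat \<Rightarrow> 'g monoid \<Rightarrow> 'g topology \<Rightarrow> ('g \<times> 'g \<Rightarrow> int) monoid" where
  "cocycles2 p G T =
     (C2 p T)\<lparr>carrier := {\<psi> \<in> carrier (C2 p T). coboundary2 p G \<psi> = \<one>\<^bsub>C3 p T\<^esub>}\<rparr>"

definition coboundaries2 :: "nat \<Rightarrow> 'g monoid \<Rightarrow> 'g topology \<Rightarrow> ('g \<times> 'g \<Rightarrow> int) set" where
  "coboundaries2 p G T = coboundary1 p G ` carrier (C1 p T)"

definition H2 :: "nat \<Rightarrow> 'g monoid \<Rightarrow> 'g topology \<Rightarrow> ('g \<times> 'g \<Rightarrow> int) set monoid" where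
  "H2 p G T = cocycles2 p G T Mod coboundaries2 p G T"

definition cohomology_class2 ::
    "nat \<Rightarrow> 'g monoid \<Rightarrow> 'g topology \<Rightarrow> ('g \<times> 'g \<Rightarrow> int) \<Rightarrow> ('g \<times> 'g \<Rightarrow> int) set" where
  "cohomology_class2 p G T \<psi> = coboundaries2 p G T #>\<^bsub>cocycles2 p G T\<^esub> \<psi>"

section \<open>Triple Massey products\<close>

definition defining_system ::
    "nat \<Rightarrow> 'g monoid \<Rightarrow> 'g topology \<Rightarrow> ('g \<Rightarrow> int) \<Rightarrow> ('g \<Rightarrow> int) \<Rightarrow> ('g \<Rightarrow> int)
       \<Rightarrow> ('g \<Rightarrow> int) \<Rightarrow> ('g \<Rightarrow> int) \<Rightarrow> bool" where
  "defining_system p G T \<chi>a \<chi>b \<chi>c \<phi>ab \<phi>bc \<longleftrightarrow>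
     \<phi>ab \<in> carrier (C1 p T) \<and> \<phi>bc \<in> carrier (C1 p T) \<and>
     coboundary1 p G \<phi>ab = cup11 p G \<chi>a \<chi>b \<and>
     coboundary1 p G \<phi>bc = cup11 p G \<chi>b \<chi>c"

definition triple_massey_product ::
    "nat \<Rightarrow> 'g monoid \<Rightarrow> 'g topology \<Rightarrow> ('g \<Rightarrow> int) \<Rightarrow> ('g \<Rightarrow> int) \<Rightarrow> ('g \<Rightarrow> int)
       \<Rightarrow> ('g \<times> 'g \<Rightarrow> int) set set" where
  "triple_massey_product p G T \<chi>a \<chi>b \<chi>c =
     {cohomology_class2 p G T (cup11 p G \<chi>a \<phi>bc \<otimes>\<^bsub>C2 p T\<^esub> cup11 p G \<phi>ab \<chi>c) | \<phi>ab \<phi>bc.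
        defining_system p G T \<chi>a \<chi>b \<chi>c \<phi>ab \<phi>bc}"

text \<open>\<open>H2\<close> is written multiplicatively, so its zero class is \<open>\<one>\<close>.\<close>

definition vanishing_triple_massey_product_property ::
    "nat \<Rightarrow> 'g monoid \<Rightarrow> 'g topology \<Rightarrow> bool" where
  "vanishing_triple_massey_product_property p G T \<longleftrightarrow>
     (\<forall>\<chi>a \<in> H1 p G T. \<forall>\<chi>b \<in> H1 p G T. \<forall>\<chi>c \<in> H1 p G T.
        cohomology_class2 p G T (cup11 p G \<chi>a \<chi>b) = \<one>\<^bsub>H2 p G T\<^esub> \<longrightarrow>
        cohomology_class2 p G T (cup11 p G \<chi>b \<chi>c) = \<one>\<^bsub>H2 p G T\<^esub> \<longrightarrow>
        \<one>\<^bsub>H2 p G T\<^esub> \<in> triple_massey_product p G T \<chi>a \<chi>b \<chi>c)"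

end

(*
  Write everything in terms of G = G_F acting on the multiplicative group M of the separable closure
  (noted additively), in which Z/p is identified with the p-torsion via a root of unity zeta.
  The only input from field theory is Hilbert 90, p-divisibility of M and the description of its
  p-torsion.

  If phi bounds chi_a u chi_b and psi bounds chi_b u chi_c, then Hilbert 90 on ker chi_a and on
  ker chi_c turns phi and psi into presentations of b (the Kummer element of chi_b) as a norm from
  the corresponding fields, and Hilbert 90 on the kernel of chi_a - chi_c compares the two norm
  presentations. The resulting element of M is used to find a character chi_f such that
  chi_a u (psi + chi_f) vanishes on N = ker chi_c. The Massey cocycle is then trivial on N, hence
  of the form eta u chi_c up to a coboundary, and replacing phi by phi - eta kills it.
*)

theory Submission
  imports Defs
begin

section \<open>Kummer formations\<close>

text \<open>Coefficients in M pay off because smooth 1-cocycles with values in M are coboundaries on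
  every subgroup. Hence a 2-class that dies on the kernel of a character comes from the cyclic
  quotient, where only multiples of one cocycle occur: \<open>carry\<close>, the failure of
  representatives in \<open>{0..<p}\<close> to add up. If e = p x, then
  \<open>carry \<kappa> g h \<cdot> e\<close> is, up to a coboundary, a cup product of
  \<open>\<kappa>\<close> with the Kummer character of e; and it is itself a coboundary when e is a
  norm. This dictionary turns cup products into norm questions and back.

  The obstacle is that \<open>\<psi>\<close> is additive only on ker \<open>\<chi>c\<close>, while
  the correction \<open>\<chi>f\<close> has to be a character of all of G. The two norm
  presentations of b come from different cyclic extensions, but where
  \<open>\<chi>a = \<chi>c\<close> their carries coincide and b cancels from the difference. That
  subgroup and one element of ker \<open>\<chi>c\<close> generate G, which is what makes the element
  behind \<open>\<chi>f\<close> invariant.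

  Returning from M to Z/p costs one more use of Hilbert 90. On the field side the laborious point is
  that separable elements form a field.\<close>

definition add_subgroup :: "'g::group_add set \<Rightarrow> bool" where
  "add_subgroup U \<longleftrightarrow> 0 \<in> U \<and> (\<forall>g\<in>U. \<forall>h\<in>U. g + h \<in> U) \<and> (\<forall>g\<in>U. - g \<in> U)"

definition gpow :: "'g::group_add \<Rightarrow> nat \<Rightarrow> 'g" where
  "gpow g n = ((+) g ^^ n) 0"

lemma gpow_0 [simp]: "gpow g 0 = 0"
  by (simp add: gpow_def)

lemma gpow_Suc: "gpow g (Suc n) = g + gpow g n"
  by (simp add: gpow_def)

lemma gpow_add: "gpow g (m + n) = gpow g m + gpow g n"
  by (induction m) (simp_all add: gpow_Suc add.assoc)

lemma gpow_1 [simp]: "gpow g (Suc 0) = g"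
  by (simp add: gpow_Suc)

lemma gpow_commute: "gpow g m + gpow g n = gpow g n + gpow g m"
  by (metis gpow_add add.commute)

lemma gpow_in: "add_subgroup U \<Longrightarrow> g \<in> U \<Longrightarrow> gpow g n \<in> U"
  by (induction n) (auto simp: gpow_Suc add_subgroup_def)

lemma sum_lessThan_add:
  fixes F :: "nat \<Rightarrow> 'm::ab_group_add"
  shows "(\<Sum>i<a + b. F i) = (\<Sum>i<a. F i) + (\<Sum>j<b. F (a + j))"
  by (induction b) (simp_all add: add.assoc)

text \<open>\<open>small\<close> stands for membership in a basis of open subgroups; continuity of a cochain is
  replaced by uniform local constancy (\<open>smooth\<close> below), which for cochains bounding a cup product
  of characters is equivalent.\<close>

locale kummer_formation = Modules.module smul
  for smul :: "int \<Rightarrow> 'm::ab_group_add \<Rightarrow> 'm" (infixr "\<cdot>" 75) +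
  fixes act :: "'g::group_add \<Rightarrow> 'm \<Rightarrow> 'm"
    and p :: nat
    and \<zeta> :: 'm
    and small :: "'g set \<Rightarrow> bool"
  assumes prime_p: "Factorial_Ring.prime p"
    and act_0 [simp]: "act 0 x = x"
    and act_plus: "act (g + h) x = act g (act h x)"
    and act_add: "act g (x + y) = act g x + act g y"
    and act_zeta [simp]: "act g \<zeta> = \<zeta>"
    and p_zeta: "int p \<cdot> \<zeta> = 0"
    and zeta_order: "k \<cdot> \<zeta> = 0 \<Longrightarrow> int p dvd k"
    and torsion: "int p \<cdot> x = 0 \<Longrightarrow> \<exists>k. x = k \<cdot> \<zeta>"
    and divisible: "\<exists>y. int p \<cdot> y = x"
    and small_Int: "small V \<Longrightarrow> small W \<Longrightarrow> small (V \<inter> W)"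
    and small_conj: "small V \<Longrightarrow> small {g. - h + g + h \<in> V}"
    and small_stabilizer: "\<exists>V. small V \<and> (\<forall>v\<in>V. act v x = x)"
    and hilbert90: "add_subgroup U \<Longrightarrow> small V \<Longrightarrow> (\<And>v. v \<in> U \<inter> V \<Longrightarrow> u v = 0) \<Longrightarrow>
      (\<And>g h. g \<in> U \<Longrightarrow> h \<in> U \<Longrightarrow> u (g + h) = u g + act g (u h)) \<Longrightarrow>
      \<exists>y. \<forall>g\<in>U. act g y = y + u g"
begin

lemma act_additive: "Modules.additive (act g)"
  by standard (rule act_add)

lemmas act_zero [simp] = Modules.additive.zero [OF act_additive]
  and act_minus = Modules.additive.minus [OF act_additive]
  and act_diff = Modules.additive.diff [OF act_additive]
  and act_sum = Modules.additive.sum [OF act_additive]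

lemma act_smul: "act g (k \<cdot> x) = k \<cdot> act g x"
proof (induction k rule: int_induct[where k = 0])
  case (step1 i)
  then show ?case by (simp add: scale_left_distrib act_add)
next
  case (step2 i)
  then show ?case by (simp add: scale_left_diff_distrib act_diff)
qed simp

lemmas act_simps = act_add act_minus act_diff act_smul

lemma p_pos: "p > 0" and p_gt_1: "p > 1"
  using prime_p prime_gt_1_nat by (auto intro: prime_gt_0_nat)

lemma p_smul_zeta [simp]: "int p \<cdot> (k \<cdot> \<zeta>) = 0"
  by (metis p_zeta scale_left_commute scale_zero_right)

text \<open>Z/p sits in M as the multiples of \<open>\<zeta>\<close>, so congruences between
  cochains can be computed as equations in M.\<close>

lemma zeta_cong: "[i = j] (mod int p) \<longleftrightarrow> i \<cdot> \<zeta> = j \<cdot> \<zeta>"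
proof
  assume "[i = j] (mod int p)"
  then obtain k where "i = j + int p * k"
    by (metis cong_iff_lin cong_sym mult.commute)
  then show "i \<cdot> \<zeta> = j \<cdot> \<zeta>"
    by (simp add: scale_left_distrib mult.commute p_zeta flip: scale_scale)
next
  assume "i \<cdot> \<zeta> = j \<cdot> \<zeta>"
  then have "(i - j) \<cdot> \<zeta> = 0" by (simp add: scale_left_diff_distrib)
  then show "[i = j] (mod int p)" using zeta_order by (simp add: cong_iff_dvd_diff)
qed

definition smooth :: "('g \<Rightarrow> 'b) \<Rightarrow> bool" where
  "smooth f \<longleftrightarrow> (\<exists>V. small V \<and> (\<forall>g. \<forall>v\<in>V. f (g + v) = f g))"

lemma smooth_const [intro, simp]: "smooth (\<lambda>g. c)"
  using small_stabilizer unfolding smooth_def by fast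

lemma smooth_compose2: "smooth f \<Longrightarrow> smooth f' \<Longrightarrow> smooth (\<lambda>g. F (f g) (f' g))"
  unfolding smooth_def using small_Int by (metis IntD1 IntD2)

lemma smooth_compose: "smooth f \<Longrightarrow> smooth (\<lambda>g. F (f g))"
  unfolding smooth_def by metis

lemma smooth_act [intro, simp]: "smooth (\<lambda>g. act g x)"
  unfolding smooth_def using small_stabilizer act_plus by metis

lemmas smooth_arith =
  smooth_compose2[where F = "(+)"] smooth_compose2[where F = "(-)"]
  smooth_compose2[where F = "(*)"] smooth_compose[where F = uminus]
  smooth_compose2[where F = "smul"]  smooth_compose[where F = "act h" for h]

section \<open>Characters mod p through integer representatives\<close>

definition character :: "('g \<Rightarrow> int) \<Rightarrow> bool" where
  "character \<kappa> \<longleftrightarrow> smooth \<kappa> \<and> (\<forall>g. 0 \<le> \<kappa> g \<and> \<kappa> g < int p) \<and>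
     (\<forall>g h. \<kappa> (g + h) = (\<kappa> g + \<kappa> h) mod int p)"

text \<open>Characters have integer values so that they can scale elements of M; the price is
  additivity only mod p. The defect is the cocycle of the extension of Z/p by Z, pulled back along
  \<open>\<kappa>\<close>.\<close>

definition carry :: "('g \<Rightarrow> int) \<Rightarrow> 'g \<Rightarrow> 'g \<Rightarrow> int" where
  "carry \<kappa> g h = (\<kappa> g + \<kappa> h) div int p"

context
  fixes \<kappa> :: "'g \<Rightarrow> int"
  assumes \<kappa>: "character \<kappa>"
begin

lemma character_smooth: "smooth \<kappa>"
  and character_range: "0 \<le> \<kappa> g" "\<kappa> g < int p"
  and character_add: "\<kappa> (g + h) = (\<kappa> g + \<kappa> h) mod int p"
  using \<kappa> by (auto simp: character_def)

lemma character_mod [simp]: "\<kappa> g mod int p = \<kappa> g"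
  using character_range by simp

lemma character_cong: "[\<kappa> (g + h) = \<kappa> g + \<kappa> h] (mod int p)"
  by (simp add: character_add cong_def)

lemma character_0 [simp]: "\<kappa> 0 = 0"
proof -
  have "[\<kappa> 0 + \<kappa> 0 = \<kappa> 0 + 0] (mod int p)"
    using character_cong[of 0 0] by (simp add: cong_sym)
  then have "[\<kappa> 0 = 0] (mod int p)" by (simp only: cong_add_lcancel)
  then show ?thesis by (simp add: cong_def)
qed

lemma character_minus: "[\<kappa> (- g) = - \<kappa> g] (mod int p)"
proof -
  have "[\<kappa> g + \<kappa> (- g) = \<kappa> g + - \<kappa> g] (mod int p)"
    using character_cong[of g "- g"] by (simp add: cong_sym)
  then show ?thesis by (simp only: cong_add_lcancel)
qed

lemma character_eqI: "[\<kappa> g = k] (mod int p) \<Longrightarrow> 0 \<le> k \<Longrightarrow> k < int p \<Longrightarrow> \<kappa> g = k"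
  using character_range by (simp add: cong_def)

lemma character_diff_eq_0_iff: "\<kappa> (- g + h) = 0 \<longleftrightarrow> \<kappa> g = \<kappa> h"
proof -
  have "[\<kappa> (- g + h) = \<kappa> h - \<kappa> g] (mod int p)"
    using cong_trans[OF character_cong cong_add[OF character_minus cong_refl]] by simp
  then have "\<kappa> (- g + h) = 0 \<longleftrightarrow> [\<kappa> h - \<kappa> g = 0] (mod int p)"
    by (metis character_mod cong_def mod_0)
  also have "\<dots> \<longleftrightarrow> [\<kappa> h = \<kappa> g] (mod int p)"
    by (simp add: cong_diff_iff_cong_0)
  finally show ?thesis by (auto simp: cong_def)
qed

lemma carry: "int p * carry \<kappa> g h = \<kappa> g + \<kappa> h - \<kappa> (g + h)"
  by (simp add: carry_def character_add minus_mod_eq_mult_div [symmetric])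

text \<open>The right side is the coboundary of \<open>\<kappa> \<cdot> x\<close> except that the
  action on x is left out. Restoring the action adds a cup product with the Kummer character of
  \<open>int p \<cdot> x\<close>.\<close>

lemma carry_scale: "carry \<kappa> g h \<cdot> (int p \<cdot> x) = \<kappa> g \<cdot> x + \<kappa> h \<cdot> x - \<kappa> (g + h) \<cdot> x"
  by (simp add: mult.commute[of "carry \<kappa> g h"] carry algebra_simps)

lemma carry_eq_0 [simp]: "\<kappa> g = 0 \<Longrightarrow> carry \<kappa> g h = 0" "\<kappa> h = 0 \<Longrightarrow> carry \<kappa> g h = 0"
  using character_range by (simp_all add: carry_def)

lemma add_subgroup_kernel: "add_subgroup {g. \<kappa> g = 0}"
  unfolding add_subgroup_def using character_add character_diff_eq_0_iff[of _ 0] by simp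

lemma character_gpow: "\<kappa> g = 1 \<Longrightarrow> \<kappa> (gpow g n) = int n mod int p"
  by (induction n) (simp_all add: gpow_Suc character_add mod_simps)

lemma character_conj: "\<kappa> (- h + g + h) = 0 \<longleftrightarrow> \<kappa> g = 0"
proof -
  have "\<kappa> (- h + g + h) = 0 \<longleftrightarrow> \<kappa> h = \<kappa> (g + h)"
    by (simp add: add.assoc character_diff_eq_0_iff)
  also have "\<dots> \<longleftrightarrow> [0 + \<kappa> h = \<kappa> g + \<kappa> h] (mod int p)"
    by (auto simp: character_add cong_def)
  also have "\<dots> \<longleftrightarrow> [0 = \<kappa> g] (mod int p)" by (simp only: cong_add_rcancel)
  also have "\<dots> \<longleftrightarrow> \<kappa> g = 0" by (auto simp: cong_def)
  finally show ?thesis .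
qed

end

lemma characterI:
  assumes "smooth \<eta>" and "\<And>g h. [\<eta> (g + h) = \<eta> g + \<eta> h] (mod int p)"
  shows "character (\<lambda>g. \<eta> g mod int p)"
  using assms p_pos smooth_compose[OF assms(1), of "\<lambda>k. k mod int p"]
  by (auto simp: character_def cong_def mod_simps)

section \<open>Kummer theory\<close>

lemma smooth_cocycle_small:
  assumes "smooth u" "u 0 = 0"
  obtains V where "small V" "\<And>v. v \<in> V \<Longrightarrow> u v = 0"
  using assms unfolding smooth_def by (metis add_0)

text \<open>As \<open>\<zeta>\<close> is fixed by the action, \<open>\<eta> \<cdot> \<zeta>\<close>
  is a cocycle on U and Hilbert 90 applies. Additivity is asked on U alone, since a cochain bounding
  a cup product is additive only on the kernel of one factor.\<close>

lemma kummer_generator: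
  assumes U: "add_subgroup U" and sm: "smooth \<eta>"
    and hom: "\<And>g h. g \<in> U \<Longrightarrow> h \<in> U \<Longrightarrow> [\<eta> (g + h) = \<eta> g + \<eta> h] (mod int p)"
  obtains y where "\<And>g. g \<in> U \<Longrightarrow> act g y = y + \<eta> g \<cdot> \<zeta>"
proof -
  let ?u = "\<lambda>g. \<eta> g \<cdot> \<zeta>"
  have add: "?u (g + h) = ?u g + act g (?u h)" if "g \<in> U" "h \<in> U" for g h
    using hom[OF that] by (simp add: zeta_cong act_simps scale_left_distrib)
  have "0 \<in> U" using U by (simp add: add_subgroup_def)
  from add[OF this this] have u_0: "?u 0 = 0" by simp
  have "smooth ?u" by (rule smooth_compose[OF sm])
  from smooth_cocycle_small[OF this u_0] obtain V where "small V" "\<And>v. v \<in> V \<Longrightarrow> ?u v = 0"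
    by blast
  then show ?thesis using that hilbert90[OF U, of V ?u] add by blast
qed

text \<open>Two p-th roots of an invariant element differ by a multiple of \<open>\<zeta>\<close>,
  and this multiple is additive in g because \<open>\<zeta>\<close> is fixed.\<close>

lemma kummer_character:
  assumes inv: "\<And>g. act g e = e"
  obtains x \<kappa> where "character \<kappa>" "int p \<cdot> x = e" "\<And>g. act g x = x + \<kappa> g \<cdot> \<zeta>"
proof -
  obtain x where x: "int p \<cdot> x = e" using divisible by blast
  have "\<exists>k. act g x - x = k \<cdot> \<zeta>" for g
    using torsion[of "act g x - x"] x inv[of g] by (simp add: scale_right_diff_distrib flip: act_smul)
  then obtain k where "\<And>g. act g x - x = k g \<cdot> \<zeta>" by metis
  then have k: "act g x = x + (k g mod int p) \<cdot> \<zeta>" for g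
    by (metis add.commute cong_mod_left cong_refl diff_add_cancel zeta_cong)
  define \<kappa> where "\<kappa> g = k g mod int p" for g
  have act: "act g x = x + \<kappa> g \<cdot> \<zeta>" for g using k by (simp add: \<kappa>_def)
  \<comment> \<open>The exponent \<open>k\<close> was chosen separately for each g. Its residue is
    determined by \<open>act g x\<close> and so inherits smoothness.\<close>
  have "\<kappa> g = \<kappa> h" if "act g x = act h x" for g h
    using that act zeta_cong[of "\<kappa> g" "\<kappa> h"] by (simp add: cong_def \<kappa>_def)
  moreover have "smooth (\<lambda>g. act g x)" by simp
  ultimately have sm: "smooth \<kappa>" unfolding smooth_def by metis
  have "[\<kappa> (g + h) = \<kappa> g + \<kappa> h] (mod int p)" for g h
  proof -
    have "x + \<kappa> (g + h) \<cdot> \<zeta> = act g (act h x)" by (simp only: act_plus flip: act)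
    also have "\<dots> = x + (\<kappa> g + \<kappa> h) \<cdot> \<zeta>" by (simp add: act act_simps algebra_simps)
    finally show ?thesis by (simp add: zeta_cong)
  qed
  from characterI[OF sm this] have "character \<kappa>"
    by (simp add: \<kappa>_def [abs_def])
  with x act that show ?thesis by blast
qed

section \<open>Cup products with a cyclic character\<close>

text \<open>Applying g shifts a run of conjugates by \<open>\<kappa> g\<close> places, so the two
  runs join into one. If its length reaches p, a full period splits off, which is the norm of
  \<open>\<delta>\<close>, and exactly then the carry is 1. Hence \<open>carry\<close> times a norm
  is a coboundary.\<close>

lemma cyclic_sum_cocycle:
  assumes N: "add_subgroup N" and \<kappa>: "character \<kappa>" and \<tau>: "\<tau> \<in> N" "\<kappa> \<tau> = 1"
    and fixed: "\<And>g. g \<in> N \<Longrightarrow> \<kappa> g = 0 \<Longrightarrow> act g \<delta> = \<delta>"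
  defines "s \<equiv> \<lambda>g. \<Sum>i<nat (\<kappa> g). act (gpow \<tau> i) \<delta>"
  assumes gh: "g \<in> N" "h \<in> N"
  shows "s g + act g (s h) = s (g + h) + carry \<kappa> g h \<cdot> (\<Sum>i<p. act (gpow \<tau> i) \<delta>)"
proof -
  define D where "D i = act (gpow \<tau> i) \<delta>" for i
  \<comment> \<open>A conjugate depends only on the value of \<open>\<kappa>\<close>:
    \<open>- gpow \<tau> i + k\<close> lies in N and in the kernel of \<open>\<kappa>\<close>, so it
    fixes \<open>\<delta>\<close>.\<close>
  have D: "act k \<delta> = D i" if "k \<in> N" "\<kappa> k = int i mod int p" for k i
  proof -
    have "act (- gpow \<tau> i + k) \<delta> = \<delta>"
      using that N \<tau> gpow_in[of N \<tau> i]
      by (intro fixed) (auto simp: character_diff_eq_0_iff \<kappa> character_gpow add_subgroup_def)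
    then have "act (gpow \<tau> i) (act (- gpow \<tau> i + k) \<delta>) = D i" by (simp add: D_def)
    then show ?thesis by (simp flip: act_plus)
  qed
  have shift: "act g (D j) = D (nat (\<kappa> g) + j)" for j
  proof -
    have "g + gpow \<tau> j \<in> N" using N gh gpow_in[OF N \<tau>(1)] by (simp add: add_subgroup_def)
    moreover have "\<kappa> (g + gpow \<tau> j) = int (nat (\<kappa> g) + j) mod int p"
      using character_range[OF \<kappa>] \<kappa> \<tau> by (simp add: character_add character_gpow mod_simps)
    ultimately show ?thesis using D by (simp add: D_def flip: act_plus)
  qed
  have period: "D (p + i) = D i" for i
    using D[of "gpow \<tau> (p + i)" i] N \<tau> gpow_in[of N \<tau>] \<kappa>
    by (simp add: D_def character_gpow)
  have "s g + act g (s h) = (\<Sum>i<nat (\<kappa> g) + nat (\<kappa> h). D i)"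
    by (simp add: s_def D_def[symmetric] act_sum shift sum_lessThan_add)
  also have "\<dots> = s (g + h) + carry \<kappa> g h \<cdot> (\<Sum>i<p. D i)"
  proof (cases "\<kappa> g + \<kappa> h < int p")
    case True
    then have "carry \<kappa> g h = 0" "\<kappa> (g + h) = \<kappa> g + \<kappa> h"
      using character_range[OF \<kappa>] by (simp_all add: carry_def character_add \<kappa>)
    then show ?thesis
      using character_range[OF \<kappa>] by (simp add: s_def D_def nat_add_distrib)
  next
    case False
    then have "(\<kappa> g + \<kappa> h) div int p = 1"
      using character_range[OF \<kappa>, of g] character_range[OF \<kappa>, of h]
      by (intro int_div_pos_eq[where r = "\<kappa> g + \<kappa> h - int p"]) auto
    then have c: "carry \<kappa> g h = 1" by (simp add: carry_def)
    with carry[OF \<kappa>, of g h] have "nat (\<kappa> g) + nat (\<kappa> h) = p + nat (\<kappa> (g + h))"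
      using character_range[OF \<kappa>, of g] character_range[OF \<kappa>, of h]
        character_range[OF \<kappa>, of "g + h"] by simp
    then show ?thesis by (simp add: c sum_lessThan_add s_def period flip: D_def)
  qed
  finally show ?thesis by (simp add: D_def)
qed

lemma sum_mod_shift:
  fixes T :: "nat \<Rightarrow> 'm"
  shows "(\<Sum>i<p. T ((i + c) mod p)) = (\<Sum>i<p. T i)"
proof (induction c)
  case (Suc c)
  obtain q where q: "p = Suc q" using p_pos gr0_implies_Suc by blast
  have "(\<Sum>i<p. T ((i + Suc c) mod p)) = (\<Sum>i<q. T ((Suc i + c) mod p)) + T (c mod p)"
    by (subst q, subst sum.lessThan_Suc) (simp add: q, metis add_Suc_right add.commute mod_add_self2)
  also have "\<dots> = (\<Sum>i<p. T ((i + c) mod p))"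
    by (subst (3) q, subst sum.lessThan_Suc_shift) (simp add: add.commute)
  finally show ?case using Suc by simp
qed simp

text \<open>Sum the identity for \<open>t\<close> over \<open>g = gpow \<tau> i\<close>. As
  \<open>t\<close> factors through \<open>\<kappa>\<close>, the terms \<open>t (g + h)\<close> are a
  rotation of the terms \<open>t g\<close> and cancel them; adding \<open>\<kappa> h\<close> to each
  residue produces \<open>\<kappa> h\<close> carries in all. For \<open>\<kappa> h = 1\<close> this
  says that \<open>t h\<close> has norm \<open>b\<close>.\<close>

lemma sum_conjugates_eq_carry:
  assumes \<kappa>: "character \<kappa>" and \<tau>: "\<kappa> \<tau> = 1"
    and t: "\<And>g h. t g + act g (t h) = t (g + h) + carry \<kappa> g h \<cdot> b"
    and t_eq: "\<And>g h. \<kappa> g = \<kappa> h \<Longrightarrow> t g = t h"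
  shows "(\<Sum>i<p. act (gpow \<tau> i) (t h)) = \<kappa> h \<cdot> b"
proof -
  let ?c = "nat (\<kappa> h)"
  have shift: "\<kappa> (gpow \<tau> i + h) = int ((i + ?c) mod p)" for i
    using character_range[OF \<kappa>] \<kappa> \<tau>
    by (simp add: character_add character_gpow zmod_int mod_simps)
  have gp: "\<kappa> (gpow \<tau> i) = int (i mod p)" for i
    using \<kappa> \<tau> by (simp add: character_gpow zmod_int)
  have "int p * (\<Sum>i<p. carry \<kappa> (gpow \<tau> i) h)
      = (\<Sum>i<p. int (i mod p) + \<kappa> h - int ((i + ?c) mod p))"
    by (simp add: sum_distrib_left carry[OF \<kappa>] shift gp)
  also have "\<dots> = (\<Sum>i<p. int i) + int p * \<kappa> h - (\<Sum>i<p. int ((i + ?c) mod p))"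
    by (simp add: sum.distrib sum_subtractf)
  also have "(\<Sum>i<p. int ((i + ?c) mod p)) = (\<Sum>i<p. int i)"
  proof -
    have "bij_betw (\<lambda>i. (i + ?c) mod p) {..<p} {..<p}"
    proof (rule bij_betwI')
      fix i j assume "i \<in> {..<p}" "j \<in> {..<p}"
      then show "(i + ?c) mod p = (j + ?c) mod p \<longleftrightarrow> i = j"
        using cong_add_rcancel_nat[of i ?c j p] by (auto simp: cong_def)
    next
      fix j assume "j \<in> {..<p}"
      \<comment> \<open>The preimage of j is j - \<open>\<kappa> h\<close> mod p; adding p first
        avoids truncated subtraction.\<close>
      then have "(((j + (p - ?c)) mod p) + ?c) mod p = j"
        using character_range[OF \<kappa>, of h] by (simp add: mod_simps)
      then show "\<exists>i\<in>{..<p}. j = (i + ?c) mod p"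
        using p_pos by (metis lessThan_iff mod_less_divisor)
    qed (use p_pos in simp)
    then show ?thesis by (rule sum.reindex_bij_betw)
  qed
  finally have c: "(\<Sum>i<p. carry \<kappa> (gpow \<tau> i) h) = \<kappa> h" using p_pos by simp
  have "act g (t h) = t (g + h) + carry \<kappa> g h \<cdot> b - t g" for g
    using t[of g h] by (simp add: algebra_simps)
  then have "(\<Sum>i<p. act (gpow \<tau> i) (t h))
      = (\<Sum>i<p. t (gpow \<tau> i + h) + carry \<kappa> (gpow \<tau> i) h \<cdot> b - t (gpow \<tau> i))"
    by simp
  also have "\<dots> = (\<Sum>i<p. t (gpow \<tau> i + h)) + \<kappa> h \<cdot> b - (\<Sum>i<p. t (gpow \<tau> i))"
    by (simp add: sum.distrib sum_subtractf c flip: scale_sum_left)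
  also have "(\<Sum>i<p. t (gpow \<tau> i + h)) = (\<Sum>i<p. t (gpow \<tau> ((i + ?c) mod p)))"
    by (intro sum.cong t_eq refl) (simp add: shift gp)
  also have "\<dots> = (\<Sum>i<p. t (gpow \<tau> i))"
    by (rule sum_mod_shift)
  finally show ?thesis by simp
qed

text \<open>If \<open>b\<close> is the Kummer class of \<open>\<chi>\<^sub>b\<close> and \<open>\<eta>\<close> bounds
  \<open>\<chi>\<^sub>b \<union> \<kappa>\<close>, then \<open>t\<close> exhibits \<open>b\<close> as a norm from
  the fixed field of the kernel of \<open>\<kappa>\<close>.\<close>

lemma norm_witness:
  assumes \<kappa>: "character \<kappa>" and xb: "\<And>g. act g xb = xb + \<chi>b g \<cdot> \<zeta>"
    and sm: "smooth \<eta>"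
    and \<eta>: "\<And>g h. [\<eta> g + \<eta> h - \<eta> (g + h) = \<chi>b g * \<kappa> h] (mod int p)"
  obtains y t where "\<And>g. act g y = y + \<kappa> g \<cdot> xb - \<eta> g \<cdot> \<zeta> - t g"
    "\<And>g. \<kappa> g = 0 \<Longrightarrow> t g = 0"
    "\<And>g h. t g + act g (t h) = t (g + h) + carry \<kappa> g h \<cdot> (int p \<cdot> xb)"
    "\<And>g h. \<kappa> g = \<kappa> h \<Longrightarrow> t g = t h"
    "\<And>n g. \<kappa> n = 0 \<Longrightarrow> act n (t g) = t g"
    "smooth t"
proof -
  let ?N = "{g. \<kappa> g = 0}"
  \<comment> \<open>The cup product vanishes on the kernel of \<open>\<kappa>\<close>, so
    \<open>\<eta>\<close> is additive there and has a Kummer generator.\<close>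
  obtain y where y: "\<And>g. \<kappa> g = 0 \<Longrightarrow> act g y = y + (- \<eta> g) \<cdot> \<zeta>"
  proof (rule kummer_generator[of ?N "\<lambda>g. - \<eta> g"])
    show "add_subgroup ?N" by (rule add_subgroup_kernel[OF \<kappa>])
    show "smooth (\<lambda>g. - \<eta> g)" using sm by (intro smooth_arith)
    show "[- \<eta> (g + h) = - \<eta> g + - \<eta> h] (mod int p)" if "g \<in> ?N" "h \<in> ?N" for g h
      using \<eta>[of g h] that by (simp add: cong_iff_dvd_diff algebra_simps)
  qed auto
  \<comment> \<open>The coboundary of \<open>\<kappa> \<cdot> xb\<close> is \<open>carry\<close>
    times \<open>int p \<cdot> xb\<close> plus the cup product of \<open>\<chi>b\<close> and
    \<open>\<kappa>\<close>; subtracting \<open>\<eta> \<cdot> \<zeta>\<close> removes the cup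
    product. The coboundary of \<open>y\<close> then makes \<open>t\<close> vanish on the kernel, so
    that it descends to the cyclic quotient.\<close>
  define t where "t g = \<kappa> g \<cdot> xb - \<eta> g \<cdot> \<zeta> - (act g y - y)" for g
  have t0: "t g = 0" if "\<kappa> g = 0" for g using y[OF that] that by (simp add: t_def)
  have cocycle: "t g + act g (t h) = t (g + h) + carry \<kappa> g h \<cdot> (int p \<cdot> xb)" for g h
  proof -
    have "(\<eta> g + \<eta> h - \<chi>b g * \<kappa> h) \<cdot> \<zeta> = \<eta> (g + h) \<cdot> \<zeta>"
      unfolding zeta_cong [symmetric] using \<eta>[of g h]
      by (simp add: cong_iff_dvd_diff algebra_simps)
    from this [symmetric] show ?thesis
      unfolding carry_scale[OF \<kappa>]
      by (simp add: t_def act_simps act_plus xb algebra_simps)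
  qed
  have t_eq: "t g = t h" if "\<kappa> g = \<kappa> h" for g h
  proof -
    have "\<kappa> (- g + h) = 0" using that by (simp add: character_diff_eq_0_iff[OF \<kappa>])
    then show ?thesis using cocycle[of g "- g + h"] t0 \<kappa> by simp
  qed
  have inv: "act n (t g) = t g" if "\<kappa> n = 0" for n g
    using cocycle[of n g] t_eq[of "n + g" g] that t0 \<kappa> by (simp add: character_add)
  have sm_t: "smooth t"
    using character_smooth[OF \<kappa>] sm unfolding t_def by (intro smooth_arith) auto
  have act_y: "act g y = y + \<kappa> g \<cdot> xb - \<eta> g \<cdot> \<zeta> - t g" for g by (simp add: t_def)
  show ?thesis by (rule that[OF act_y t0 cocycle t_eq inv sm_t])
qed

section \<open>Vanishing of the Massey product in a Kummer formation\<close>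

text \<open>A nonzero residue is invertible mod the prime p, so a suitable multiple of g
  works.\<close>

lemma character_kernel_scale:
  assumes \<kappa>: "character \<kappa>" and U: "add_subgroup U" and g: "g \<in> U" "\<kappa> g \<noteq> 0"
  obtains \<tau> where "\<tau> \<in> U" "\<kappa> \<tau> = 1"
proof -
  have pow: "[\<kappa> (gpow g n) = int n * \<kappa> g] (mod int p)" for n
  proof (induction n)
    case (Suc n)
    have "[\<kappa> g + \<kappa> (gpow g n) = \<kappa> g + int n * \<kappa> g] (mod int p)"
      using Suc by (intro cong_add) auto
    with character_cong[OF \<kappa>, of g "gpow g n"] show ?case
      by (simp add: gpow_Suc algebra_simps) (metis cong_trans)
  qed (simp add: \<kappa>)
  have "\<not> p dvd nat (\<kappa> g)"
    using character_range[OF \<kappa>, of g] g by (auto dest!: dvd_imp_le)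
  then have "coprime (nat (\<kappa> g)) p"
    using prime_p prime_imp_coprime coprime_commute by blast
  then obtain n where "[nat (\<kappa> g) * n = 1] (mod p)"
    using cong_solve_coprime_nat by auto
  then have "[\<kappa> g * int n = 1] (mod int p)"
    using character_range[OF \<kappa>, of g] by (metis cong_int_iff int_nat_eq of_nat_1 of_nat_mult)
  then have "[\<kappa> (gpow g n) = 1] (mod int p)"
    using pow[of n] by (simp add: mult.commute) (metis cong_trans)
  then have "\<kappa> (gpow g n) = 1" using p_gt_1 by (intro character_eqI[OF \<kappa>]) auto
  then show ?thesis using that gpow_in[OF U g(1)] by blast
qed

text \<open>The key step: after twisting \<open>\<psi>\<close> by a character, \<open>\<chi>\<^sub>a \<union> \<psi>\<close>
  becomes trivial on the kernel of \<open>\<chi>\<^sub>c\<close>. Both \<open>t'\<close> (for \<open>\<chi>\<^sub>a\<close>) and \<open>t\<close> (for \<open>\<chi>\<^sub>c\<close>)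
  present \<open>b\<close> as a norm, hence differ by a cocycle on the subgroup where \<open>\<chi>\<^sub>a = \<chi>\<^sub>c\<close>;
  Hilbert 90 there yields \<open>\<delta>\<close>, and the twist is the Kummer character of
  \<open>p y + N\<^sub>\<tau> \<delta>\<close>.\<close>

lemma cup_trivial_on_kernel:
  assumes \<chi>a: "character \<chi>a" and \<chi>b: "character \<chi>b" and \<chi>c: "character \<chi>c"
    and sm: "smooth \<phi>" "smooth \<psi>"
    and \<phi>: "\<And>g h. [\<phi> g + \<phi> h - \<phi> (g + h) = \<chi>a g * \<chi>b h] (mod int p)"
    and \<psi>: "\<And>g h. [\<psi> g + \<psi> h - \<psi> (g + h) = \<chi>b g * \<chi>c h] (mod int p)"
  obtains \<chi>f u where "character \<chi>f" "smooth u"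
    "\<And>g h. \<chi>c g = 0 \<Longrightarrow> \<chi>c h = 0 \<Longrightarrow>
       u g + act g (u h) - u (g + h) = (\<chi>a g * (\<psi> h + \<chi>f h)) \<cdot> \<zeta>"
proof (cases "\<exists>g. \<chi>c g = 0 \<and> \<chi>a g \<noteq> 0")
  case False
  show ?thesis
  \<comment> \<open>Here \<open>\<chi>a\<close> is zero on the kernel of \<open>\<chi>c\<close>, and
    so is the cup product.\<close>
  proof (rule that[of "\<lambda>g. 0" "\<lambda>g. 0"])
    show "character (\<lambda>g. 0)" using p_pos by (simp add: character_def)
  qed (use False in auto)
next
  case True
  let ?N = "{g. \<chi>c g = 0}"
  note N = add_subgroup_kernel[OF \<chi>c]
  obtain \<tau> where \<tau>: "\<tau> \<in> ?N" "\<chi>a \<tau> = 1"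
    using True character_kernel_scale[OF \<chi>a N] by blast
  obtain xb where xb: "\<And>g. act g xb = xb + \<chi>b g \<cdot> \<zeta>"
  proof (rule kummer_generator[of UNIV \<chi>b])
    show "add_subgroup UNIV" by (simp add: add_subgroup_def)
  qed (use character_smooth[OF \<chi>b] character_cong[OF \<chi>b] in auto)
  define b where "b = int p \<cdot> xb"
  obtain y t where y: "\<And>g. act g y = y + \<chi>c g \<cdot> xb - \<psi> g \<cdot> \<zeta> - t g"
    and t: "\<And>g. \<chi>c g = 0 \<Longrightarrow> t g = 0"
      "\<And>g h. t g + act g (t h) = t (g + h) + carry \<chi>c g h \<cdot> b"
      "\<And>g h. \<chi>c g = \<chi>c h \<Longrightarrow> t g = t h"
      "\<And>n g. \<chi>c n = 0 \<Longrightarrow> act n (t g) = t g" "smooth t"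
    by (rule norm_witness[OF \<chi>c xb sm(2) \<psi>, folded b_def]) (rule that)
  \<comment> \<open>Anticommutativity on cochains: the coboundary of the pointwise product
    \<open>\<chi>a g * \<chi>b g\<close> is minus the sum of the cup products in both orders.
    \<open>norm_witness\<close> expects \<open>\<chi>b\<close> as the first factor.\<close>
  define \<phi>' where "\<phi>' g = - \<phi> g - \<chi>a g * \<chi>b g" for g
  have \<phi>'_cup: "[\<phi>' g + \<phi>' h - \<phi>' (g + h) = \<chi>b g * \<chi>a h] (mod int p)" for g h
  proof -
    have "[\<chi>a (g + h) * \<chi>b (g + h) = (\<chi>a g + \<chi>a h) * (\<chi>b g + \<chi>b h)] (mod int p)"
      by (intro cong_mult character_cong \<chi>a \<chi>b)
    from cong_diff[OF this \<phi>[of g h]] show ?thesis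
      by (simp add: \<phi>'_def cong_iff_dvd_diff algebra_simps)
  qed
  have sm': "smooth \<phi>'"
    unfolding \<phi>'_def using sm character_smooth \<chi>a \<chi>b by (intro smooth_arith)
  obtain y' t' where "\<And>g. act g y' = y' + \<chi>a g \<cdot> xb - \<phi>' g \<cdot> \<zeta> - t' g"
    and t': "\<And>g. \<chi>a g = 0 \<Longrightarrow> t' g = 0"
      "\<And>g h. t' g + act g (t' h) = t' (g + h) + carry \<chi>a g h \<cdot> b"
      "\<And>g h. \<chi>a g = \<chi>a h \<Longrightarrow> t' g = t' h"
      "\<And>n g. \<chi>a n = 0 \<Longrightarrow> act n (t' g) = t' g" "smooth t'"
    by (rule norm_witness[OF \<chi>a xb sm' \<phi>'_cup, folded b_def]) (rule that)
  let ?D = "{g. \<chi>a g = \<chi>c g}"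
  have D: "add_subgroup ?D"
    unfolding add_subgroup_def
  proof (intro conjI ballI)
    fix g assume "g \<in> ?D"
    then have "[\<chi>a (- g) = \<chi>c (- g)] (mod int p)"
      using character_minus[OF \<chi>a, of g] character_minus[OF \<chi>c, of g]
      by simp (metis cong_sym cong_trans)
    then show "- g \<in> ?D" using \<chi>a \<chi>c by (simp add: cong_def)
  qed (simp_all add: \<chi>a \<chi>c character_add)
  obtain V where "small V" "\<And>v. v \<in> V \<Longrightarrow> t v - t' v = 0"
  proof (rule smooth_cocycle_small[of "\<lambda>g. t g - t' g"])
    show "smooth (\<lambda>g. t g - t' g)" using t t' by (intro smooth_arith)
  qed (simp_all add: t(1) t'(1) \<chi>a \<chi>c)
  moreover have "t (g + h) - t' (g + h) = t g - t' g + act g (t h - t' h)"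
    if "g \<in> ?D" "h \<in> ?D" for g h
  proof -
    have "carry \<chi>a g h = carry \<chi>c g h" using that by (simp add: carry_def)
    then show ?thesis using t(2)[of g h] t'(2)[of g h] by (simp add: act_diff algebra_simps)
  qed
  ultimately obtain \<delta> where "\<forall>g\<in>?D. act g \<delta> = \<delta> + (t g - t' g)"
    using hilbert90[OF D, of V "\<lambda>g. t g - t' g"] by blast
  then have \<delta>: "\<And>g. \<chi>a g = \<chi>c g \<Longrightarrow> act g \<delta> = \<delta> + (t g - t' g)" by blast
  have \<delta>_fixed: "act g \<delta> = \<delta>" if "\<chi>a g = 0" "\<chi>c g = 0" for g
    using \<delta>[of g] that t(1) t'(1) by simp
  define N\<delta> where "N\<delta> = (\<Sum>i<p. act (gpow \<tau> i) \<delta>)"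
  \<comment> \<open>If \<open>int p \<cdot> xf = f\<close>, then \<open>y - xf\<close> has p-th
    multiple \<open>- N\<delta>\<close>, so the Kummer element of \<open>\<psi> + \<chi>f\<close> on
    ker \<open>\<chi>c\<close> becomes the norm \<open>N\<delta>\<close>. For \<open>xf\<close> to
    define a character of the whole group, \<open>f\<close> must be invariant under all of
    it.\<close>
  define f where "f = int p \<cdot> y + N\<delta>"
  have \<tau>_fixed: "act \<tau> N\<delta> = N\<delta>"
  proof -
    obtain q where q: "p = Suc q" using p_pos gr0_implies_Suc by blast
    have "act (gpow \<tau> p) \<delta> = \<delta>"
      using gpow_in[OF N \<tau>(1)] \<tau> \<chi>a by (intro \<delta>_fixed) (simp_all add: character_gpow)
    have "act \<tau> N\<delta> = (\<Sum>i<p. act (gpow \<tau> (Suc i)) \<delta>)"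
      by (simp add: N\<delta>_def act_sum gpow_Suc act_plus)
    also have "\<dots> = (\<Sum>i<q. act (gpow \<tau> (Suc i)) \<delta>) + \<delta>"
      using \<open>act (gpow \<tau> p) \<delta> = \<delta>\<close> by (simp add: q)
    also have "\<dots> = N\<delta>"
      unfolding N\<delta>_def q by (subst sum.lessThan_Suc_shift) (simp add: add.commute)
    finally show ?thesis .
  qed
  have kernel_y: "act n (int p \<cdot> y) = int p \<cdot> y" if "\<chi>c n = 0" for n
    using y[of n] t(1)[OF that] that
    by (simp add: act_smul scale_right_diff_distrib del: scale_scale)
  have \<tau>_inv: "act \<tau> f = f"
    using \<tau> by (simp add: f_def act_add kernel_y \<tau>_fixed)
  have D_inv: "act d f = f" if d: "\<chi>a d = \<chi>c d" for d
  proof -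
    \<comment> \<open>The commutator of d with a power of \<open>\<tau>\<close> is killed by
      \<open>\<chi>a\<close> and \<open>\<chi>c\<close>, hence fixes
      \<open>\<delta>\<close>.\<close>
    have swap: "act d (act (gpow \<tau> i) \<delta>) = act (gpow \<tau> i) (act d \<delta>)" for i
    proof -
      have "act (- (d + gpow \<tau> i) + (gpow \<tau> i + d)) \<delta> = \<delta>"
        by (intro \<delta>_fixed; subst character_diff_eq_0_iff)
          (simp_all add: \<chi>a \<chi>c character_add add.commute)
      then have "act (d + gpow \<tau> i) (act (- (d + gpow \<tau> i) + (gpow \<tau> i + d)) \<delta>)
        = act (d + gpow \<tau> i) \<delta>" by simp
      then show ?thesis by (simp add: act_plus [symmetric] add.assoc [symmetric])
    qed
    \<comment> \<open>The term \<open>t d\<close> is fixed by \<open>\<tau>\<close> and is counted p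
      times; the conjugates of \<open>t' d\<close> add up to \<open>\<chi>a d \<cdot> b\<close>. The
      action of d on \<open>int p \<cdot> y\<close> produces the opposite terms, because
      \<open>\<chi>a d = \<chi>c d\<close>.\<close>
    have "act d N\<delta> = (\<Sum>i<p. act (gpow \<tau> i) \<delta> + t d - act (gpow \<tau> i) (t' d))"
    proof -
      have "act (gpow \<tau> i) (t d) = t d" for i
        using gpow_in[OF N \<tau>(1), of i] t(4) by simp
      then show ?thesis
        by (simp add: N\<delta>_def act_sum swap \<delta>[OF d] act_add act_diff algebra_simps)
    qed
    also have "\<dots> = N\<delta> + int p \<cdot> t d - (\<Sum>i<p. act (gpow \<tau> i) (t' d))"
      by (simp add: N\<delta>_def sum.distrib sum_subtractf sum_constant_scale)
    also have "(\<Sum>i<p. act (gpow \<tau> i) (t' d)) = \<chi>a d \<cdot> b"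
      by (rule sum_conjugates_eq_carry[OF \<chi>a \<tau>(2) t'(2) t'(3)])
    finally have "act d N\<delta> = N\<delta> + int p \<cdot> t d - \<chi>a d \<cdot> b" .
    moreover have "act d (int p \<cdot> y) = int p \<cdot> y + \<chi>c d \<cdot> b - int p \<cdot> t d"
    proof -
      have "int p \<cdot> (\<chi>c d \<cdot> xb) = \<chi>c d \<cdot> b"
        unfolding b_def by (rule scale_left_commute)
      then show ?thesis
        by (simp only: act_smul y scale_right_distrib scale_right_diff_distrib p_smul_zeta diff_zero)
    qed
    ultimately show ?thesis by (simp add: f_def act_add d)
  qed
  have "act g f = f" for g
  proof -
    \<comment> \<open>\<open>\<tau>\<close> raises \<open>\<chi>a\<close> by 1 and leaves
      \<open>\<chi>c\<close> alone, so this exponent brings the remaining factor \<open>?d\<close>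
      into the subgroup where both agree.\<close>
    let ?i = "nat ((\<chi>a g - \<chi>c g) mod int p)"
    let ?d = "- gpow \<tau> ?i + g"
    have "\<chi>c (gpow \<tau> ?i) = 0" using gpow_in[OF N \<tau>(1)] by simp
    then have "\<chi>c ?d = \<chi>c g"
      using character_minus[OF \<chi>c, of "gpow \<tau> ?i"] \<chi>c by (simp add: character_add cong_def)
    moreover have "[\<chi>a ?d = - (int ?i mod int p) + \<chi>a g] (mod int p)"
      using cong_trans[OF character_cong[OF \<chi>a]
        cong_add[OF character_minus[OF \<chi>a, of "gpow \<tau> ?i"] cong_refl]] \<tau> \<chi>a
      by (simp add: character_gpow)
    then have "[\<chi>a ?d = \<chi>c g] (mod int p)"
      using p_pos by (simp add: cong_def mod_simps)
    ultimately have "\<chi>a ?d = \<chi>c ?d" using \<chi>a \<chi>c by (simp add: cong_def)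
    then have "act ?d f = f" by (rule D_inv)
    moreover have "act (gpow \<tau> i) f = f" for i
      by (induction i) (simp_all add: gpow_Suc act_plus \<tau>_inv)
    moreover have "act g f = act (gpow \<tau> ?i) (act ?d f)"
      by (simp add: act_plus [symmetric] add.assoc [symmetric])
    ultimately show ?thesis by simp
  qed
  then obtain xf \<chi>f where \<chi>f: "character \<chi>f" and xf: "int p \<cdot> xf = f"
    "\<And>g. act g xf = xf + \<chi>f g \<cdot> \<zeta>"
    using kummer_character by blast
  define y1 where "y1 = y - xf"
  have p_y1: "int p \<cdot> y1 = - N\<delta>"
    by (simp add: y1_def scale_right_diff_distrib xf f_def)
  have act_y1: "act n y1 = y1 - (\<psi> n + \<chi>f n) \<cdot> \<zeta>" if "\<chi>c n = 0" for n
    using y[of n] t(1)[OF that] that by (simp add: y1_def act_diff xf algebra_simps)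
  define s where "s g = (\<Sum>i<nat (\<chi>a g). act (gpow \<tau> i) \<delta>)" for g
  \<comment> \<open>On ker \<open>\<chi>c\<close> the coboundary of
    \<open>\<chi>a \<cdot> y1\<close> is \<open>carry\<close> times \<open>int p \<cdot> y1\<close>,
    minus the cup product of \<open>\<psi> + \<chi>f\<close> with \<open>\<chi>a\<close>. The sum
    \<open>s\<close> cancels the carry term, as \<open>int p \<cdot> y1 = - N\<delta>\<close>; the
    last summand exchanges the two factors and thereby corrects the sign.\<close>
  define u where "u g = \<chi>a g \<cdot> y1 + s g - (\<chi>a g * (\<psi> g + \<chi>f g)) \<cdot> \<zeta>" for g
  show ?thesis
  proof (rule that[OF \<chi>f])
    have "smooth s"
      unfolding s_def using character_smooth[OF \<chi>a]
      by (rule smooth_compose[where F = "\<lambda>k. \<Sum>i<nat k. act (gpow \<tau> i) \<delta>"])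
    then show "smooth u"
      unfolding u_def using character_smooth \<chi>a \<chi>f sm by (intro smooth_arith smooth_const)
    fix g h assume gh: "\<chi>c g = 0" "\<chi>c h = 0"
    have s: "s g + act g (s h) = s (g + h) + carry \<chi>a g h \<cdot> N\<delta>"
      unfolding s_def N\<delta>_def using \<tau> gh
      by (intro cyclic_sum_cocycle[OF N \<chi>a]) (auto intro: \<delta>_fixed)
    have "- (carry \<chi>a g h \<cdot> N\<delta>) = \<chi>a g \<cdot> y1 + \<chi>a h \<cdot> y1 - \<chi>a (g + h) \<cdot> y1"
      using carry_scale[OF \<chi>a, of g h y1] by (simp add: p_y1)
    then have "carry \<chi>a g h \<cdot> N\<delta> = - (\<chi>a g \<cdot> y1 + \<chi>a h \<cdot> y1 - \<chi>a (g + h) \<cdot> y1)"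
      by (metis add.inverse_inverse)
    with s have s': "s g + act g (s h)
      = s (g + h) - (\<chi>a g \<cdot> y1 + \<chi>a h \<cdot> y1 - \<chi>a (g + h) \<cdot> y1)" by simp
    have "[\<psi> (g + h) + \<chi>f (g + h) = (\<psi> g + \<psi> h) + (\<chi>f g + \<chi>f h)] (mod int p)"
      using \<psi>[of g h] gh character_cong[OF \<chi>f]
      by (intro cong_add) (simp_all add: cong_iff_dvd_diff dvd_diff_commute)
    then have "[\<chi>a (g + h) * (\<psi> (g + h) + \<chi>f (g + h))
      = (\<chi>a g + \<chi>a h) * ((\<psi> g + \<psi> h) + (\<chi>f g + \<chi>f h))] (mod int p)"
      by (intro cong_mult character_cong \<chi>a)
    then have "(\<chi>a (g + h) * (\<psi> (g + h) + \<chi>f (g + h))) \<cdot> \<zeta>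
      = ((\<chi>a g + \<chi>a h) * ((\<psi> g + \<psi> h) + (\<chi>f g + \<chi>f h))) \<cdot> \<zeta>"
      by (simp only: zeta_cong)
    then show "u g + act g (u h) - u (g + h) = (\<chi>a g * (\<psi> h + \<chi>f h)) \<cdot> \<zeta>"
      using s' unfolding u_def
      by (simp add: act_simps act_y1 gh algebra_simps)
  qed
qed

text \<open>In the extension \<open>E\<close> of the group by the module given by \<open>\<Theta>\<close>, the kernel \<open>N\<close> of
  \<open>\<kappa>\<close> lifts to a subgroup via \<open>n \<mapsto> (- u n, n)\<close>, and Hilbert 90 on \<open>N\<close> provides a lift of
  \<open>\<sigma>\<close> normalising it compatibly. The powers of that lift give a section of \<open>E\<close> whose
  cocycle is \<open>e\<close> times the carry cocycle.\<close>

lemma cocycle_trivial_on_kernel: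
  assumes \<kappa>: "character \<kappa>" and \<sigma>: "\<kappa> \<sigma> = 1"
    and cocycle: "\<And>g h k. act g (\<Theta> h k) + \<Theta> g (h + k) = \<Theta> (g + h) k + \<Theta> g h"
    and \<Theta>_0 [simp]: "\<And>g. \<Theta> 0 g = 0" "\<And>g. \<Theta> g 0 = 0"
    and V: "small V" "\<And>g h v. v \<in> V \<Longrightarrow> \<Theta> g (h + v) = \<Theta> g h" "\<And>h v. v \<in> V \<Longrightarrow> \<Theta> v h = 0"
    and u: "smooth u" "\<And>g h. \<kappa> g = 0 \<Longrightarrow> \<kappa> h = 0 \<Longrightarrow> u g + act g (u h) - u (g + h) = \<Theta> g h"
  obtains U e where "smooth U" "\<And>g. act g e = e"
    "\<And>g h. U g + act g (U h) + \<Theta> g h = U (g + h) + carry \<kappa> g h \<cdot> e"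
proof -
  let ?N = "{g. \<kappa> g = 0}"
  note N = add_subgroup_kernel[OF \<kappa>]
  have N_add: "\<kappa> (g + h) = 0" if "\<kappa> g = 0" "\<kappa> h = 0" for g h
    using that by (simp add: character_add \<kappa>)
  have u_0 [simp]: "u 0 = 0" using u(2)[of 0 0] \<kappa> by simp
  have u_add: "u (g + h) = u g + act g (u h) - \<Theta> g h" if "\<kappa> g = 0" "\<kappa> h = 0" for g h
    using u(2)[OF that] by (simp add: algebra_simps)
  define c where "c n = - \<sigma> + n + \<sigma>" for n
  have c: "\<sigma> + c n = n + \<sigma>" for n
    by (simp add: c_def add.assoc [symmetric])
  have c_N [simp]: "\<kappa> (c n) = 0 \<longleftrightarrow> \<kappa> n = 0" for n
    unfolding c_def by (rule character_conj[OF \<kappa>])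
  have c_add: "c (m + n) = c m + c n" for m n
    by (simp add: c_def algebra_simps)
  \<comment> \<open>The amount by which the lift \<open>(0, \<sigma>)\<close> fails to conjugate
    \<open>(- u n, n)\<close> into the lift of \<open>c n\<close>. Replacing 0 by \<open>m0\<close>
    corrects it precisely when \<open>act n m0 = m0 + q n\<close>.\<close>
  define q where "q n = u n - act \<sigma> (u (c n)) + \<Theta> \<sigma> (c n) - \<Theta> n \<sigma>" for n
  have "\<exists>y. \<forall>g\<in>?N. act g y = y + q g"
  proof -
    obtain W where W: "small W" "\<And>v. v \<in> W \<Longrightarrow> u v = 0"
      using smooth_cocycle_small[OF u(1) u_0] by blast
    \<comment> \<open>\<open>q v\<close> involves \<open>u\<close> and \<open>\<Theta>\<close> both
      at v and at its conjugate \<open>c v\<close>.\<close>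
    let ?W = "(V \<inter> W) \<inter> {v. c v \<in> V \<inter> W}"
    show ?thesis
    proof (rule hilbert90[OF N, of ?W])
      show "small ?W"
        unfolding c_def using V(1) W(1) by (intro small_Int small_conj)
      show "q v = 0" if "v \<in> ?N \<inter> ?W" for v
        using that V(2)[of "c v" \<sigma> 0] V(3)[of v \<sigma>] W(2) by (simp add: q_def)
      fix m n assume mn: "m \<in> ?N" "n \<in> ?N"
      have 1: "\<Theta> \<sigma> (c m + c n) = \<Theta> (\<sigma> + c m) (c n) + \<Theta> \<sigma> (c m) - act \<sigma> (\<Theta> (c m) (c n))"
        using cocycle[of \<sigma> "c m" "c n"] by (simp add: algebra_simps)
      have 2: "\<Theta> (m + n) \<sigma> = act m (\<Theta> n \<sigma>) + \<Theta> m (n + \<sigma>) - \<Theta> m n"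
        using cocycle[of m n \<sigma>] by (simp add: algebra_simps)
      have 3: "\<Theta> (m + \<sigma>) (c n) = act m (\<Theta> \<sigma> (c n)) + \<Theta> m (n + \<sigma>) - \<Theta> m \<sigma>"
        using cocycle[of m \<sigma> "c n"] by (simp add: algebra_simps c)
      have 4: "act \<sigma> (act (c m) x) = act m (act \<sigma> x)" for x
        by (simp add: c flip: act_plus)
      show "q (m + n) = q m + act m (q n)"
        using mn unfolding q_def c_add
        by (simp add: u_add 1 2 3 4 c act_simps algebra_simps)
    qed
  qed
  then obtain m0 where m0: "\<And>n. \<kappa> n = 0 \<Longrightarrow> act n m0 = m0 + q n" by blast

  \<comment> \<open>The extension with factor set \<open>\<Theta>\<close>: products of pairs replace
    long cocycle computations.\<close>
  define mul where "mul x y = (fst x + act (snd x) (fst y) + \<Theta> (snd x) (snd y), snd x + snd y)" for x y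
  have assoc: "mul (mul x y) z = mul x (mul y z)" for x y z
    using cocycle[of "snd x" "snd y" "snd z"]
    by (simp add: mul_def act_add act_plus algebra_simps)
  have unit [simp]: "mul (0, 0) x = x" "mul x (0, 0) = x" for x
    by (simp_all add: mul_def)
  have cancel: "x = y" if "mul x z = mul y z" for x y z
    using that by (cases x; cases y) (auto simp: mul_def)
  define s where "s n = (- u n, n)" for n
  have snd_s [simp]: "snd (s n) = n" for n by (simp add: s_def)
  have s_add: "mul (s m) (s n) = s (m + n)" if "\<kappa> m = 0" "\<kappa> n = 0" for m n
    using u(2)[OF that] by (simp add: mul_def s_def act_minus algebra_simps)
  define S where "S = (m0, \<sigma>)"
  have s_S: "mul (s n) S = mul S (s (c n))" if "\<kappa> n = 0" for n
    using m0[OF that] by (simp add: mul_def s_def S_def c q_def act_minus algebra_simps)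
  define P where "P i = (mul S ^^ i) (0, 0)" for i
  have P_0 [simp]: "P 0 = (0, 0)" and P_Suc: "P (Suc i) = mul S (P i)" for i
    by (simp_all add: P_def)
  have P_add: "P (i + j) = mul (P i) (P j)" for i j
    by (induction i) (simp_all add: P_Suc assoc)
  have snd_P: "snd (P i) = gpow \<sigma> i" for i
    by (induction i) (simp_all add: P_Suc mul_def gpow_Suc S_def)
  have s_P: "mul (s n) (P i) = mul (P i) (s (- gpow \<sigma> i + n + gpow \<sigma> i))" if "\<kappa> n = 0" for n i
    using that
  proof (induction i arbitrary: n)
    case (Suc i)
    have "mul (s n) (P (Suc i)) = mul S (mul (s (c n)) (P i))"
      using Suc.prems by (simp add: P_Suc s_S flip: assoc)
    also have "\<dots> = mul (P (Suc i)) (s (- gpow \<sigma> i + c n + gpow \<sigma> i))"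
      using Suc by (simp add: P_Suc assoc)
    also have "- gpow \<sigma> i + c n + gpow \<sigma> i = - gpow \<sigma> (Suc i) + n + gpow \<sigma> (Suc i)"
      by (simp add: c_def gpow_Suc minus_add add.assoc del: add_uminus_conv_diff)
    finally show ?case .
  qed simp
  define \<pi> where "\<pi> = gpow \<sigma> p"
  have \<pi> [simp]: "\<kappa> \<pi> = 0" by (simp add: \<pi>_def character_gpow \<kappa> \<sigma>)
  \<comment> \<open>\<open>P p\<close> and \<open>s \<pi>\<close> lie over the same element
    \<open>\<pi>\<close>, so they differ by an element of the module.\<close>
  define e where "e = fst (P p) + u \<pi>"
  have P_p: "P p = mul (e, 0) (s \<pi>)"
    by (simp add: prod_eq_iff mul_def snd_P \<pi>_def e_def s_def)
  \<comment> \<open>S commutes with its power \<open>P p\<close> and, as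
    \<open>c \<pi> = \<pi>\<close>, with \<open>s \<pi>\<close>; hence with their quotient.\<close>
  have central_S: "mul S (e, 0) = mul (e, 0) S"
  proof (rule cancel)
    have "c \<pi> = \<pi>"
      using gpow_commute[of \<sigma> p 1] by (simp add: c_def \<pi>_def add.assoc)
    then have "mul S (s \<pi>) = mul (s \<pi>) S" by (simp add: s_S)
    moreover have "mul S (P p) = mul (P p) S"
      using P_add[of 1 p] P_add[of p 1] by (simp add: P_Suc)
    ultimately show "mul (mul S (e, 0)) (s \<pi>) = mul (mul (e, 0) S) (s \<pi>)"
      by (simp add: P_p assoc)
  qed
  \<comment> \<open>Conjugation by \<open>P p\<close> and by \<open>s \<pi>\<close> has the same
    effect on \<open>s n\<close>.\<close>
  have central_s: "mul (s n) (e, 0) = mul (e, 0) (s n)" if n: "\<kappa> n = 0" for n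
  proof (rule cancel)
    have "\<kappa> (- \<pi> + n + \<pi>) = 0" using n by (simp add: character_conj \<kappa>)
    moreover have "\<pi> + (- \<pi> + n + \<pi>) = n + \<pi>" by (simp add: add.assoc [symmetric])
    ultimately show "mul (mul (s n) (e, 0)) (s \<pi>) = mul (mul (e, 0) (s n)) (s \<pi>)"
      using s_P[OF n, of p] n by (simp add: P_p assoc s_add \<pi>_def [symmetric])
  qed
  have split: "\<kappa> (- gpow \<sigma> (nat (\<kappa> g)) + g) = 0" for g
    using character_range[OF \<kappa>, of g] \<kappa> \<sigma>
    by (subst character_diff_eq_0_iff) (simp_all add: character_gpow)
  have e_inv: "act g e = e" for g
  proof -
    have "act \<sigma> e = e" using central_S by (simp add: mul_def S_def add.commute)
    then have "act (gpow \<sigma> i) e = e" for i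
      by (induction i) (simp_all add: gpow_Suc act_plus)
    moreover have "act n e = e" if "\<kappa> n = 0" for n
      using central_s[OF that] by (simp add: mul_def s_def)
    ultimately have "act (gpow \<sigma> (nat (\<kappa> g))) (act (- gpow \<sigma> (nat (\<kappa> g)) + g) e) = e"
      using split by simp
    then show ?thesis by (simp add: act_plus [symmetric] add.assoc [symmetric])
  qed
  \<comment> \<open>The section: a power of S accounts for \<open>\<kappa> g\<close>, the lift
    \<open>s\<close> for the remaining factor in the kernel. Multiplying two values adds the
    exponents, and a total of at least p splits off \<open>P p\<close>, that is one factor
    \<open>(e, 0)\<close>.\<close>
  define F where "F g = mul (P (nat (\<kappa> g))) (s (- gpow \<sigma> (nat (\<kappa> g)) + g))" for g
  have snd_F: "snd (F g) = g" for g
    by (simp add: F_def mul_def snd_P add.assoc [symmetric])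
  have F_mult: "mul (F g) (F h) = mul (carry \<kappa> g h \<cdot> e, 0) (F (g + h))" for g h
  proof -
    define i j where "i = nat (\<kappa> g)" "j = nat (\<kappa> h)"
    note ij = character_range[OF \<kappa>, of g] character_range[OF \<kappa>, of h]
    let ?m = "- gpow \<sigma> i + g" and ?n = "- gpow \<sigma> j + h"
    let ?m' = "- gpow \<sigma> j + ?m + gpow \<sigma> j"
    have N: "\<kappa> ?m = 0" "\<kappa> ?n = 0" "\<kappa> ?m' = 0"
      using split[of g] split[of h] character_conj[OF \<kappa>, of "gpow \<sigma> j" ?m] by (simp_all add: i_j_def)
    have sum: "?m' + ?n = - gpow \<sigma> (i + j) + (g + h)"
      by (simp add: gpow_add minus_add add.assoc del: add_uminus_conv_diff)
    have "mul (F g) (F h) = mul (P i) (mul (mul (s ?m) (P j)) (s ?n))"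
      by (simp add: F_def i_j_def assoc)
    also have "\<dots> = mul (P (i + j)) (mul (s ?m') (s ?n))"
      by (simp only: s_P[OF N(1)] P_add assoc)
    also have "\<dots> = mul (P (i + j)) (s (- gpow \<sigma> (i + j) + (g + h)))"
      by (simp only: s_add[OF N(3,2)] sum)
    also have "\<dots> = mul (carry \<kappa> g h \<cdot> e, 0) (F (g + h))"
    proof (cases "\<kappa> g + \<kappa> h < int p")
      case True
      then have "carry \<kappa> g h = 0" "nat (\<kappa> (g + h)) = i + j"
        using ij by (simp_all add: carry_def character_add \<kappa> i_j_def nat_add_distrib)
      then show ?thesis by (simp add: F_def)
    next
      case False
      then have "(\<kappa> g + \<kappa> h) div int p = 1"
        using ij by (intro int_div_pos_eq[where r = "\<kappa> g + \<kappa> h - int p"]) auto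
      then have carry_1: "carry \<kappa> g h = 1" by (simp add: carry_def)
      define k where "k = nat (\<kappa> (g + h))"
      have k: "i + j = p + k"
        using carry[OF \<kappa>, of g h] carry_1 ij character_range[OF \<kappa>, of "g + h"]
        by (simp add: k_def i_j_def)
      have "mul (P (i + j)) (s (- gpow \<sigma> (i + j) + (g + h)))
        = mul (e, 0) (mul (mul (s \<pi>) (P k)) (s (- gpow \<sigma> (p + k) + (g + h))))"
        by (simp add: k P_add P_p assoc)
      also have "\<dots> = mul (e, 0) (mul (P k)
          (mul (s (- gpow \<sigma> k + \<pi> + gpow \<sigma> k)) (s (- gpow \<sigma> (p + k) + (g + h)))))"
        by (simp only: s_P[OF \<pi>] assoc)
      also have "mul (s (- gpow \<sigma> k + \<pi> + gpow \<sigma> k)) (s (- gpow \<sigma> (p + k) + (g + h)))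
          = s (- gpow \<sigma> k + \<pi> + gpow \<sigma> k + (- gpow \<sigma> (p + k) + (g + h)))"
      proof (rule s_add)
        show "\<kappa> (- gpow \<sigma> k + \<pi> + gpow \<sigma> k) = 0" by (simp add: character_conj \<kappa>)
        show "\<kappa> (- gpow \<sigma> (p + k) + (g + h)) = 0"
          using N_add[OF N(3,2)] by (simp only: sum k)
      qed
      also have "- gpow \<sigma> k + \<pi> + gpow \<sigma> k + (- gpow \<sigma> (p + k) + (g + h)) = - gpow \<sigma> k + (g + h)"
      proof -
        have "- gpow \<sigma> k + \<pi> + gpow \<sigma> k = \<pi>"
          using gpow_commute[of \<sigma> p k] by (simp add: \<pi>_def add.assoc)
        moreover have "gpow \<sigma> (p + k) = gpow \<sigma> k + \<pi>"
          by (simp add: \<pi>_def gpow_add gpow_commute)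
        ultimately show ?thesis
          by (simp add: minus_add add.assoc del: add_uminus_conv_diff)
      qed
      finally show ?thesis by (simp add: carry_1 F_def k_def)
    qed
    finally show ?thesis .
  qed
  show ?thesis
  proof (rule that[of "\<lambda>g. fst (F g)" e])
    show "act g e = e" for g by (rule e_inv)
    show "fst (F g) + act g (fst (F h)) + \<Theta> g h = fst (F (g + h)) + carry \<kappa> g h \<cdot> e" for g h
      using arg_cong[OF F_mult[of g h], of fst] by (simp add: mul_def snd_F add.commute)
    obtain W where W: "small W" "\<And>g v. v \<in> W \<Longrightarrow> u (g + v) = u g"
      using u(1) unfolding smooth_def by blast
    obtain Y where Y: "small Y" "\<And>g v. v \<in> Y \<Longrightarrow> \<kappa> (g + v) = \<kappa> g"
      using character_smooth[OF \<kappa>] unfolding smooth_def by blast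
    \<comment> \<open>The power of S depends on \<open>\<kappa> g\<close> alone, so right
      translation by v reaches only the factor in the kernel.\<close>
    have "fst (F (g + v)) = fst (F g)" if "v \<in> V \<inter> (W \<inter> Y)" for g v
    proof -
      have "- gpow \<sigma> (nat (\<kappa> g)) + (g + v) = - gpow \<sigma> (nat (\<kappa> g)) + g + v"
        by (simp add: add.assoc)
      then show ?thesis
        using that by (simp add: F_def mul_def s_def Y(2) W(2) V(2))
    qed
    moreover have "small (V \<inter> (W \<inter> Y))" using V(1) W(1) Y(1) by (intro small_Int)
    ultimately show "smooth (\<lambda>g. fst (F g))" unfolding smooth_def by blast
  qed
qed

text \<open>Adding characters to \<open>\<phi>\<close> and \<open>\<psi>\<close> leaves their
  coboundaries unchanged. This freedom is used twice: on \<open>\<psi>\<close> to reach the cyclic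
  quotient, on \<open>\<phi>\<close> to cancel the class remaining there.\<close>

theorem massey_product_vanishes:
  assumes \<chi>a: "character \<chi>a" and \<chi>b: "character \<chi>b" and \<chi>c: "character \<chi>c"
    and sm: "smooth \<phi>" "smooth \<psi>"
    and \<phi>: "\<And>g h. [\<phi> g + \<phi> h - \<phi> (g + h) = \<chi>a g * \<chi>b h] (mod int p)"
    and \<psi>: "\<And>g h. [\<psi> g + \<psi> h - \<psi> (g + h) = \<chi>b g * \<chi>c h] (mod int p)"
  obtains \<phi>' \<psi>' \<omega> where "smooth \<phi>'" "smooth \<psi>'" "smooth \<omega>"
    "\<And>g h. [\<phi>' g + \<phi>' h - \<phi>' (g + h) = \<chi>a g * \<chi>b h] (mod int p)"
    "\<And>g h. [\<psi>' g + \<psi>' h - \<psi>' (g + h) = \<chi>b g * \<chi>c h] (mod int p)"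
    "\<And>g h. [\<omega> g + \<omega> h - \<omega> (g + h) = \<chi>a g * \<psi>' h + \<phi>' g * \<chi>c h] (mod int p)"
proof -
  obtain \<chi>f u where \<chi>f: "character \<chi>f" and u: "smooth u"
    "\<And>g h. \<chi>c g = 0 \<Longrightarrow> \<chi>c h = 0 \<Longrightarrow>
       u g + act g (u h) - u (g + h) = (\<chi>a g * (\<psi> h + \<chi>f h)) \<cdot> \<zeta>"
    using cup_trivial_on_kernel[OF \<chi>a \<chi>b \<chi>c sm \<phi> \<psi>] by blast
  define \<psi>' where "\<psi>' g = \<psi> g + \<chi>f g" for g
  have twist: "[\<theta> g + \<kappa> g + (\<theta> h + \<kappa> h) - (\<theta> (g + h) + \<kappa> (g + h)) = x] (mod int p)"
    if "[\<theta> g + \<theta> h - \<theta> (g + h) = x] (mod int p)" "character \<kappa>" for \<theta> \<kappa> g h x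
  proof -
    have "[\<theta> g + \<theta> h - \<theta> (g + h) - (\<kappa> (g + h) - (\<kappa> g + \<kappa> h)) = x - 0] (mod int p)"
      using that(1) character_cong[OF that(2), of g h]
      by (intro cong_diff) (simp_all add: cong_diff_iff_cong_0)
    then show ?thesis by (simp add: algebra_simps)
  qed
  have \<psi>': "[\<psi>' g + \<psi>' h - \<psi>' (g + h) = \<chi>b g * \<chi>c h] (mod int p)" for g h
    unfolding \<psi>'_def by (rule twist[of \<psi> _ _ _ \<chi>f, OF \<psi> \<chi>f])
  have sm_\<psi>': "smooth \<psi>'"
    unfolding \<psi>'_def using sm character_smooth[OF \<chi>f] by (intro smooth_arith)
  have zero: "[\<phi> 0 = 0] (mod int p)" "[\<psi>' 0 = 0] (mod int p)"
    using \<phi>[of 0 0] \<psi>'[of 0 0] \<chi>a \<chi>b by simp_all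
  define \<Theta> where "\<Theta> g h = (\<chi>a g * \<psi>' h + \<phi> g * \<chi>c h) \<cdot> \<zeta>" for g h
  obtain U e where U: "smooth U" "\<And>g. act g e = e"
    "\<And>g h. U g + act g (U h) + \<Theta> g h = U (g + h) + carry \<chi>c g h \<cdot> e"
  proof (cases "\<forall>g. \<chi>c g = 0")
    case True
    show ?thesis
    \<comment> \<open>The kernel is the whole group, and \<open>u\<close> already bounds
      \<open>\<Theta>\<close>.\<close>
    proof (rule that[of "\<lambda>g. - u g" 0])
      show "smooth (\<lambda>g. - u g)" using u(1) by (rule smooth_compose)
      show "- u g + act g (- u h) + \<Theta> g h = - u (g + h) + carry \<chi>c g h \<cdot> 0" for g h
        using u(2)[of g h] True by (simp add: \<Theta>_def \<psi>'_def act_minus algebra_simps)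
    qed simp
  next
    case False
    then obtain \<sigma> where \<sigma>: "\<chi>c \<sigma> = 1"
      using character_kernel_scale[OF \<chi>c, of UNIV] by (auto simp: add_subgroup_def)
    obtain V where V: "small V" "\<And>v. v \<in> V \<Longrightarrow> \<phi> v = \<phi> 0" "\<And>v. v \<in> V \<Longrightarrow> \<chi>a v = 0"
      "\<And>g v. v \<in> V \<Longrightarrow> \<psi>' (g + v) = \<psi>' g" "\<And>g v. v \<in> V \<Longrightarrow> \<chi>c (g + v) = \<chi>c g"
    proof -
      have "smooth (\<lambda>g. ((\<phi> g, \<chi>a g), (\<psi>' g, \<chi>c g)))"
        by (intro smooth_compose2[where F = Pair] sm sm_\<psi>' character_smooth \<chi>a \<chi>c)
      then obtain V where "small V"
        and eq: "\<And>g v. v \<in> V \<Longrightarrow>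
          ((\<phi> (g + v), \<chi>a (g + v)), (\<psi>' (g + v), \<chi>c (g + v))) = ((\<phi> g, \<chi>a g), (\<psi>' g, \<chi>c g))"
        unfolding smooth_def by blast
      then show ?thesis using that[of V] eq[of _ 0] eq by (simp add: \<chi>a)
    qed
    show ?thesis
    proof (rule cocycle_trivial_on_kernel[OF \<chi>c \<sigma>, of \<Theta> V u])
      fix g h k
      \<comment> \<open>Expanding \<open>\<psi>' (h + k)\<close> and contracting to
        \<open>\<phi> (g + h)\<close> both involve the triple product
        \<open>\<chi>a g * \<chi>b h * \<chi>c k\<close>, which is only regrouped.\<close>
      have "[\<chi>a h * \<psi>' k + \<phi> h * \<chi>c k + (\<chi>a g * \<psi>' (h + k) + \<phi> g * \<chi>c (h + k))
        = \<chi>a h * \<psi>' k + \<phi> h * \<chi>c k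
          + (\<chi>a g * (\<psi>' h + \<psi>' k - \<chi>b h * \<chi>c k) + \<phi> g * (\<chi>c h + \<chi>c k))] (mod int p)"
        using \<psi>'[of h k] character_cong[OF \<chi>c]
        by (intro cong_add cong_mult) (auto simp: cong_iff_dvd_diff algebra_simps dvd_diff_commute)
      also have "\<chi>a h * \<psi>' k + \<phi> h * \<chi>c k
          + (\<chi>a g * (\<psi>' h + \<psi>' k - \<chi>b h * \<chi>c k) + \<phi> g * (\<chi>c h + \<chi>c k))
        = (\<chi>a g + \<chi>a h) * \<psi>' k + (\<phi> g + \<phi> h - \<chi>a g * \<chi>b h) * \<chi>c k
          + (\<chi>a g * \<psi>' h + \<phi> g * \<chi>c h)" by (simp add: algebra_simps)
      also have "[\<dots> = \<chi>a (g + h) * \<psi>' k + \<phi> (g + h) * \<chi>c k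
          + (\<chi>a g * \<psi>' h + \<phi> g * \<chi>c h)] (mod int p)"
        using \<phi>[of g h] cong_sym[OF character_cong[OF \<chi>a, of g h]]
        by (intro cong_add cong_mult) (auto simp: cong_iff_dvd_diff algebra_simps dvd_diff_commute)
      finally show "act g (\<Theta> h k) + \<Theta> g (h + k) = \<Theta> (g + h) k + \<Theta> g h"
        by (simp add: \<Theta>_def act_simps zeta_cong scale_left_distrib)
    next
      show "\<Theta> 0 g = 0" "\<Theta> g 0 = 0" for g
        using cong_mult[OF zero(1) cong_refl, of "\<chi>c g"] cong_mult[OF cong_refl zero(2), of "\<chi>a g"]
        by (simp_all add: \<Theta>_def \<chi>a \<chi>c zeta_cong)
      show "\<Theta> v h = 0" if "v \<in> V" for h v
        using cong_mult[OF zero(1) cong_refl, of "\<chi>c h"] that V by (simp add: \<Theta>_def zeta_cong)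
      show "\<Theta> g (h + v) = \<Theta> g h" if "v \<in> V" for g h v
        using that V by (simp add: \<Theta>_def)
      show "u g + act g (u h) - u (g + h) = \<Theta> g h" if "\<chi>c g = 0" "\<chi>c h = 0" for g h
        using u(2)[OF that] that by (simp add: \<Theta>_def \<psi>'_def)
    qed (use V(1) u(1) that in blast)+
  qed
  \<comment> \<open>A p-th root of e turns the leftover \<open>carry \<chi>c g h \<cdot> e\<close>
    into a cup product with \<open>\<chi>c\<close>, which the new summand \<open>\<chi>e\<close> of
    \<open>\<phi>'\<close> absorbs.\<close>
  obtain xe \<chi>e where \<chi>e: "character \<chi>e" and xe: "int p \<cdot> xe = e"
    "\<And>g. act g xe = xe + \<chi>e g \<cdot> \<zeta>"
    using kummer_character[of e] U(2) by blast
  define \<phi>' where "\<phi>' g = \<phi> g + \<chi>e g" for g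
  have \<phi>': "[\<phi>' g + \<phi>' h - \<phi>' (g + h) = \<chi>a g * \<chi>b h] (mod int p)" for g h
    unfolding \<phi>'_def by (rule twist[of \<phi> _ _ _ \<chi>e, OF \<phi> \<chi>e])
  have sm_\<phi>': "smooth \<phi>'"
    unfolding \<phi>'_def using sm character_smooth[OF \<chi>e] by (intro smooth_arith)
  define T where "T g h = (\<chi>a g * \<psi>' h + \<phi>' g * \<chi>c h) \<cdot> \<zeta>" for g h
  define W where "W g = U g - \<chi>c g \<cdot> xe" for g
  have W: "W g + act g (W h) + T g h = W (g + h)" for g h
  proof -
    have "T g h = \<Theta> g h + (\<chi>e g * \<chi>c h) \<cdot> \<zeta>"
      by (simp add: T_def \<Theta>_def \<phi>'_def algebra_simps)
    then show ?thesis
      using U(3)[of g h] carry_scale[OF \<chi>c, of g h xe]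
      by (simp add: W_def xe act_simps algebra_simps)
  qed
  have sm_W: "smooth W"
    unfolding W_def using U(1) character_smooth[OF \<chi>c] by (intro smooth_arith smooth_const)
  have p_T: "int p \<cdot> T g h = 0" for g h
    unfolding T_def by (rule p_smul_zeta)
  \<comment> \<open>\<open>W\<close> bounds the Massey cocycle, up to sign, in M rather than in Z/p.
    Since that cocycle is p-torsion, p times \<open>W\<close> is a 1-cocycle; Hilbert 90 and
    divisibility write it as p times a coboundary, and removing the latter leaves torsion
    values.\<close>
  have pW: "int p \<cdot> W (g + h) = int p \<cdot> W g + act g (int p \<cdot> W h)" for g h
  proof -
    have "int p \<cdot> W (g + h) = int p \<cdot> (W g + act g (W h) + T g h)" by (simp only: W)
    then show ?thesis by (simp only: scale_right_distrib p_T act_smul add_0_right)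
  qed
  obtain m where m: "\<And>g. act g m = m + int p \<cdot> W g"
  proof -
    have "int p \<cdot> W 0 = 0" using pW[of 0 0] by simp
    moreover have "smooth (\<lambda>g. int p \<cdot> W g)" using sm_W by (rule smooth_compose)
    ultimately obtain V where "small V" "\<And>v. v \<in> V \<Longrightarrow> int p \<cdot> W v = 0"
      using smooth_cocycle_small[of "\<lambda>g. int p \<cdot> W g"] by blast
    then show ?thesis
      using hilbert90[of UNIV V "\<lambda>g. int p \<cdot> W g"] pW that by (auto simp: add_subgroup_def)
  qed
  obtain m' where m': "int p \<cdot> m' = m" using divisible by blast
  define Z where "Z g = W g - (act g m' - m')" for g
  have "int p \<cdot> Z g = 0" for g
    by (simp add: Z_def scale_right_diff_distrib m' m flip: act_smul)
  \<comment> \<open>Exponents are chosen as a function of the torsion element, not of the group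
    element, so they inherit smoothness from \<open>Z\<close>.\<close>
  moreover obtain K where "\<And>x. int p \<cdot> x = 0 \<Longrightarrow> x = K x \<cdot> \<zeta>"
    using torsion by metis
  ultimately have Z: "Z g = K (Z g) \<cdot> \<zeta>" for g by blast
  have sm_Z: "smooth Z"
    unfolding Z_def using sm_W by (intro smooth_arith smooth_const smooth_act)
  have Z_add: "Z g + Z h + T g h = Z (g + h)" for g h
  proof -
    have "act g (Z h) = Z h" by (subst (1 2) Z) (simp add: act_smul)
    moreover have "Z g + act g (Z h) + T g h = Z (g + h)"
      using W[of g h] by (simp add: Z_def act_simps act_plus algebra_simps)
    ultimately show ?thesis by simp
  qed
  show ?thesis
  proof (rule that[OF sm_\<phi>' sm_\<psi>' _ \<phi>' \<psi>'])
    show "smooth (\<lambda>g. - K (Z g))" using sm_Z by (rule smooth_compose)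
    show "[- K (Z g) + - K (Z h) - - K (Z (g + h)) = \<chi>a g * \<psi>' h + \<phi>' g * \<chi>c h] (mod int p)" for g h
      using Z_add[of g h] Z[of g] Z[of h] Z[of "g + h"]
      by (simp add: zeta_cong scale_left_distrib scale_left_diff_distrib T_def [symmetric]
        flip: Z) (simp add: T_def algebra_simps)
  qed
qed

end

section \<open>The separable closure\<close>

definition ac_eval :: "'a::field poly \<Rightarrow> 'a alg_closure \<Rightarrow> 'a alg_closure" where
  "ac_eval f x = poly (map_poly to_ac f) x"

lemma ac_eval_0 [simp]: "ac_eval 0 x = 0"
  and ac_eval_1 [simp]: "ac_eval 1 x = 1"
  by (simp_all add: ac_eval_def)

lemma ac_eval_pCons [simp]: "ac_eval (pCons a f) x = to_ac a + x * ac_eval f x"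
  by (simp add: ac_eval_def map_poly_pCons)

lemma ac_eval_add [simp]: "ac_eval (f + g) x = ac_eval f x + ac_eval g x"
proof -
  have "map_poly to_ac (f + g) = map_poly to_ac f + map_poly to_ac g"
    by (rule poly_eqI) (simp add: coeff_map_poly)
  then show ?thesis by (simp add: ac_eval_def)
qed

lemma ac_eval_smult [simp]: "ac_eval (Polynomial.smult c f) x = to_ac c * ac_eval f x"
  by (induction f) (simp_all add: algebra_simps)

lemma ac_eval_mult [simp]: "ac_eval (f * g) x = ac_eval f x * ac_eval g x"
  by (induction f) (simp_all add: algebra_simps)

lemma ac_eval_diff [simp]: "ac_eval (f - g) x = ac_eval f x - ac_eval g x"
  using ac_eval_add[of "f - g" g x] by (simp add: eq_diff_eq)

lemma ac_eval_minus [simp]: "ac_eval (- f) x = - ac_eval f x"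
  using ac_eval_diff[of 0 f x] by simp

lemma ac_eval_monom [simp]: "ac_eval (Polynomial.monom c n) x = to_ac c * x ^ n"
  by (induction n) (simp_all add: monom_0 monom_Suc)

lemma ac_eval_pcompose: "ac_eval (pcompose f g) x = ac_eval f (ac_eval g x)"
  by (induction f) (simp_all add: pcompose_pCons)

lemma ac_eval_altdef: "ac_eval f x = (\<Sum>i\<le>Polynomial.degree f. to_ac (Polynomial.coeff f i) * x ^ i)"
  by (simp add: ac_eval_def poly_altdef coeff_map_poly degree_map_poly)

lemma degree_pderiv_less: "Polynomial.degree f > 0 \<Longrightarrow> Polynomial.degree (pderiv f) < Polynomial.degree f"
  by (intro Polynomial.degree_lessI) (auto simp: coeff_pderiv coeff_eq_0)

lemma pderiv_map_poly_to_ac: "pderiv (map_poly to_ac f) = map_poly to_ac (pderiv f)"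
  by (rule poly_eqI) (simp add: coeff_pderiv coeff_map_poly)

lemma ac_eval_min_poly:
  fixes x :: "'a::field alg_closure"
  shows "\<exists>m. ac_eval m x = 0 \<and> m \<noteq> 0 \<and> Polynomial.degree m > 0 \<and> Factorial_Ring.irreducible m \<and>
    (\<forall>f. ac_eval f x = 0 \<longrightarrow> m dvd f)"
proof -
  define P where "P m \<longleftrightarrow> m \<noteq> 0 \<and> ac_eval m x = 0" for m
  obtain f0 where "P f0" using alg_closure_algebraic[of x] unfolding P_def ac_eval_def by metis
  define m where "m = (ARG_MIN Polynomial.degree m. P m)"
  have m: "P m" "\<And>f. P f \<Longrightarrow> Polynomial.degree m \<le> Polynomial.degree f"
    using arg_min_natI[of P f0 Polynomial.degree] arg_min_nat_le[of P _ Polynomial.degree] \<open>P f0\<close>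
    by (auto simp: m_def)
  have dvd: "m dvd f" if "ac_eval f x = 0" for f
  proof (rule ccontr)
    assume "\<not> m dvd f"
    then have "f mod m \<noteq> 0" by (simp add: dvd_eq_mod_eq_0)
    moreover have "ac_eval (f mod m) x = 0"
      using that m(1) ac_eval_add[of "f div m * m" "f mod m" x] by (simp add: P_def)
    ultimately have "Polynomial.degree m \<le> Polynomial.degree (f mod m)" using m(2) by (simp add: P_def)
    then show False using degree_mod_less[of m f] m(1) \<open>f mod m \<noteq> 0\<close> by (simp add: P_def)
  qed
  have deg: "Polynomial.degree m > 0"
  proof (rule ccontr)
    assume "\<not> ?thesis"
    then obtain c where "m = [:c:]" by (metis degree_eq_zeroE neq0_conv)
    then show False using m(1) by (simp add: P_def)
  qed
  have "Factorial_Ring.irreducible m"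
  proof (rule Factorial_Ring.irreducibleI)
    show "m \<noteq> 0" using m(1) by (simp add: P_def)
    show "\<not> m dvd 1" using deg by (auto simp: is_unit_poly_iff)
    fix a b assume ab: "m = a * b"
    then have nz: "a \<noteq> 0" "b \<noteq> 0" using m(1) by (auto simp: P_def)
    have deg_ab: "Polynomial.degree m = Polynomial.degree a + Polynomial.degree b"
      using nz by (simp add: ab Polynomial.degree_mult_eq)
    have "ac_eval a x = 0 \<or> ac_eval b x = 0" using m(1) ab by (simp add: P_def)
    then show "a dvd 1 \<or> b dvd 1"
    proof
      assume "ac_eval a x = 0"
      then have "Polynomial.degree b = 0" using m(2)[of a] nz deg_ab by (simp add: P_def)
      then show ?thesis using nz by (simp add: is_unit_iff_degree)
    next
      assume "ac_eval b x = 0"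
      then have "Polynomial.degree a = 0" using m(2)[of b] nz deg_ab by (simp add: P_def)
      then show ?thesis using nz by (simp add: is_unit_iff_degree)
    qed
  qed
  then show ?thesis using m(1) deg dvd by (intro exI[of _ m]) (simp add: P_def)
qed

text \<open>If x is a simple root of some f, then it is one of its minimal polynomial m, a divisor
  of f. Were another root of m multiple, its minimal polynomial would be associated to m and divide
  the derivative of m, which does not vanish at x. The criterion trades irreducibility for any
  convenient f.\<close>

lemma sep_closure_iff:
  "x \<in> sep_closure \<longleftrightarrow> (\<exists>f. ac_eval f x = 0 \<and> ac_eval (pderiv f) x \<noteq> 0)"
proof
  assume "x \<in> sep_closure"
  then obtain f where f: "ac_eval f x = 0" "rsquarefree (map_poly to_ac f)"
    unfolding sep_closure_def ac_eval_def by blast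
  let ?f = "map_poly to_ac f"
  have f0: "?f \<noteq> 0" "poly ?f x = 0" using f by (auto simp: rsquarefree_def ac_eval_def)
  have ord: "Polynomial.order x ?f = 1" using f f0 by (intro rsquarefree_root_order)
  then obtain q where q: "?f = [:- x, 1:] * q" "\<not> [:- x, 1:] dvd q"
    using order_decomp[OF f0(1), of x] by auto
  have "poly (pderiv ?f) x = poly q x" by (simp add: q(1) pderiv_mult pderiv_pCons del: mult_pCons_left)
  also have "\<dots> \<noteq> 0" using q(2) by (simp add: poly_eq_0_iff_dvd)
  finally show "\<exists>f. ac_eval f x = 0 \<and> ac_eval (pderiv f) x \<noteq> 0"
    using f(1) by (auto simp: ac_eval_def pderiv_map_poly_to_ac)
next
  assume "\<exists>f. ac_eval f x = 0 \<and> ac_eval (pderiv f) x \<noteq> 0"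
  then obtain f where f: "ac_eval f x = 0" "ac_eval (pderiv f) x \<noteq> 0" by blast
  obtain m where m: "ac_eval m x = 0" "m \<noteq> 0" "Polynomial.degree m > 0"
    "Factorial_Ring.irreducible m" "\<And>f. ac_eval f x = 0 \<Longrightarrow> m dvd f"
    using ac_eval_min_poly[of x] by blast
  obtain q where "f = m * q" using m(5)[OF f(1)] by blast
  then have dm: "ac_eval (pderiv m) x \<noteq> 0" using f(2) m(1) by (auto simp: pderiv_mult)
  have "Polynomial.order a (map_poly to_ac m) = 0 \<or> Polynomial.order a (map_poly to_ac m) = 1" for a
  proof (rule ccontr)
    assume "\<not> ?thesis"
    then have "2 \<le> Polynomial.order a (map_poly to_ac m)" by linarith
    then have "[:- a, 1:] ^ 2 dvd map_poly to_ac m"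
      by (meson order_1 dvd_trans le_imp_power_dvd)
    then obtain h where h: "map_poly to_ac m = [:- a, 1:] * ([:- a, 1:] * h)"
      by (metis dvdE mult.assoc power2_eq_square)
    have "poly (map_poly to_ac m) a = 0" "poly (pderiv (map_poly to_ac m)) a = 0"
      unfolding h pderiv_mult poly_mult poly_add by simp_all
    then have a: "ac_eval m a = 0" "ac_eval (pderiv m) a = 0"
      by (simp_all add: ac_eval_def pderiv_map_poly_to_ac)
    obtain n where n: "n \<noteq> 0" "Polynomial.degree n > 0" "\<And>f. ac_eval f a = 0 \<Longrightarrow> n dvd f"
      using ac_eval_min_poly[of a] by blast
    obtain c where c: "m = n * c" using n(3)[OF a(1)] by blast
    have "\<not> n dvd 1" using n(2) by (auto simp: is_unit_poly_iff)
    then have "c dvd 1" using m(4) c Factorial_Ring.irreducibleD by blast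
    then have "m dvd n" using c by (metis dvd_mult_unit_iff dvd_refl)
    then have "m dvd pderiv m" using n(3)[OF a(2)] dvd_trans by blast
    then obtain k where "pderiv m = m * k" by blast
    then have "ac_eval (pderiv m) x = 0" using m(1) by simp
    with dm show False ..
  qed
  moreover have "map_poly to_ac m \<noteq> 0"
    using m(3) degree_map_poly[of to_ac m] by auto
  ultimately have "rsquarefree (map_poly to_ac m)"
    by (simp add: rsquarefree_def)
  then show "x \<in> sep_closure"
    using m unfolding sep_closure_def ac_eval_def by blast
qed

lemma to_ac_in_sep_closure [simp]: "to_ac a \<in> sep_closure"
  unfolding sep_closure_iff by (rule exI[of _ "[:- a, 1:]"]) (simp add: pderiv_pCons)

lemma zero_one_in_sep_closure [simp]: "0 \<in> sep_closure" "1 \<in> sep_closure"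
  using to_ac_in_sep_closure[of 0] to_ac_in_sep_closure[of 1] by simp_all

text \<open>By the chain rule f(X^n) has a simple root at y. This gives p-divisibility of the unit
  group.\<close>

lemma sep_closure_root:
  fixes y :: "'a::field alg_closure"
  assumes "y ^ n \<in> sep_closure" "y \<noteq> 0" "of_nat n \<noteq> (0 :: 'a)"
  shows "y \<in> sep_closure"
proof -
  obtain f where f: "ac_eval f (y ^ n) = 0" "ac_eval (pderiv f) (y ^ n) \<noteq> 0"
    using assms(1) sep_closure_iff by blast
  let ?g = "pcompose f (Polynomial.monom 1 n)"
  have "ac_eval ?g y = 0" using f(1) by (simp add: ac_eval_pcompose)
  moreover have "ac_eval (pderiv ?g) y \<noteq> 0"
    using f(2) assms(2,3) by (simp add: pderiv_pcompose pderiv_monom ac_eval_pcompose)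
      (metis to_ac_eq_0_iff to_ac_of_nat)
  ultimately show ?thesis using sep_closure_iff by blast
qed

section \<open>Linear algebra over the base field\<close>

interpretation acv: vector_space "\<lambda>c (x :: 'a::field alg_closure). to_ac c * x"
  by standard (simp_all add: algebra_simps)

lemma ac_eval_in_span:
  "Polynomial.degree f < n \<Longrightarrow> ac_eval f x \<in> acv.span ((\<lambda>i. x ^ i) ` {..<n})"
  unfolding ac_eval_altdef
  by (intro acv.span_sum acv.span_scale acv.span_base) auto

lemma power_in_span:
  assumes m: "ac_eval m x = 0" "m \<noteq> 0" "Polynomial.degree m > 0"
  shows "x ^ i \<in> acv.span ((\<lambda>i. x ^ i) ` {..<Polynomial.degree m})"
proof -
  have "x ^ i = ac_eval (Polynomial.monom 1 i mod m) x"
    using ac_eval_add[of "Polynomial.monom 1 i div m * m" "Polynomial.monom 1 i mod m" x] m(1) by simp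
  also have "\<dots> \<in> acv.span ((\<lambda>i. x ^ i) ` {..<Polynomial.degree m})"
    using degree_mod_less[of m "Polynomial.monom 1 i"] m(2,3) by (intro ac_eval_in_span) auto
  finally show ?thesis .
qed

lemma finite_power_span:
  obtains T where "finite T" "\<And>i. x ^ i \<in> acv.span T"
proof -
  obtain m where m: "ac_eval m x = 0" "m \<noteq> 0" "Polynomial.degree m > 0"
    using ac_eval_min_poly[of x] by blast
  show ?thesis by (rule that[OF _ power_in_span[OF m]]) simp
qed

lemma span_mult:
  assumes "x \<in> acv.span A" "y \<in> acv.span B"
  shows "x * y \<in> acv.span ((\<lambda>(a, b). a * b) ` (A \<times> B))" (is "_ \<in> acv.span ?C")
proof -
  have *: "a * y \<in> acv.span ?C" if "a \<in> A" for a
    using assms(2)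
  proof (induction rule: acv.span_induct_alt)
    case (step c b z)
    have "a * b \<in> ?C" using that step by force
    then have "to_ac c * (a * b) + a * z \<in> acv.span ?C"
      using step(2) by (intro acv.span_add acv.span_scale acv.span_base[of "a * b"])
    then show ?case by (simp add: algebra_simps)
  qed (simp add: acv.span_zero)
  show ?thesis using assms(1)
  proof (induction rule: acv.span_induct_alt)
    case (step c a z)
    then have "to_ac c * (a * y) + z * y \<in> acv.span ?C"
      by (intro acv.span_add acv.span_scale *[OF step(1)] step(2))
    then show ?case by (simp add: algebra_simps)
  qed (simp add: acv.span_zero)
qed

lemma span_mult_closed:
  assumes "\<And>a b. a \<in> A \<Longrightarrow> b \<in> A \<Longrightarrow> a * b \<in> A" "x \<in> acv.span A" "y \<in> acv.span A"
  shows "x * y \<in> acv.span A"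
proof -
  have "(\<lambda>(a, b). a * b) ` (A \<times> A) \<subseteq> A" using assms(1) by auto
  from acv.span_mono[OF this] show ?thesis using span_mult[OF assms(2,3)] by blast
qed

text \<open>Independence is a property of the set of powers, so their distinctness is recorded
  separately; each expresses that x satisfies no relation of degree below n.\<close>

lemma independent_powers:
  assumes m: "\<And>f. f \<noteq> 0 \<Longrightarrow> ac_eval f x = 0 \<Longrightarrow> n \<le> Polynomial.degree f"
  shows "inj_on (\<lambda>i. x ^ i) {..<n}" "acv.independent ((\<lambda>i. x ^ i) ` {..<n})"
proof -
  have zero: "c i = 0" if "(\<Sum>i<n. to_ac (c i) * x ^ i) = 0" "i < n" for c i
  proof -
    define f where "f = (\<Sum>i<n. Polynomial.monom (c i) i)"
    have coeff: "Polynomial.coeff f j = (if j < n then c j else 0)" for j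
      by (simp add: f_def Polynomial.coeff_sum if_distrib[of "\<lambda>f. f _"] cong: if_cong)
    have "ac_eval f x = (\<Sum>i<n. to_ac (c i) * x ^ i)"
      unfolding f_def by (induction n) simp_all
    then have "f = 0 \<or> n \<le> Polynomial.degree f" using m that(1) by auto
    moreover have "Polynomial.degree f < n"
      using that(2) coeff by (intro Polynomial.degree_lessI) auto
    ultimately have "f = 0" by simp
    then show ?thesis using coeff[of i] that(2) by simp
  qed
  show inj: "inj_on (\<lambda>i. x ^ i) {..<n}"
  proof (rule inj_onI, rule ccontr)
    fix i j assume ij: "i \<in> {..<n}" "j \<in> {..<n}" "x ^ i = x ^ j" "i \<noteq> j"
    let ?c = "\<lambda>k. if k = i then 1 else if k = j then - 1 else 0 :: 'a"
    have "(\<Sum>k<n. to_ac (?c k) * x ^ k) = (\<Sum>k\<in>{i, j}. to_ac (?c k) * x ^ k)"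
      using ij by (intro sum.mono_neutral_right) auto
    also have "\<dots> = 0" using ij by simp
    finally show False using zero[of ?c i] ij by simp
  qed
  show "acv.independent ((\<lambda>i. x ^ i) ` {..<n})"
  proof (rule acv.independent_if_scalars_zero)
    fix f y assume f: "(\<Sum>x\<in>(\<lambda>i. x ^ i) ` {..<n}. to_ac (f x) * x) = 0" "y \<in> (\<lambda>i. x ^ i) ` {..<n}"
    then have "(\<Sum>i<n. to_ac (f (x ^ i)) * x ^ i) = 0"
      by (simp add: sum.reindex[OF inj])
    then show "f y = 0" using zero[of "\<lambda>i. f (x ^ i)"] f(2) by auto
  qed simp
qed

lemma independent_card_spans:
  assumes B: "acv.independent B" "B \<subseteq> acv.span T" and T: "finite T" "card T \<le> card B"
  shows "acv.span T \<subseteq> acv.span B"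
proof
  fix x assume x: "x \<in> acv.span T"
  show "x \<in> acv.span B"
  proof (rule ccontr)
    assume nx: "x \<notin> acv.span B"
    then have "acv.independent (insert x B)" using B acv.independent_insert[of x B] by auto
    from acv.independent_span_bound[OF T(1) this] have "card (insert x B) \<le> card T" "finite B"
      using x B by auto
    then show False using T(2) nx acv.span_base[of x B] by (auto simp: card_insert_if split: if_splits)
  qed
qed

text \<open>In characteristic \<open>l > 0\<close>, an algebra spanned by its \<open>l\<close>-th powers is separable: by
  counting dimensions the Frobenius preserves linear independence, whereas the minimal polynomial
  of an inseparable element is a linear relation between \<open>l\<close>-th powers of smaller degree.\<close>

lemma frobenius_independent:
  fixes V :: "'a::field alg_closure set"
  assumes l: "l = CHAR('a)" "l > 0" and T: "finite T" "V \<subseteq> acv.span T"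
    and V: "V \<subseteq> acv.span ((\<lambda>v. v ^ l) ` V)"
    and B: "B \<subseteq> V" "acv.independent B"
  shows "acv.independent ((\<lambda>v. v ^ l) ` B)"
proof -
  have prime_l: "Factorial_Ring.prime CHAR('a alg_closure)"
    using l prime_CHAR_semidom[where ?'a = 'a] by simp
  have frob_sum: "(\<Sum>i\<in>I. f i) ^ l = (\<Sum>i\<in>I. f i ^ l)" for I and f :: "'b \<Rightarrow> 'a alg_closure"
    using freshmans_dream_sum[OF prime_l, of l f I] l by simp
  obtain C where C: "B \<subseteq> C" "C \<subseteq> V" "acv.independent C" "V \<subseteq> acv.span C"
    using acv.maximal_independent_subset_extend[OF B] by metis
  have fin: "finite C" using acv.independent_span_bound[OF T(1) C(3)] C(2) T(2) by auto
  let ?P = "(\<lambda>v. v ^ l) ` C"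
  \<comment> \<open>Frobenius is additive and sends scalars to scalars, so the l-th powers of a
    basis span all l-th powers, hence all of V.\<close>
  have "v ^ l \<in> acv.span ?P" if "v \<in> V" for v
  proof -
    have "v \<in> acv.span C" using that C(4) by blast
    then obtain c where "v = (\<Sum>b\<in>C. to_ac (c b) * b)"
      unfolding acv.span_finite[OF fin] by blast
    then have "v ^ l = (\<Sum>b\<in>C. to_ac (c b ^ l) * b ^ l)"
      by (simp add: frob_sum power_mult_distrib)
    also have "\<dots> \<in> acv.span ?P"
      by (intro acv.span_sum acv.span_scale acv.span_base) auto
    finally show ?thesis .
  qed
  then have "acv.span ((\<lambda>v. v ^ l) ` V) \<subseteq> acv.span ?P"
    by (intro acv.span_minimal) auto
  then have C_P: "C \<subseteq> acv.span ?P" using V C(2) by blast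
  \<comment> \<open>A redundant vector could be dropped, leaving fewer than \<open>card C\<close>
    vectors to span the independent set C.\<close>
  have "acv.independent ?P"
  proof
    assume "acv.dependent ?P"
    then obtain a where a: "a \<in> ?P" "a \<in> acv.span (?P - {a})"
      by (auto simp: acv.dependent_def)
    then have "acv.span ?P = acv.span (?P - {a})"
      using acv.span_redundant[OF a(2)] by (simp add: insert_absorb)
    with C_P have "C \<subseteq> acv.span (?P - {a})" by blast
    from acv.independent_span_bound[OF _ C(3) this] have "card C \<le> card (?P - {a})"
      using fin by simp
    also have "\<dots> < card ?P" using a(1) fin by (metis card_Diff1_less finite_imageI)
    also have "\<dots> \<le> card C" using fin by (rule card_image_le)
    finally show False by simp
  qed
  then show ?thesis using C(1) by (elim acv.independent_mono) auto
qed

lemma frobenius_span_imp_separable: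
  fixes V :: "'a::field alg_closure set"
  assumes l: "l = CHAR('a)" "l > 0" and T: "finite T" "V \<subseteq> acv.span T"
    and V: "V \<subseteq> acv.span ((\<lambda>v. v ^ l) ` V)"
    and one: "1 \<in> V" and mult: "\<And>x y. x \<in> V \<Longrightarrow> y \<in> V \<Longrightarrow> x * y \<in> V"
  shows "V \<subseteq> sep_closure"
proof
  fix z assume z: "z \<in> V"
  obtain m where m: "ac_eval m z = 0" "m \<noteq> 0" "Polynomial.degree m > 0"
    "\<And>f. ac_eval f z = 0 \<Longrightarrow> m dvd f"
    using ac_eval_min_poly[of z] by blast
  let ?d = "Polynomial.degree m"
  have min: "?d \<le> Polynomial.degree f" if "f \<noteq> 0" "ac_eval f z = 0" for f
    using m(4)[OF that(2)] that(1) by (rule dvd_imp_degree_le)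
  have l_prime: "Factorial_Ring.prime l" using l prime_CHAR_semidom[where ?'a = 'a] by simp
  then have l1: "l > 1" by (rule prime_gt_1_nat)
  have "pderiv m \<noteq> 0"
  proof
    assume "pderiv m = 0"
    \<comment> \<open>With zero derivative, m is a polynomial in X^l.\<close>
    have coeff_0: "Polynomial.coeff m i = 0" if "\<not> l dvd i" for i
    proof (cases i)
      case (Suc j)
      have "of_nat i * Polynomial.coeff m i = (0 :: 'a)"
        using \<open>pderiv m = 0\<close> coeff_pderiv[of m j] Suc by simp
      then show ?thesis using that l by (simp add: of_nat_eq_0_iff_char_dvd del: of_nat_Suc)
    qed (use that in simp)
    have "l dvd ?d" using coeff_0[of ?d] m(2) by auto
    then obtain e where e: "?d = l * e" by blast
    then have "e < ?d" using m(3) l1 by (simp add: n_less_m_mult_n)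
    let ?b = "\<lambda>i. z ^ i"
    have ind: "inj_on ?b {..<?d}" "acv.independent (?b ` {..<?d})"
      using independent_powers[of z ?d] min by blast+
    have sub: "{..e} \<subseteq> {..<?d}" using \<open>e < ?d\<close> by auto
    have zV: "z ^ i \<in> V" for i by (induction i) (simp_all add: one mult z)
    have "acv.independent (?b ` {..e})"
      using ind(2) sub by (elim acv.independent_mono) auto
    then have ind': "acv.independent ((\<lambda>v. v ^ l) ` ?b ` {..e})"
      using zV by (intro frobenius_independent[OF l T V]) auto
    have inj: "inj_on (\<lambda>i. z ^ (l * i)) {..e}"
    proof (rule inj_onI)
      fix i j assume ij: "i \<in> {..e}" "j \<in> {..e}" "z ^ (l * i) = z ^ (l * j)"
      have "(z ^ i - z ^ j) ^ l = (z ^ i) ^ l - (z ^ j) ^ l"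
      proof -
        have "((z ^ i - z ^ j) + z ^ j) ^ l = (z ^ i - z ^ j) ^ l + (z ^ j) ^ l"
          using l l_prime by (intro freshmans_dream) simp_all
        then show ?thesis by simp
      qed
      also have "\<dots> = 0" using ij(3) by (simp add: mult.commute flip: power_mult)
      finally have "z ^ i = z ^ j" by simp
      then show "i = j" using inj_onD[OF ind(1)] ij sub by blast
    qed
    have img: "(\<lambda>v. v ^ l) ` ?b ` {..e} = (\<lambda>i. z ^ (l * i)) ` {..e}"
      by (auto simp: image_image mult.commute simp flip: power_mult)
    have "0 = (\<Sum>i\<le>?d. to_ac (Polynomial.coeff m i) * z ^ i)"
      using m(1) by (simp add: ac_eval_altdef)
    also have "\<dots> = (\<Sum>i\<in>(\<lambda>j. l * j) ` {..e}. to_ac (Polynomial.coeff m i) * z ^ i)"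
    proof (rule sum.mono_neutral_right)
      show "(\<lambda>j. l * j) ` {..e} \<subseteq> {..?d}" using e by auto
      show "\<forall>i\<in>{..?d} - (\<lambda>j. l * j) ` {..e}. to_ac (Polynomial.coeff m i) * z ^ i = 0"
      proof
        fix i assume i: "i \<in> {..?d} - (\<lambda>j. l * j) ` {..e}"
        have "\<not> l dvd i"
        proof
          assume "l dvd i"
          then obtain k where "i = l * k" by blast
          then show False using i e l(2) by auto
        qed
        then show "to_ac (Polynomial.coeff m i) * z ^ i = 0" by (simp add: coeff_0)
      qed
    qed simp
    also have "\<dots> = (\<Sum>j\<le>e. to_ac (Polynomial.coeff m (l * j)) * z ^ (l * j))"
      using l(2) by (subst sum.reindex) (auto simp: inj_on_def)
    finally have rel: "(\<Sum>j\<le>e. to_ac (Polynomial.coeff m (l * j)) * z ^ (l * j)) = 0" by simp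
    \<comment> \<open>The coefficients are reindexed by the vectors themselves, as independence of a
      set requires.\<close>
    define u where "u = (\<lambda>v. Polynomial.coeff m (l * the_inv_into {..e} (\<lambda>i. z ^ (l * i)) v))"
    have "(\<Sum>v\<in>(\<lambda>i. z ^ (l * i)) ` {..e}. to_ac (u v) * v) = 0"
      using rel by (simp add: sum.reindex[OF inj] u_def the_inv_into_f_f[OF inj])
    then have "u (z ^ (l * e)) = 0"
      using ind' unfolding img acv.independent_explicit_finite_subsets by auto
    then have "Polynomial.coeff m (l * e) = 0"
      using the_inv_into_f_f[OF inj, of e] by (simp add: u_def)
    then show False using m(2) by (simp flip: e)
  qed
  then have "ac_eval (pderiv m) z \<noteq> 0"
    using min[of "pderiv m"] m(3) degree_pderiv_less[of m] by (intro notI) linarith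
  then show "z \<in> sep_closure" using m(1) sep_closure_iff by blast
qed

text \<open>With \<open>m\<close> the minimal polynomial of \<open>x\<close>, which is prime to its derivative: if \<open>n(x\<^sup>l) = 0\<close>, then
  differentiating \<open>n(X\<^sup>l) = m\<^sup>k q\<close> for \<open>0 < k < l\<close> gives \<open>m dvd q\<close>, so \<open>m\<^sup>l\<close> divides
  \<open>n(X\<^sup>l)\<close> and \<open>deg n \<ge> deg m\<close>.\<close>

lemma separable_in_span_powers:
  fixes x :: "'a::field alg_closure"
  assumes l: "l = CHAR('a)" "l > 0" and x: "x \<in> sep_closure"
  shows "x \<in> acv.span (range (\<lambda>i. (x ^ i) ^ l))"
proof -
  obtain m where m: "ac_eval m x = 0" "m \<noteq> 0" "Polynomial.degree m > 0"
    "\<And>f. ac_eval f x = 0 \<Longrightarrow> m dvd f"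
    using ac_eval_min_poly[of x] by blast
  let ?d = "Polynomial.degree m"
  obtain f where f: "ac_eval f x = 0" "ac_eval (pderiv f) x \<noteq> 0" using x sep_closure_iff by blast
  obtain q where "f = m * q" using m(4)[OF f(1)] by blast
  then have dm: "ac_eval (pderiv m) x \<noteq> 0" using f(2) m(1) by (auto simp: pderiv_mult)
  have min: "?d \<le> Polynomial.degree n" if n: "n \<noteq> 0" "ac_eval n (x ^ l) = 0" for n
  proof -
    let ?n = "pcompose n (Polynomial.monom 1 l)"
    have "pderiv (Polynomial.monom 1 l :: 'a poly) = 0"
      using l(1) by (simp add: pderiv_monom)
    then have dn: "pderiv ?n = 0" by (simp add: pderiv_pcompose)
    have "k \<le> l \<Longrightarrow> m ^ k dvd ?n" for k
    proof (induction k)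
      case (Suc k)
      then obtain q where q: "?n = m ^ k * q" by auto
      have "m dvd q"
      proof (cases k)
        case 0
        have "ac_eval ?n x = 0" using n(2) by (simp add: ac_eval_pcompose)
        then show ?thesis using m(4) q 0 by (metis mult_1 power_0)
      next
        case (Suc j)
        have "pderiv (m ^ k) = Polynomial.smult (of_nat k) (m ^ j) * pderiv m"
          unfolding Suc by (rule pderiv_power_Suc)
        then have "pderiv ?n = m ^ k * pderiv q + q * (Polynomial.smult (of_nat k) (m ^ j) * pderiv m)"
          unfolding q pderiv_mult by simp
        then have "m ^ j * (Polynomial.smult (of_nat k) (pderiv m * q) + m * pderiv q) = pderiv ?n"
          by (simp add: Suc algebra_simps)
        then have "Polynomial.smult (of_nat k) (pderiv m * q) + m * pderiv q = 0"
          using dn m(2) by simp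
        then have "ac_eval (Polynomial.smult (of_nat k) (pderiv m * q) + m * pderiv q) x = 0"
          by simp
        moreover have "of_nat k \<noteq> (0 :: 'a alg_closure)"
          using Suc.prems \<open>k = Suc j\<close> l(1) by (auto simp: of_nat_eq_0_iff_char_dvd simp del: of_nat_Suc dest!: dvd_imp_le)
        ultimately have "ac_eval q x = 0" using dm m(1) by simp
        then show ?thesis by (rule m(4))
      qed
      then show ?case using q by (metis mult_dvd_mono dvd_refl power_Suc2)
    qed simp
    then have "m ^ l dvd ?n" by simp
    moreover have "?n \<noteq> 0"
      using n(1) l(2) by (auto simp: pcompose_eq_0_iff degree_monom_eq)
    ultimately have "l * ?d \<le> Polynomial.degree ?n"
      using dvd_imp_degree_le[of "m ^ l" ?n] m(2) by (simp add: degree_power_eq)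
    then show ?thesis using l(2) by (simp add: degree_pcompose degree_monom_eq)
  qed
  have ind: "inj_on (\<lambda>i. (x ^ l) ^ i) {..<?d}" "acv.independent ((\<lambda>i. (x ^ l) ^ i) ` {..<?d})"
    using independent_powers[of "x ^ l" ?d] min by blast+
  let ?T = "(\<lambda>i. x ^ i) ` {..<?d}"
  note T = power_in_span[OF m(1-3)]
  \<comment> \<open>Dimension count: the powers of x^l below deg m are independent and as numerous
    as a spanning set of F[x], so F[x^l] = F[x].\<close>
  have "acv.span ?T \<subseteq> acv.span ((\<lambda>i. (x ^ l) ^ i) ` {..<?d})"
  proof (rule independent_card_spans[OF ind(2)])
    show "(\<lambda>i. (x ^ l) ^ i) ` {..<?d} \<subseteq> acv.span ?T" using T by (auto simp flip: power_mult)
    show "card ?T \<le> card ((\<lambda>i. (x ^ l) ^ i) ` {..<?d})"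
      using card_image_le[of "{..<?d}" "\<lambda>i. x ^ i"] by (simp add: card_image[OF ind(1)])
  qed simp
  also have "\<dots> \<subseteq> acv.span (range (\<lambda>i. (x ^ i) ^ l))"
    by (intro acv.span_mono) (auto simp: mult.commute simp flip: power_mult)
  finally show ?thesis using T[of 1] by auto
qed

text \<open>In characteristic 0 a minimal polynomial cannot divide its nonzero derivative. In
  characteristic l, the span of the l-th powers of F[x,y] is a ring that contains the separable
  generators x and y, hence all of F[x,y]; the Frobenius criterion then applies to every element at
  once.\<close>

lemma sep_closure_algebra:
  fixes x y :: "'a::field alg_closure"
  assumes x: "x \<in> sep_closure" and y: "y \<in> sep_closure"
  shows "acv.span (range (\<lambda>(i, j). x ^ i * y ^ j)) \<subseteq> sep_closure" (is "?V \<subseteq> _")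
proof (cases "CHAR('a) = 0")
  case True
  have "z \<in> sep_closure" for z :: "'a alg_closure"
  proof -
    obtain m where m: "ac_eval m z = 0" "m \<noteq> 0" "Polynomial.degree m > 0"
      "\<And>f. ac_eval f z = 0 \<Longrightarrow> m dvd f"
      using ac_eval_min_poly[of z] by blast
    have "Polynomial.coeff (pderiv m) (Polynomial.degree m - 1)
        = of_nat (Polynomial.degree m) * Polynomial.coeff m (Polynomial.degree m)"
      using m(3) by (simp add: coeff_pderiv del: of_nat_Suc)
    moreover have "\<dots> \<noteq> 0" using m(2,3) True by (simp add: of_nat_eq_0_iff_char_dvd)
    ultimately have "pderiv m \<noteq> 0" by auto
    then have "\<not> m dvd pderiv m"
      using dvd_imp_degree_le[of m "pderiv m"] degree_pderiv_less[of m] m(3) by auto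
    then show ?thesis using m sep_closure_iff by blast
  qed
  then show ?thesis by blast
next
  case False
  define l where "l = CHAR('a)"
  have l: "l = CHAR('a)" "l > 0" using False by (simp_all add: l_def)
  let ?G = "range (\<lambda>(i, j). x ^ i * y ^ j)"
  have G_mult: "a * b \<in> ?G" if ab: "a \<in> ?G" "b \<in> ?G" for a b
  proof -
    obtain u v where "a = x ^ fst u * y ^ snd u" "b = x ^ fst v * y ^ snd v"
      using ab by (auto simp: case_prod_beta)
    then have "a * b = (\<lambda>(i, j). x ^ i * y ^ j) (fst u + fst v, snd u + snd v)"
      by (simp add: power_add mult_ac)
    then show ?thesis by blast
  qed
  have xG: "x ^ i \<in> ?V" and yG: "y ^ i \<in> ?V" for i
    by (rule acv.span_base, rule range_eqI[of _ _ "(i, 0)"], simp,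
        rule acv.span_base, rule range_eqI[of _ _ "(0, i)"], simp)
  have V_mult: "a * b \<in> ?V" if "a \<in> ?V" "b \<in> ?V" for a b
    using span_mult_closed[of ?G a b] G_mult that by blast
  obtain A where A: "finite A" "\<And>i. x ^ i \<in> acv.span A" using finite_power_span by blast
  obtain B where B: "finite B" "\<And>i. y ^ i \<in> acv.span B" using finite_power_span by blast
  let ?T = "(\<lambda>(a, b). a * b) ` (A \<times> B)"
  have T: "?V \<subseteq> acv.span ?T"
    using span_mult[OF A(2) B(2)] by (intro acv.span_minimal) auto
  let ?U = "acv.span ((\<lambda>v. v ^ l) ` ?V)"
  have U_mult: "a * b \<in> ?U" if "a \<in> ?U" "b \<in> ?U" for a b
    using that
  proof (rule span_mult_closed[rotated])
    fix a b assume "a \<in> (\<lambda>v. v ^ l) ` ?V" "b \<in> (\<lambda>v. v ^ l) ` ?V"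
    then show "a * b \<in> (\<lambda>v. v ^ l) ` ?V"
      using V_mult by (auto simp: image_iff simp flip: power_mult_distrib)
  qed
  have one_V: "1 \<in> ?V" using xG[of 0] by simp
  then have "1 \<in> (\<lambda>v. v ^ l) ` ?V" by (rule rev_image_eqI) simp
  then have one_U: "1 \<in> ?U" by (rule acv.span_base)
  have "x \<in> ?U"
    using separable_in_span_powers[OF l x] acv.span_mono[of "range (\<lambda>i. (x ^ i) ^ l)" "(\<lambda>v. v ^ l) ` ?V"] xG
    by blast
  moreover have "y \<in> ?U"
    using separable_in_span_powers[OF l y] acv.span_mono[of "range (\<lambda>i. (y ^ i) ^ l)" "(\<lambda>v. v ^ l) ` ?V"] yG
    by blast
  ultimately have pow_U: "x ^ i \<in> ?U" "y ^ i \<in> ?U" for i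
    by (induction i) (simp_all add: one_U U_mult)
  have V_U: "?V \<subseteq> ?U" using U_mult pow_U by (intro acv.span_minimal) auto
  show ?thesis
    by (rule frobenius_span_imp_separable[OF l _ T V_U one_V V_mult]) (use A(1) B(1) in simp_all)
qed

section \<open>Field operations on separable elements\<close>

lemma sep_closure_add: "x \<in> sep_closure \<Longrightarrow> y \<in> sep_closure \<Longrightarrow> x + y \<in> sep_closure"
  and sep_closure_mult: "x \<in> sep_closure \<Longrightarrow> y \<in> sep_closure \<Longrightarrow> x * y \<in> sep_closure"
proof -
  assume xy: "x \<in> sep_closure" "y \<in> sep_closure"
  have b: "x ^ i * y ^ j \<in> acv.span (range (\<lambda>(i, j). x ^ i * y ^ j))" for i j
    by (rule acv.span_base, rule range_eqI[of _ _ "(i, j)"]) simp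
  show "x + y \<in> sep_closure"
    using sep_closure_algebra[OF xy] acv.span_add[OF b[of 1 0] b[of 0 1]] by auto
  show "x * y \<in> sep_closure"
    using sep_closure_algebra[OF xy] b[of 1 1] by auto
qed

lemma sep_closure_minus: "x \<in> sep_closure \<Longrightarrow> - x \<in> sep_closure"
  using sep_closure_mult[OF to_ac_in_sep_closure[of "- 1"]] by simp

lemma sep_closure_sum: "(\<And>i. i \<in> A \<Longrightarrow> f i \<in> sep_closure) \<Longrightarrow> sum f A \<in> sep_closure"
  by (induction A rule: infinite_finite_induct) (simp_all add: sep_closure_add)

lemma sep_closure_power: "x \<in> sep_closure \<Longrightarrow> x ^ n \<in> sep_closure"
  by (induction n) (simp_all add: sep_closure_mult)

lemma ac_eval_in_sep_closure: "x \<in> sep_closure \<Longrightarrow> ac_eval f x \<in> sep_closure"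
  by (induction f) (simp_all add: sep_closure_add sep_closure_mult)

text \<open>The minimal polynomial of a nonzero x has nonzero constant coefficient, which exhibits
  the inverse as a polynomial in x.\<close>

lemma sep_closure_inverse:
  assumes "x \<in> sep_closure"
  shows "inverse x \<in> sep_closure"
proof (cases "x = 0")
  case False
  obtain m where m: "ac_eval m x = 0" "m \<noteq> 0" "Polynomial.degree m > 0"
    "\<And>f. ac_eval f x = 0 \<Longrightarrow> m dvd f"
    using ac_eval_min_poly[of x] by blast
  obtain c q where q: "m = pCons c q" by (cases m)
  have "c \<noteq> 0"
  proof
    assume "c = 0"
    then have "ac_eval q x = 0" "q \<noteq> 0" using m(1,2) False by (auto simp: q)
    then have "Polynomial.degree m \<le> Polynomial.degree q" using m(4) dvd_imp_degree_le by blast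
    then show False using \<open>q \<noteq> 0\<close> by (simp add: q)
  qed
  moreover have "x * ac_eval q x = - to_ac c"
    using m(1) by (simp add: q eq_neg_iff_add_eq_0 add.commute)
  ultimately have "x * ac_eval (Polynomial.smult (- inverse c) q) x = 1"
    by (simp add: mult.left_commute[of x])
  then have "inverse x = ac_eval (Polynomial.smult (- inverse c) q) x"
    by (rule inverse_unique)
  then show ?thesis using ac_eval_in_sep_closure[OF assms] by metis
qed simp

section \<open>The absolute Galois group and Hilbert 90\<close>

lemma galois_group_iff:
  fixes \<sigma> :: "'a::field alg_closure \<Rightarrow> 'a alg_closure"
  shows "\<sigma> \<in> carrier absolute_galois_group \<longleftrightarrow>
    \<sigma> \<in> extensional sep_closure \<and> bij_betw \<sigma> sep_closure sep_closure \<and>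
    (\<forall>x\<in>sep_closure. \<forall>y\<in>sep_closure. \<sigma> (x + y) = \<sigma> x + \<sigma> y \<and> \<sigma> (x * y) = \<sigma> x * \<sigma> y) \<and>
    (\<forall>a. \<sigma> (to_ac a) = to_ac a)"
proof -
  have "\<sigma> 1 = 1" if "\<forall>a. \<sigma> (to_ac a) = to_ac a"
    using that to_ac_1 by metis
  then show ?thesis
    by (auto simp: absolute_galois_group_def ring_iso_def ring_hom_def sep_closure_ring_def
        ring_of_type_algebra_def bij_betw_def)
qed

section \<open>The Galois group as a type with additive notation\<close>

typedef (overloaded) 'a gal =
  "carrier (absolute_galois_group :: ('a::field alg_closure \<Rightarrow> 'a alg_closure) monoid)"
  by (rule exI[of _ "\<lambda>x\<in>sep_closure. x"])
    (auto simp: galois_group_iff sep_closure_add sep_closure_mult bij_betw_def inj_on_def)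

lemma Rep_gal_iff:
  "Rep_gal g \<in> extensional sep_closure" "bij_betw (Rep_gal g) sep_closure sep_closure"
  "x \<in> sep_closure \<Longrightarrow> y \<in> sep_closure \<Longrightarrow> Rep_gal g (x + y) = Rep_gal g x + Rep_gal g y"
  "x \<in> sep_closure \<Longrightarrow> y \<in> sep_closure \<Longrightarrow> Rep_gal g (x * y) = Rep_gal g x * Rep_gal g y"
  "Rep_gal g (to_ac a) = to_ac a"
  using Rep_gal[of g] by (simp_all add: galois_group_iff)

lemma Rep_gal_in [simp]: "x \<in> sep_closure \<Longrightarrow> Rep_gal g x \<in> sep_closure"
  using Rep_gal_iff(2)[of g] by (auto simp: bij_betw_def)

lemma gal_eqI: "(\<And>x. x \<in> sep_closure \<Longrightarrow> Rep_gal g x = Rep_gal h x) \<Longrightarrow> g = h"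
  using extensionalityI[OF Rep_gal_iff(1) Rep_gal_iff(1)] Rep_gal_inject by metis

lemma Rep_gal_0 [simp]: "Rep_gal g 0 = 0" and Rep_gal_1 [simp]: "Rep_gal g 1 = 1"
  using Rep_gal_iff(5)[of g 0] Rep_gal_iff(5)[of g 1] by simp_all

lemma Rep_gal_eq_0_iff [simp]: "x \<in> sep_closure \<Longrightarrow> Rep_gal g x = 0 \<longleftrightarrow> x = 0"
  using Rep_gal_iff(2)[of g] by (metis Rep_gal_0 bij_betw_def inj_onD zero_one_in_sep_closure(1))

lemma Rep_gal_sum:
  "(\<And>i. i \<in> A \<Longrightarrow> f i \<in> sep_closure) \<Longrightarrow> Rep_gal g (sum f A) = (\<Sum>i\<in>A. Rep_gal g (f i))"
  by (induction A rule: infinite_finite_induct) (simp_all add: Rep_gal_iff sep_closure_sum)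

lemma Rep_gal_field_inverse: "x \<in> sep_closure \<Longrightarrow> Rep_gal g (inverse x) = inverse (Rep_gal g x)"
  by (cases "x = 0")
    (simp, metis Rep_gal_1 Rep_gal_iff(4) inverse_unique right_inverse sep_closure_inverse)

lemma ac_eval_Rep_gal: "x \<in> sep_closure \<Longrightarrow> ac_eval f (Rep_gal g x) = Rep_gal g (ac_eval f x)"
  by (induction f) (simp_all add: Rep_gal_iff ac_eval_in_sep_closure sep_closure_mult)

instantiation gal :: (field) group_add
begin

definition "zero_gal = Abs_gal (\<lambda>x\<in>sep_closure. x)"
definition "plus_gal g h = Abs_gal (compose sep_closure (Rep_gal g) (Rep_gal h))"
definition "uminus_gal g = Abs_gal (\<lambda>x\<in>sep_closure. inv_into sep_closure (Rep_gal g) x)"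
definition minus_gal :: "'a gal \<Rightarrow> 'a gal \<Rightarrow> 'a gal" where "minus_gal g h = g + - h"

lemma Rep_gal_zero: "Rep_gal (0 :: 'a gal) = (\<lambda>x\<in>sep_closure. x)"
proof -
  have "(\<lambda>x\<in>sep_closure. x)
      \<in> carrier (absolute_galois_group :: ('a alg_closure \<Rightarrow> 'a alg_closure) monoid)"
    by (auto simp: galois_group_iff sep_closure_add sep_closure_mult bij_betw_def inj_on_def)
  then show ?thesis by (simp add: zero_gal_def Abs_gal_inverse)
qed

lemma Rep_gal_add: "Rep_gal (g + h) = compose sep_closure (Rep_gal g) (Rep_gal h)"
proof -
  have "bij_betw (compose sep_closure (Rep_gal g) (Rep_gal h)) sep_closure sep_closure"
    using bij_betw_compose[OF Rep_gal_iff(2)[of h] Rep_gal_iff(2)[of g]] by simp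
  then have "compose sep_closure (Rep_gal g) (Rep_gal h) \<in> carrier absolute_galois_group"
    by (simp add: galois_group_iff compose_eq sep_closure_add sep_closure_mult Rep_gal_iff)
  then show ?thesis by (simp add: plus_gal_def Abs_gal_inverse)
qed

lemma Rep_gal_uminus: "Rep_gal (- g) = (\<lambda>x\<in>sep_closure. inv_into sep_closure (Rep_gal g) x)"
proof -
  let ?i = "inv_into sep_closure (Rep_gal g)"
  have bij: "bij_betw ?i sep_closure sep_closure" by (rule bij_betw_inv_into[OF Rep_gal_iff(2)])
  have im: "?i x \<in> sep_closure" "Rep_gal g (?i x) = x" if "x \<in> sep_closure" for x
    using that bij Rep_gal_iff(2)[of g]
    by (auto simp: bij_betw_def f_inv_into_f)
  have inv: "?i (Rep_gal g x) = x" if "x \<in> sep_closure" for x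
    using that Rep_gal_iff(2)[of g] by (auto simp: bij_betw_def)
  have "bij_betw (\<lambda>x\<in>sep_closure. ?i x) sep_closure sep_closure"
    using bij bij_betw_cong[of sep_closure "\<lambda>x\<in>sep_closure. ?i x" ?i] by simp
  moreover have "?i (x + y) = ?i x + ?i y" "?i (x * y) = ?i x * ?i y"
    if "x \<in> sep_closure" "y \<in> sep_closure" for x y
    using inv[of "?i x + ?i y"] inv[of "?i x * ?i y"] im that
    by (simp_all add: Rep_gal_iff sep_closure_add sep_closure_mult)
  moreover have "?i (to_ac a) = to_ac a" for a
    using inv[of "to_ac a"] by (simp add: Rep_gal_iff)
  ultimately have "(\<lambda>x\<in>sep_closure. ?i x) \<in> carrier absolute_galois_group"
    by (simp add: galois_group_iff sep_closure_add sep_closure_mult)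
  then show ?thesis by (simp add: uminus_gal_def Abs_gal_inverse)
qed

instance
proof
  fix a b c :: "'a gal"
  show "a + b + c = a + (b + c)"
    by (rule gal_eqI) (simp add: Rep_gal_add compose_eq)
  show "0 + a = a" "a + 0 = a"
    by (rule gal_eqI, simp add: Rep_gal_add Rep_gal_zero compose_eq)+
  show "- a + a = 0"
    using Rep_gal_iff(2)[of a]
    by (intro gal_eqI) (simp add: Rep_gal_add Rep_gal_uminus Rep_gal_zero compose_eq bij_betw_def)
  show "a + - b = a - b" by (simp add: minus_gal_def)
qed

end

lemma gal_apply [simp]:
  "x \<in> sep_closure \<Longrightarrow> Rep_gal 0 x = x"
  "x \<in> sep_closure \<Longrightarrow> Rep_gal (g + h) x = Rep_gal g (Rep_gal h x)"
  by (simp_all add: Rep_gal_zero Rep_gal_add compose_eq)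

lemma gal_agree_iff:
  assumes "x \<in> sep_closure"
  shows "Rep_gal (- g + h) x = x \<longleftrightarrow> Rep_gal g x = Rep_gal h x"
proof
  assume "Rep_gal (- g + h) x = x"
  moreover have "Rep_gal (g + (- g + h)) x = Rep_gal g (Rep_gal (- g + h) x)"
    using assms by (rule gal_apply(2))
  ultimately show "Rep_gal g x = Rep_gal h x" by (simp del: gal_apply(2))
next
  assume "Rep_gal g x = Rep_gal h x"
  then have "Rep_gal (- g + h) x = Rep_gal (- g) (Rep_gal g x)" using assms by simp
  also have "\<dots> = Rep_gal (- g + g) x" using assms by (rule gal_apply(2)[symmetric])
  finally show "Rep_gal (- g + h) x = x" using assms by (simp del: gal_apply(2))
qed

section \<open>The multiplicative group as a Galois module\<close>

typedef (overloaded) 'a sep_unit = "sep_closure - {0 :: 'a::field alg_closure}"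
  by (rule exI[of _ 1]) simp

lemma Rep_sep_unit_simps [simp]:
  "Rep_sep_unit x \<in> sep_closure" "Rep_sep_unit x \<noteq> 0"
  using Rep_sep_unit[of x] by auto

instantiation sep_unit :: (field) ab_group_add
begin

definition "zero_sep_unit = Abs_sep_unit 1"
definition "plus_sep_unit x y = Abs_sep_unit (Rep_sep_unit x * Rep_sep_unit y)"
definition "uminus_sep_unit x = Abs_sep_unit (inverse (Rep_sep_unit x))"
definition "minus_sep_unit x y = Abs_sep_unit (Rep_sep_unit x * inverse (Rep_sep_unit y))"

lemma Rep_sep_unit_group [simp]:
  "Rep_sep_unit 0 = 1"
  "Rep_sep_unit (x + y) = Rep_sep_unit x * Rep_sep_unit y"
  "Rep_sep_unit (- x) = inverse (Rep_sep_unit x)"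
  "Rep_sep_unit (x - y) = Rep_sep_unit x * inverse (Rep_sep_unit y)"
  by (simp_all add: zero_sep_unit_def plus_sep_unit_def uminus_sep_unit_def minus_sep_unit_def
      Abs_sep_unit_inverse sep_closure_mult sep_closure_inverse)

instance
  by standard (simp_all flip: Rep_sep_unit_inject add: mult_ac)

end

lemma sep_closure_power_int: "x \<in> sep_closure \<Longrightarrow> x powi k \<in> sep_closure"
  by (simp add: power_int_def sep_closure_power sep_closure_inverse)

definition unit_power :: "int \<Rightarrow> 'a::field sep_unit \<Rightarrow> 'a sep_unit" where
  "unit_power k x = Abs_sep_unit (Rep_sep_unit x powi k)"

definition gal_act :: "'a::field gal \<Rightarrow> 'a sep_unit \<Rightarrow> 'a sep_unit" where
  "gal_act g x = Abs_sep_unit (Rep_gal g (Rep_sep_unit x))"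

definition fixer :: "'a::field alg_closure set \<Rightarrow> 'a gal set" where
  "fixer S = {g. \<forall>x\<in>S. Rep_gal g x = x}"

text \<open>With finite sets in place of finite extensions, intersections and conjugates are
  immediate: unions and images of the sets.\<close>

definition open_basis :: "'a::field gal set \<Rightarrow> bool" where
  "open_basis V \<longleftrightarrow> (\<exists>S. finite S \<and> S \<subseteq> sep_closure \<and> V = fixer S)"

lemma Rep_unit_power [simp]: "Rep_sep_unit (unit_power k x) = Rep_sep_unit x powi k"
  by (simp add: unit_power_def Abs_sep_unit_inverse sep_closure_power_int power_int_not_zero)

lemma Rep_gal_act [simp]: "Rep_sep_unit (gal_act g x) = Rep_gal g (Rep_sep_unit x)"
  by (simp add: gal_act_def Abs_sep_unit_inverse)

section \<open>Independence of characters and Hilbert 90\<close>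

lemma finite_conjugates:
  assumes "x \<in> sep_closure"
  shows "finite (range (\<lambda>g. Rep_gal g x))"
proof -
  obtain f where f: "ac_eval f x = 0" "f \<noteq> 0" using ac_eval_min_poly[of x] by blast
  have "map_poly to_ac f \<noteq> 0"
    using f(2) by (metis (no_types, lifting) coeff_map_poly leading_coeff_0_iff to_ac_0 to_ac_eq_0_iff coeff_0)
  then have "finite {z. poly (map_poly to_ac f) z = 0}" by (rule poly_roots_finite)
  moreover have "range (\<lambda>g. Rep_gal g x) \<subseteq> {z. poly (map_poly to_ac f) z = 0}"
    using ac_eval_Rep_gal[OF assms, of f] f(1) by (auto simp: ac_eval_def)
  ultimately show ?thesis by (rule finite_subset[rotated])
qed

text \<open>Artin's argument: comparing the relation at \<open>m a b\<close> with \<open>s a\<close>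
  times the relation at b eliminates s; induction kills every \<open>c r * (r a - s a)\<close>, and
  distinctness supplies a suitable a. The domain L is a parameter because it will be the fixed field
  of a small subgroup.\<close>

lemma dedekind_independence:
  fixes R :: "('b \<Rightarrow> 'c::field) set"
  assumes "finite R" and one: "e \<in> L" "\<And>r. r \<in> R \<Longrightarrow> r e = 1"
    and closed: "\<And>a b. a \<in> L \<Longrightarrow> b \<in> L \<Longrightarrow> m a b \<in> L"
    and mult: "\<And>r a b. r \<in> R \<Longrightarrow> a \<in> L \<Longrightarrow> b \<in> L \<Longrightarrow> r (m a b) = r a * r b"
    and distinct: "\<And>r s. r \<in> R \<Longrightarrow> s \<in> R \<Longrightarrow> (\<And>a. a \<in> L \<Longrightarrow> r a = s a) \<Longrightarrow> r = s"
    and zero: "\<And>a. a \<in> L \<Longrightarrow> (\<Sum>r\<in>R. c r * r a) = 0"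
  shows "\<forall>r\<in>R. c r = 0"
  using assms(1) one(2) mult distinct zero
proof (induction R arbitrary: c rule: finite_induct)
  case (insert s R)
  have "c r * (r a - s a) = 0" if r: "r \<in> R" and a: "a \<in> L" for r a
  proof -
    have "(\<Sum>r\<in>R. (c r * (r a - s a)) * r b) = 0" if b: "b \<in> L" for b
    proof -
      have "(\<Sum>r\<in>insert s R. c r * r (m a b)) = 0"
        using insert.prems(4) closed a b by blast
      then have 1: "c s * (s a * s b) + (\<Sum>r\<in>R. c r * (r a * r b)) = 0"
        using insert.hyps insert.prems(2) a b by simp
      have 2: "s a * (c s * s b + (\<Sum>r\<in>R. c r * r b)) = 0"
        using insert.prems(4)[OF b] insert.hyps by simp
      have "(\<Sum>r\<in>R. (c r * (r a - s a)) * r b)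
          = (\<Sum>r\<in>R. c r * (r a * r b)) - s a * (\<Sum>r\<in>R. c r * r b)"
        by (simp add: sum_subtractf sum_distrib_left algebra_simps)
      also have "\<dots> = (c s * (s a * s b) + (\<Sum>r\<in>R. c r * (r a * r b)))
          - s a * (c s * s b + (\<Sum>r\<in>R. c r * r b))"
        by (simp add: algebra_simps)
      also have "\<dots> = 0" by (simp only: 1 2 diff_self)
      finally show ?thesis .
    qed
    then have "\<forall>r\<in>R. c r * (r a - s a) = 0"
      using insert.IH[of "\<lambda>r. c r * (r a - s a)"] insert.prems by blast
    then show ?thesis using r by blast
  qed
  then have cR: "c r = 0" if "r \<in> R" for r
    using that insert.prems(3)[of r s] insert.hyps(2) by (metis insertCI mult_eq_0_iff right_minus_eq)
  then have "c s * s e = 0" using insert.prems(4)[OF one(1)] insert.hyps by simp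
  then show ?case using cR insert.prems(1)[of s] by simp
qed simp

text \<open>The usual averaging argument, over representatives \<open>R\<close> of the restrictions of \<open>U\<close> to a finite
  set; \<open>U\<close> need not be open, since \<open>Rep_gal g x\<close> depends only on the restriction for \<open>x\<close> fixed by \<open>V\<close>.\<close>

lemma gal_hilbert90:
  fixes u :: "'a::field gal \<Rightarrow> 'a sep_unit"
  assumes U: "add_subgroup U" and V: "open_basis V" and uV: "\<And>v. v \<in> U \<inter> V \<Longrightarrow> u v = 0"
    and cocycle: "\<And>g h. g \<in> U \<Longrightarrow> h \<in> U \<Longrightarrow> u (g + h) = u g + gal_act g (u h)"
  shows "\<exists>y. \<forall>g\<in>U. gal_act g y = y + u g"
proof -
  obtain S where S: "finite S" "S \<subseteq> sep_closure" "V = fixer S"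
    using V by (auto simp: open_basis_def)
  define L where "L = {x \<in> sep_closure. \<forall>v\<in>V. Rep_gal v x = x}"
  have S_L: "S \<subseteq> L" using S by (auto simp: L_def fixer_def)
  define res where "res g = restrict (Rep_gal g) S" for g
  \<comment> \<open>The choice sees g only through \<open>res g\<close>, so equal restrictions share
    one representative.\<close>
  define rep where "rep g = (SOME h. h \<in> U \<and> res h = res g)" for g
  have rep: "rep g \<in> U" "res (rep g) = res g" if "g \<in> U" for g
    using someI[of "\<lambda>h. h \<in> U \<and> res h = res g" g] that by (auto simp: rep_def)
  have rep_eq: "rep g = rep h" if "res g = res h" for g h
    using that by (simp add: rep_def)
  have same_res: "- g + h \<in> V" if "res g = res h" for g h
    unfolding S(3) fixer_def
  proof (safe)
    fix x assume x: "x \<in> S"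
    then have "Rep_gal g x = Rep_gal h x" using that by (metis res_def restrict_apply')
    then show "Rep_gal (- g + h) x = x" using x S(2) gal_agree_iff by blast
  qed
  have res_L: "Rep_gal g x = Rep_gal h x" if "res g = res h" "x \<in> L" for g h x
  proof -
    have "Rep_gal (- g + h) x = x" using same_res[OF that(1)] that(2) by (auto simp: L_def)
    moreover have "x \<in> sep_closure" using that(2) by (simp add: L_def)
    ultimately show ?thesis using gal_agree_iff by blast
  qed
  define R where "R = rep ` U"
  have R_U: "R \<subseteq> U" using rep by (auto simp: R_def)
  have R_res: "r = s" if "r \<in> R" "s \<in> R" "res r = res s" for r s
    using that rep rep_eq unfolding R_def by (metis imageE)
  have "finite (res ` U)"
  proof (rule finite_subset)
    show "res ` U \<subseteq> (\<Pi>\<^sub>E x\<in>S. range (\<lambda>g. Rep_gal g x))" by (auto simp: res_def)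
    show "finite (\<Pi>\<^sub>E x\<in>S. range (\<lambda>g. Rep_gal g x))"
      using S by (intro finite_PiE finite_conjugates) auto
  qed
  moreover have "inj_on res R" using R_res by (auto intro: inj_onI)
  ultimately have fin: "finite R"
    using R_U by (metis finite_imageD finite_subset image_mono)
  have u_res: "u g = u h" if "g \<in> U" "h \<in> U" "res g = res h" for g h
  proof -
    have "- g + h \<in> U \<inter> V" using that U same_res by (auto simp: add_subgroup_def)
    moreover have "u (g + (- g + h)) = u g + gal_act g (u (- g + h))"
      using calculation that(1) by (intro cocycle) auto
    ultimately show ?thesis using uV by (simp flip: Rep_sep_unit_inject)
  qed
  \<comment> \<open>If all averages vanished, independence of the distinct restrictions would make
    the values of u zero, but they are units.\<close>
  have "\<exists>x\<in>L. (\<Sum>r\<in>R. Rep_sep_unit (u r) * Rep_gal r x) \<noteq> 0"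
  proof (rule ccontr)
    assume "\<not> ?thesis"
    then have zero: "(\<Sum>r\<in>R. Rep_sep_unit (u r) * Rep_gal r x) = 0" if "x \<in> L" for x
      using that by blast
    define c where "c f = Rep_sep_unit (u (Abs_gal f))" for f
    have "\<forall>f\<in>Rep_gal ` R. c f = 0"
    proof (rule dedekind_independence[where e = 1 and m = "(*)" and L = L])
      show "finite (Rep_gal ` R)" using fin by simp
      show "1 \<in> L" by (simp add: L_def)
      show "a * b \<in> L" if "a \<in> L" "b \<in> L" for a b
        using that by (simp add: L_def sep_closure_mult Rep_gal_iff)
      show "r (a * b) = r a * r b" if "r \<in> Rep_gal ` R" "a \<in> L" "b \<in> L" for r a b
        using that by (auto simp: L_def Rep_gal_iff)
      show "r = s" if rs: "r \<in> Rep_gal ` R" "s \<in> Rep_gal ` R" "\<And>a. a \<in> L \<Longrightarrow> r a = s a" for r s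
      proof -
        obtain g h where gh: "r = Rep_gal g" "s = Rep_gal h" "g \<in> R" "h \<in> R" using rs by blast
        then have "res g = res h"
          unfolding res_def using rs(3) S_L by (intro restrict_ext) auto
        then show ?thesis using gh R_res by blast
      qed
      show "(\<Sum>r\<in>Rep_gal ` R. c r * r a) = 0" if "a \<in> L" for a
        using zero[OF that]
        by (subst sum.reindex) (auto simp: inj_on_def Rep_gal_inject c_def Rep_gal_inverse)
    qed auto
    moreover have "rep 0 \<in> R" using U by (auto simp: R_def add_subgroup_def)
    ultimately show False by (auto simp: c_def)
  qed
  then obtain x where x: "x \<in> L" "(\<Sum>r\<in>R. Rep_sep_unit (u r) * Rep_gal r x) \<noteq> 0" by blast
  define y where "y = (\<Sum>r\<in>R. Rep_sep_unit (u r) * Rep_gal r x)"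
  have xK: "x \<in> sep_closure" using x by (simp add: L_def)
  then have yK: "y \<in> sep_closure" unfolding y_def by (intro sep_closure_sum sep_closure_mult) auto
  have y: "Rep_sep_unit (u h) * Rep_gal h y = y" if h: "h \<in> U" for h
  proof -
    \<comment> \<open>Left translation by h permutes the restrictions of U, hence their
      representatives.\<close>
    let ?f = "\<lambda>r. rep (h + r)"
    have hr: "h + r \<in> U" if "r \<in> R" for r using that h U R_U by (auto simp: add_subgroup_def)
    have "Rep_sep_unit (u h) * Rep_gal h y
        = (\<Sum>r\<in>R. Rep_sep_unit (u (h + r)) * Rep_gal (h + r) x)"
    proof -
      have "Rep_sep_unit (u (h + r)) = Rep_sep_unit (u h) * Rep_gal h (Rep_sep_unit (u r))" if "r \<in> R" for r
        using cocycle[OF h, of r] that R_U by auto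
      then show ?thesis
        unfolding y_def using xK
        by (subst Rep_gal_sum)
          (auto simp: sep_closure_mult Rep_gal_iff sum_distrib_left mult.assoc intro!: sum.cong)
    qed
    also have "\<dots> = (\<Sum>r\<in>R. Rep_sep_unit (u (?f r)) * Rep_gal (?f r) x)"
    proof (rule sum.cong[OF refl])
      fix r assume "r \<in> R"
      then have "rep (h + r) \<in> U" "res (rep (h + r)) = res (h + r)" using hr rep by blast+
      then show "Rep_sep_unit (u (h + r)) * Rep_gal (h + r) x
          = Rep_sep_unit (u (?f r)) * Rep_gal (?f r) x"
        using u_res[of "h + r" "?f r"] res_L[of "h + r" "?f r" x] hr \<open>r \<in> R\<close> x(1) by metis
    qed
    also have "\<dots> = y"
    proof -
      have inj: "inj_on ?f R"
      proof (rule inj_onI)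
        fix r s assume rs: "r \<in> R" "s \<in> R" "?f r = ?f s"
        then have "res (h + r) = res (h + s)" using rep hr by metis
        then have "- (h + r) + (h + s) \<in> V" by (rule same_res)
        then have v: "- r + s \<in> V" by (simp add: minus_add add.assoc del: add_uminus_conv_diff)
        have "res r = res s"
          unfolding res_def
        proof (rule restrict_ext)
          fix x assume "x \<in> S"
          then have "Rep_gal (- r + s) x = x" "x \<in> sep_closure"
            using v S(2) unfolding S(3) fixer_def by blast+
          then show "Rep_gal r x = Rep_gal s x" using gal_agree_iff by blast
        qed
        then show "r = s" using rs R_res by blast
      qed
      have "?f ` R \<subseteq> R" using hr by (auto simp: R_def)
      then have "?f ` R = R" using endo_inj_surj[OF fin _ inj] by blast
      then show ?thesis unfolding y_def using sum.reindex[OF inj, of "\<lambda>r. Rep_sep_unit (u r) * Rep_gal r x"]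
        by (simp add: comp_def)
    qed
    finally show ?thesis .
  qed
  \<comment> \<open>The average satisfies the equation with u on the wrong side, so its inverse is
    the solution.\<close>
  define z where "z = Abs_sep_unit (inverse y)"
  have z: "Rep_sep_unit z = inverse y"
    using yK x(2) by (simp add: z_def Abs_sep_unit_inverse sep_closure_inverse y_def)
  have "gal_act g z = z + u g" if "g \<in> U" for g
    using y[OF that] x(2) yK
    by (simp add: z Rep_gal_field_inverse flip: Rep_sep_unit_inject y_def) (simp add: field_simps)
  then show ?thesis by blast
qed

text \<open>In characteristic p, z^p - 1 = (z - 1)^p, so 1 would be the only p-th root of
  unity.\<close>

lemma of_nat_neq_0_of_primitive_root:
  fixes z :: "'a::field"
  assumes p: "Factorial_Ring.prime p" and z: "primitive_root_of_unity p z"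
  shows "of_nat p \<noteq> (0 :: 'a)"
proof
  assume "of_nat p = (0 :: 'a)"
  then have dvd: "CHAR('a) dvd p" by (simp add: of_nat_eq_0_iff_char_dvd)
  then have c: "CHAR('a) = p" using p CHAR_not_1[where ?'a = 'a] by (metis One_nat_def prime_nat_iff)
  then have "(z - 1 + 1) ^ p = (z - 1) ^ p + 1 ^ p"
    using p by (intro freshmans_dream) simp_all
  then have "(z - 1) ^ p = 0" using z by (simp add: primitive_root_of_unity_def)
  then have "z ^ 1 = 1" by simp
  then show False using z prime_gt_1_nat[OF p] unfolding primitive_root_of_unity_def by blast
qed

lemma galois_kummer_formation:
  fixes z :: "'a::field"
  assumes p: "Factorial_Ring.prime p" and z: "primitive_root_of_unity p z"
  shows "kummer_formation unit_power gal_act p (Abs_sep_unit (to_ac z)) open_basis"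
proof
  have z_pow: "z ^ p = 1" "\<And>k. 0 < k \<Longrightarrow> k < p \<Longrightarrow> z ^ k \<noteq> 1"
    using z by (auto simp: primitive_root_of_unity_def)
  have p_pos: "p > 0" using p by (rule prime_gt_0_nat)
  have z0: "z \<noteq> 0" using z_pow p_pos by (auto simp: power_0_left)
  let ?w = "to_ac z"
  have w0: "?w \<noteq> 0" using z0 by simp
  have w_pow: "?w ^ p = 1" "\<And>k. 0 < k \<Longrightarrow> k < p \<Longrightarrow> ?w ^ k \<noteq> 1"
    using z_pow by (simp_all flip: to_ac_power)
  have Rep_w [simp]: "Rep_sep_unit (Abs_sep_unit ?w) = ?w"
    using z0 by (simp add: Abs_sep_unit_inverse)
  note inj = Rep_sep_unit_inject [symmetric]
  show "unit_power a (x + y) = unit_power a x + unit_power a y" for a and x y :: "'a sep_unit"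
    by (simp add: inj power_int_mult_distrib)
  show "unit_power (a + b) x = unit_power a x + unit_power b x" for a b and x :: "'a sep_unit"
    by (simp add: inj power_int_add)
  show "unit_power a (unit_power b x) = unit_power (a * b) x" for a b and x :: "'a sep_unit"
    by (simp add: inj power_int_mult mult.commute flip: power_int_mult)
  show "unit_power 1 x = x" for x :: "'a sep_unit" by (simp add: inj)
  show "Factorial_Ring.prime p" by (rule p)
  show "gal_act 0 x = x" for x :: "'a sep_unit" by (simp add: inj)
  show "gal_act (g + h) x = gal_act g (gal_act h x)" for g h and x :: "'a sep_unit" by (simp add: inj)
  show "gal_act g (x + y) = gal_act g x + gal_act g y" for g and x y :: "'a sep_unit"
    by (simp add: inj Rep_gal_iff)
  show "gal_act g (Abs_sep_unit ?w) = Abs_sep_unit ?w" for g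
    by (simp add: inj Rep_gal_iff)
  show "unit_power (int p) (Abs_sep_unit ?w) = 0" by (simp add: inj w_pow)
  show "int p dvd k" if "unit_power k (Abs_sep_unit ?w) = 0" for k
  proof -
    have "?w powi k = 1" using that by (simp add: inj)
    moreover have "?w powi (int p * (k div int p) + k mod int p)
        = (?w ^ p) powi (k div int p) * ?w powi (k mod int p)"
      using w0 by (subst power_int_add) (auto simp: power_int_mult)
    ultimately have "?w powi int (nat (k mod int p)) = 1" using p_pos w_pow(1) by simp
    then have "?w ^ nat (k mod int p) = 1" by (simp only: power_int_of_nat)
    moreover have "nat (k mod int p) < p" using p_pos by (simp add: nat_less_iff)
    ultimately have "nat (k mod int p) = 0" using w_pow(2) by blast
    then have "k mod int p \<le> 0" by simp
    moreover have "0 \<le> k mod int p" using p_pos by simp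
    ultimately show ?thesis by (metis order_antisym dvd_eq_mod_eq_0)
  qed
  show "\<exists>k. x = unit_power k (Abs_sep_unit ?w)" if "unit_power (int p) x = 0" for x
  proof -
    \<comment> \<open>X^p - 1 has at most p roots, and the powers of \<open>?w\<close> already
      supply p of them.\<close>
    let ?f = "Polynomial.monom 1 p - 1 :: 'a alg_closure poly"
    have root: "poly ?f y = 0 \<longleftrightarrow> y ^ p = 1" for y by (simp add: poly_monom)
    have f0: "?f \<noteq> 0" using root[of 0] p_pos by (metis poly_0 power_0_left zero_neq_one neq0_conv)
    have deg: "Polynomial.degree ?f \<le> p"
      using degree_diff_le_max[of "Polynomial.monom 1 p" "1 :: 'a alg_closure poly"] p_pos
      by (simp add: degree_monom_eq)
    have inj_w: "inj_on (\<lambda>k. ?w ^ k) {..<p}"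
    proof (rule linorder_inj_onI)
      fix i j assume ij: "i < j" "i \<in> {..<p}" "j \<in> {..<p}"
      have "?w ^ j = ?w ^ i * ?w ^ (j - i)" using ij by (simp flip: power_add)
      then show "?w ^ i \<noteq> ?w ^ j" using w_pow(2)[of "j - i"] ij w0 by auto
    qed auto
    have "(\<lambda>k. ?w ^ k) ` {..<p} = {y. poly ?f y = 0}"
    proof (rule card_seteq)
      show "finite {y. poly ?f y = 0}" using f0 by (rule poly_roots_finite)
      have "(?w ^ k) ^ p = 1" for k
        by (metis mult.commute power_mult power_one w_pow(1))
      then show "(\<lambda>k. ?w ^ k) ` {..<p} \<subseteq> {y. poly ?f y = 0}"
        using root by blast
      show "card {y. poly ?f y = 0} \<le> card ((\<lambda>k. ?w ^ k) ` {..<p})"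
        using card_poly_roots_bound[OF f0] deg by (simp add: card_image[OF inj_w])
    qed
    moreover have "Rep_sep_unit x ^ p = 1" using that by (simp add: inj)
    ultimately obtain k where "Rep_sep_unit x = ?w ^ k" using root by blast
    then show ?thesis by (intro exI[of _ "int k"]) (simp add: inj)
  qed
  show "\<exists>y. unit_power (int p) y = x" for x :: "'a sep_unit"
  proof -
    obtain y where y: "y ^ p = Rep_sep_unit x" using nth_root_exists[OF p_pos] by blast
    then have "y \<noteq> 0" using p_pos by (metis Rep_sep_unit_simps(2) power_0_left neq0_conv)
    then have "y \<in> sep_closure"
      using y sep_closure_root[of y p] of_nat_neq_0_of_primitive_root[OF p z] by simp
    then show ?thesis using y \<open>y \<noteq> 0\<close>
      by (intro exI[of _ "Abs_sep_unit y"]) (simp add: inj Abs_sep_unit_inverse)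
  qed
  show "open_basis (V \<inter> W)" if VW: "open_basis V" "open_basis W" for V W :: "'a gal set"
  proof -
    obtain S S' where "finite S" "S \<subseteq> sep_closure" "V = fixer S"
      "finite S'" "S' \<subseteq> sep_closure" "W = fixer S'"
      using VW by (auto simp: open_basis_def)
    then show ?thesis
      unfolding open_basis_def by (intro exI[of _ "S \<union> S'"]) (auto simp: fixer_def)
  qed
  show "open_basis {g. - h + g + h \<in> V}" if V: "open_basis V" for V and h :: "'a gal"
  proof -
    obtain S where S: "finite S" "S \<subseteq> sep_closure" "V = fixer S"
      using V by (auto simp: open_basis_def)
    have "Rep_gal (- h + g + h) x = x \<longleftrightarrow> Rep_gal g (Rep_gal h x) = Rep_gal h x" if "x \<in> S" for g x
      using gal_agree_iff[of x h "g + h"] that S(2) by (auto simp: add.assoc)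
    then have "{g. - h + g + h \<in> V} = fixer (Rep_gal h ` S)"
      unfolding S(3) fixer_def by blast
    then show ?thesis
      using S unfolding open_basis_def by (intro exI[of _ "Rep_gal h ` S"]) auto
  qed
  show "\<exists>V. open_basis V \<and> (\<forall>v\<in>V. gal_act v x = x)" for x :: "'a sep_unit"
  proof (intro exI conjI)
    show "open_basis (fixer {Rep_sep_unit x})"
      unfolding open_basis_def by (intro exI[of _ "{Rep_sep_unit x}"]) simp
    show "\<forall>v\<in>fixer {Rep_sep_unit x}. gal_act v x = x" by (simp add: fixer_def inj)
  qed
  show "\<exists>y. \<forall>g\<in>U. gal_act g y = y + u g"
    if "add_subgroup U" "open_basis V" "\<And>v. v \<in> U \<inter> V \<Longrightarrow> u v = 0"
      "\<And>g h. g \<in> U \<Longrightarrow> h \<in> U \<Longrightarrow> u (g + h) = u g + gal_act g (u h)" for U V and u :: "'a gal \<Rightarrow> 'a sep_unit"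
    by (rule gal_hilbert90[OF that])
qed

section \<open>The Krull topology\<close>

interpretation acr: domain "ring_of_type_algebra :: 'a::field alg_closure ring"
  by (rule field.axioms(1)[OF field_from_type_algebra])

lemma ac_ring_simps [simp]:
  "carrier (ring_of_type_algebra :: 'a::field alg_closure ring) = UNIV"
  "x \<otimes>\<^bsub>ring_of_type_algebra\<^esub> y = x * (y :: 'a alg_closure)"
  "x \<oplus>\<^bsub>ring_of_type_algebra\<^esub> y = x + (y :: 'a alg_closure)"
  "\<one>\<^bsub>ring_of_type_algebra\<^esub> = (1 :: 'a alg_closure)"
  "\<zero>\<^bsub>ring_of_type_algebra\<^esub> = (0 :: 'a alg_closure)"
  by (simp_all add: ring_of_type_algebra_def)

lemma ac_ring_uminus [simp]: "\<ominus>\<^bsub>ring_of_type_algebra\<^esub> x = - (x :: 'a::field alg_closure)"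
  by (rule acr.minus_equality) simp_all

lemma ac_ring_power [simp]: "x [^]\<^bsub>ring_of_type_algebra\<^esub> (n::nat) = (x :: 'a::field alg_closure) ^ n"
  by (induction n) (simp_all add: mult.commute)

lemma subfield_range_to_ac: "subfield (range (to_ac :: 'a::field \<Rightarrow> _)) ring_of_type_algebra"
proof -
  interpret F: field "ring_of_type_algebra :: 'a ring" by (rule field_from_type_algebra)
  have "to_ac \<in> ring_hom (ring_of_type_algebra :: 'a ring) ring_of_type_algebra"
    by (simp add: ring_hom_def ring_of_type_algebra_def)
  then interpret h: ring_hom_ring "ring_of_type_algebra :: 'a ring" "ring_of_type_algebra" to_ac
    by (intro ring_hom_ringI2) (simp_all add: F.ring_axioms acr.ring_axioms)
  show ?thesis
    using h.img_is_subfield(2)[OF F.carrier_is_subfield]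
    by (simp add: ring_of_type_algebra_def)
qed

lemma subring_sep_closure: "subring (sep_closure :: 'a::field alg_closure set) ring_of_type_algebra"
  by (rule acr.subringI) (simp_all add: sep_closure_add sep_closure_mult sep_closure_minus)

lemma ac_algebraic: "(acr.algebraic over range to_ac) (x :: 'a::field alg_closure)"
proof -
  obtain f :: "'a poly" where f: "f \<noteq> 0" "ac_eval f x = 0" using ac_eval_min_poly[of x] by blast
  have eval: "acr.eval (map to_ac ds) x = ac_eval (Poly (rev ds)) x" for ds
    by (induction ds) (simp_all add: Poly_append del: mult_pCons_right)
  \<comment> \<open>Polynomials over a ring record are lists with the leading coefficient first,
    hence the reversal.\<close>
  let ?p = "map to_ac (rev (coeffs f))"
  have "?p \<in> carrier (univ_poly ring_of_type_algebra (range to_ac))"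
    using f(1) by (auto simp: univ_poly_def polynomial_def hd_map hd_rev last_coeffs_eq_coeff_degree)
  moreover have "?p \<noteq> []" using f(1) by simp
  moreover have "acr.eval ?p x = \<zero>\<^bsub>ring_of_type_algebra\<^esub>" using f(2) by (simp add: eval)
  ultimately show ?thesis by (rule acr.algebraicI)
qed

lemma finite_separable_subextension_containing:
  fixes S :: "'a::field alg_closure set"
  assumes "finite S" "S \<subseteq> sep_closure"
  obtains L where "finite_separable_subextension L" "S \<subseteq> L"
proof -
  obtain xs where xs: "set xs = S" using finite_list[OF assms(1)] by blast
  let ?L = "acr.finite_extension (range to_ac) xs"
  note K = subfield_range_to_ac[where ?'a = 'a]
  note Kr = subfieldE(1)[OF K]
  have sub: "set xs \<subseteq> carrier ring_of_type_algebra" by simp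
  have "finite_separable_subextension ?L"
    unfolding finite_separable_subextension_def
  proof (intro conjI)
    show "subfield ?L ring_of_type_algebra"
      by (rule acr.finite_extension_is_subfield[OF K sub ac_algebraic])
    show "acr.finite_dimension (range to_ac) ?L"
      by (rule acr.finite_extension_finite_dimension(1)[OF K sub ac_algebraic])
    show "range to_ac \<subseteq> ?L" by (rule acr.finite_extension_incl[OF _ sub]) simp
    show "?L \<subseteq> sep_closure"
      using assms(2) xs by (intro acr.finite_extension_subring_incl[OF subring_sep_closure]) auto
  qed
  moreover have "S \<subseteq> ?L" using acr.finite_extension_mem[OF Kr sub] xs by simp
  ultimately show ?thesis by (rule that)
qed

text \<open>Automorphisms are linear over the base field, so a finite basis of L decides agreement
  on L. Together with finite sets generating finite extensions, this matches
  \<open>open_basis\<close> with the Krull topology.\<close>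

lemma galois_agree_on_subextension:
  fixes L :: "'a::field alg_closure set"
  assumes "finite_separable_subextension L"
  obtains S where "finite S" "S \<subseteq> sep_closure"
    "\<And>g h. \<forall>x\<in>S. Rep_gal g x = Rep_gal h x \<Longrightarrow> \<forall>x\<in>L. Rep_gal g x = Rep_gal h x"
proof -
  note K = subfield_range_to_ac[where ?'a = 'a]
  obtain n where "acr.dimension n (range to_ac) L"
    using assms by (auto simp: finite_separable_subextension_def acr.finite_dimension_def)
  from acr.exists_base[OF K this] obtain Us where Us: "acr.Span (range to_ac) Us = L" by blast
  have L: "L \<subseteq> sep_closure" using assms by (simp add: finite_separable_subextension_def)
  have "set Us \<subseteq> L" using acr.Span_base_incl[OF K, of Us] Us by simp
  then have Us_sep: "set Us \<subseteq> sep_closure" using L by blast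
  have "\<forall>x\<in>acr.Span (range to_ac) Us. x \<in> sep_closure \<and> Rep_gal g x = Rep_gal h x"
    if "\<forall>x\<in>set Us. Rep_gal g x = Rep_gal h x" for g h
    using that Us_sep
  proof (induction Us)
    case (Cons u Us)
    show ?case
    proof
      fix x assume "x \<in> acr.Span (range to_ac) (u # Us)"
      then obtain a v where x: "x = to_ac a * u + v" "v \<in> acr.Span (range to_ac) Us"
        by (auto simp: acr.line_extension_mem_iff)
      then have v: "v \<in> sep_closure" "Rep_gal g v = Rep_gal h v" using Cons by auto
      then show "x \<in> sep_closure \<and> Rep_gal g x = Rep_gal h x"
        using Cons.prems x(1) by (simp add: Rep_gal_iff sep_closure_add sep_closure_mult)
    qed
  qed simp
  then show ?thesis using that[of "set Us"] Us Us_sep by blast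
qed

lemma galois_coset:
  assumes "finite_separable_subextension L"
  shows "Rep_gal g <#\<^bsub>absolute_galois_group\<^esub> galois_subgroup L
    = Rep_gal ` {h. \<forall>x\<in>L. Rep_gal h x = Rep_gal g x}"
proof -
  have L: "L \<subseteq> sep_closure" using assms by (simp add: finite_separable_subextension_def)
  have "galois_subgroup L = Rep_gal ` fixer L"
    unfolding galois_subgroup_def fixer_def using Rep_gal by (auto elim!: Rep_gal_cases)
  then have "Rep_gal g <#\<^bsub>absolute_galois_group\<^esub> galois_subgroup L = (\<lambda>h. Rep_gal (g + h)) ` fixer L"
    by (auto simp: l_coset_def absolute_galois_group_def Rep_gal_add)
  also have "\<dots> = Rep_gal ` {h. \<forall>x\<in>L. Rep_gal h x = Rep_gal g x}"
  proof (intro equalityI subsetI)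
    fix \<sigma> assume "\<sigma> \<in> (\<lambda>h. Rep_gal (g + h)) ` fixer L"
    then obtain h where "h \<in> fixer L" "\<sigma> = Rep_gal (g + h)" by blast
    then show "\<sigma> \<in> Rep_gal ` {h. \<forall>x\<in>L. Rep_gal h x = Rep_gal g x}"
      using L by (intro image_eqI[of _ _ "g + h"]) (auto simp: fixer_def subset_iff)
  next
    fix \<sigma> assume "\<sigma> \<in> Rep_gal ` {h. \<forall>x\<in>L. Rep_gal h x = Rep_gal g x}"
    then obtain h where h: "\<forall>x\<in>L. Rep_gal h x = Rep_gal g x" "\<sigma> = Rep_gal h" by blast
    have "Rep_gal (- g + h) x = x" if "x \<in> L" for x
      by (subst gal_agree_iff) (use that h(1) L in auto)
    then have "- g + h \<in> fixer L" unfolding fixer_def by blast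
    moreover have "\<sigma> = Rep_gal (g + (- g + h))" using h by simp
    ultimately show "\<sigma> \<in> (\<lambda>h. Rep_gal (g + h)) ` fixer L" by blast
  qed
  finally show ?thesis .
qed

section \<open>Neighbourhoods in the Krull topology\<close>

lemma topspace_krull [simp]:
  "topspace (krull_topology :: ('a::field alg_closure \<Rightarrow> 'a alg_closure) topology)
    = carrier absolute_galois_group" (is "_ = ?G")
proof -
  obtain L :: "'a alg_closure set" where L: "finite_separable_subextension L"
    using finite_separable_subextension_containing[of "{}"] by blast
  have "\<Union> {\<sigma> <#\<^bsub>absolute_galois_group\<^esub> galois_subgroup L | \<sigma> L.
      \<sigma> \<in> ?G \<and> finite_separable_subextension L} = ?G" (is "\<Union> ?B = _")
  proof (intro equalityI subsetI)
    fix \<sigma> assume "\<sigma> \<in> \<Union> ?B"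
    then show "\<sigma> \<in> ?G" using Rep_gal by (auto simp: galois_coset elim!: Rep_gal_cases)
  next
    fix \<sigma> assume \<sigma>: "\<sigma> \<in> ?G"
    then obtain g where "\<sigma> = Rep_gal g" by (metis Rep_gal_cases)
    then have "\<sigma> \<in> \<sigma> <#\<^bsub>absolute_galois_group\<^esub> galois_subgroup L" using galois_coset[OF L] by auto
    then show "\<sigma> \<in> \<Union> ?B" using \<sigma> L by blast
  qed
  then show ?thesis by (simp add: krull_topology_def)
qed

lemma openin_krull_imp:
  fixes W :: "('a::field alg_closure \<Rightarrow> 'a alg_closure) set"
  assumes "openin krull_topology W" "Rep_gal g \<in> W"
  shows "\<exists>S. finite S \<and> S \<subseteq> sep_closure \<and> (\<forall>h. (\<forall>x\<in>S. Rep_gal h x = Rep_gal g x) \<longrightarrow> Rep_gal h \<in> W)"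
proof -
  let ?P = "\<lambda>W. \<exists>S. finite S \<and> S \<subseteq> sep_closure \<and> (\<forall>h. (\<forall>x\<in>S. Rep_gal h x = Rep_gal g x) \<longrightarrow> Rep_gal h \<in> W)"
  \<comment> \<open>Membership of g goes into the induction statement, since g need not lie in every
    member of a union.\<close>
  have "Rep_gal g \<in> W \<longrightarrow> ?P W"
    using assms(1) unfolding krull_topology_def openin_topology_generated_by_iff
  proof (induction rule: generate_topology_on.induct)
    case (Int a b)
    show ?case
    proof
      assume "Rep_gal g \<in> a \<inter> b"
      then obtain S S' where "finite S" "S \<subseteq> sep_closure" "finite S'" "S' \<subseteq> sep_closure"
        "\<And>h. \<forall>x\<in>S. Rep_gal h x = Rep_gal g x \<Longrightarrow> Rep_gal h \<in> a"
        "\<And>h. \<forall>x\<in>S'. Rep_gal h x = Rep_gal g x \<Longrightarrow> Rep_gal h \<in> b"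
        using Int.IH by blast
      then show "?P (a \<inter> b)" by (intro exI[of _ "S \<union> S'"]) auto
    qed
  next
    case (UN K)
    show ?case
    proof
      assume "Rep_gal g \<in> \<Union> K"
      then obtain k where k: "k \<in> K" "Rep_gal g \<in> k" by blast
      with UN.IH[OF k(1)] obtain S where "finite S \<and> S \<subseteq> sep_closure \<and>
          (\<forall>h. (\<forall>x\<in>S. Rep_gal h x = Rep_gal g x) \<longrightarrow> Rep_gal h \<in> k)" by blast
      then show "?P (\<Union> K)" using k(1) by (intro exI[of _ S]) blast
    qed
  next
    case (Basis s)
    then obtain \<sigma> L where s: "s = \<sigma> <#\<^bsub>absolute_galois_group\<^esub> galois_subgroup L"
      "\<sigma> \<in> carrier absolute_galois_group" "finite_separable_subextension L" by blast
    obtain k where k: "\<sigma> = Rep_gal k" using s(2) by (metis Rep_gal_cases)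
    note s_eq = s(1)[unfolded k galois_coset[OF s(3)]]
    obtain S where S: "finite S" "S \<subseteq> sep_closure"
      "\<And>g h. \<forall>x\<in>S. Rep_gal g x = Rep_gal h x \<Longrightarrow> \<forall>x\<in>L. Rep_gal g x = Rep_gal h x"
      using galois_agree_on_subextension[OF s(3)] by blast
    show ?case
    proof
      assume "Rep_gal g \<in> s"
      then have "\<forall>x\<in>L. Rep_gal g x = Rep_gal k x" by (auto simp: s_eq Rep_gal_inject)
      then have "Rep_gal h \<in> s" if "\<forall>x\<in>S. Rep_gal h x = Rep_gal g x" for h
        using S(3)[OF that] by (auto simp: s_eq)
      then show "?P s" using S by blast
    qed
  qed simp
  then show ?thesis using assms(2) by blast
qed

lemma openin_krullI:
  fixes W :: "('a::field alg_closure \<Rightarrow> 'a alg_closure) set"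
  assumes W: "W \<subseteq> carrier absolute_galois_group"
    and nbhd: "\<And>g. Rep_gal g \<in> W \<Longrightarrow>
      \<exists>S. finite S \<and> S \<subseteq> sep_closure \<and> (\<forall>h. (\<forall>x\<in>S. Rep_gal h x = Rep_gal g x) \<longrightarrow> Rep_gal h \<in> W)"
  shows "openin krull_topology W"
proof (subst openin_subopen, intro ballI)
  fix \<sigma> assume \<sigma>: "\<sigma> \<in> W"
  then obtain g where g: "\<sigma> = Rep_gal g" using W by (metis Rep_gal_cases subsetD)
  obtain S where "finite S \<and> S \<subseteq> sep_closure \<and>
      (\<forall>h. (\<forall>x\<in>S. Rep_gal h x = Rep_gal g x) \<longrightarrow> Rep_gal h \<in> W)"
    using nbhd[OF \<sigma>[unfolded g]] ..
  then have S: "finite S" "S \<subseteq> sep_closure"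
    "\<And>h. \<forall>x\<in>S. Rep_gal h x = Rep_gal g x \<Longrightarrow> Rep_gal h \<in> W"
    by simp_all
  obtain L where L: "finite_separable_subextension L" "S \<subseteq> L"
    using finite_separable_subextension_containing[OF S(1,2)] by blast
  let ?T = "Rep_gal g <#\<^bsub>absolute_galois_group\<^esub> galois_subgroup L"
  have "openin krull_topology ?T"
    unfolding krull_topology_def by (rule topology_generated_by_Basis) (use L Rep_gal in blast)
  moreover have "\<sigma> \<in> ?T" "?T \<subseteq> W" using S(3) L(2) by (auto simp: galois_coset[OF L(1)] g)
  ultimately show "\<exists>T. openin krull_topology T \<and> \<sigma> \<in> T \<and> T \<subseteq> W" by blast
qed

section \<open>Massey products of the absolute Galois group\<close>

text \<open>The target is discrete, so continuity means that the fibres are open.\<close>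

lemma cochain_iff:
  "f \<in> carrier (cochain_group p U) \<longleftrightarrow> f \<in> extensional (topspace U) \<and>
    (\<forall>x\<in>topspace U. 0 \<le> f x \<and> f x < int p) \<and>
    (\<forall>x\<in>topspace U. openin U {y \<in> topspace U. f y = f x})"
proof -
  have "openin U {y \<in> topspace U. f y \<in> V}"
    if "\<forall>x\<in>topspace U. openin U {y \<in> topspace U. f y = f x}" for V
  proof (subst openin_subopen, intro ballI)
    fix x assume "x \<in> {y \<in> topspace U. f y \<in> V}"
    then show "\<exists>T. openin U T \<and> x \<in> T \<and> T \<subseteq> {y \<in> topspace U. f y \<in> V}"
      using that by (intro exI[of _ "{y \<in> topspace U. f y = f x}"]) auto
  qed
  moreover have "openin U {y \<in> topspace U. f y = f x}"
    if "\<forall>V\<subseteq>{0..int p - 1}. openin U {y \<in> topspace U. f y \<in> V}"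
      "0 \<le> f x \<and> f x < int p" for x
    using that(1)[rule_format, of "{f x}"] that(2) by simp
  ultimately show ?thesis
    by (auto simp: cochain_group_def continuous_map_def residue_ring_def Pi_iff)
qed

lemma cochain_compose2:
  assumes "f \<in> carrier (cochain_group p U)" "g \<in> carrier (cochain_group p U)" "p > 0"
  shows "(\<lambda>x\<in>topspace U. F (f x) (g x) mod int p) \<in> carrier (cochain_group p U)"
proof -
  let ?h = "\<lambda>x\<in>topspace U. F (f x) (g x) mod int p"
  have "openin U {y \<in> topspace U. ?h y = ?h x}" if x: "x \<in> topspace U" for x
  proof (subst openin_subopen, intro ballI)
    fix z assume z: "z \<in> {y \<in> topspace U. ?h y = ?h x}"
    let ?T = "{y \<in> topspace U. f y = f z} \<inter> {y \<in> topspace U. g y = g z}"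
    have "openin U ?T" using assms z by (intro openin_Int) (simp_all add: cochain_iff)
    then show "\<exists>T. openin U T \<and> z \<in> T \<and> T \<subseteq> {y \<in> topspace U. ?h y = ?h x}"
      using z by (intro exI[of _ ?T]) auto
  qed
  then show ?thesis using assms(3) by (simp add: cochain_iff)
qed

lemma cochain_mult:
  "f \<otimes>\<^bsub>cochain_group p U\<^esub> g = (\<lambda>x\<in>topspace U. (f x + g x) mod int p)"
  by (simp add: cochain_group_def residue_ring_def)

lemma H2_one: "\<one>\<^bsub>H2 p G T\<^esub> = coboundaries2 p G T"
  by (simp add: H2_def FactGroup_def)

lemma cohomology_class2_altdef:
  "cohomology_class2 p G T \<psi> = (\<lambda>h. h \<otimes>\<^bsub>C2 p T\<^esub> \<psi>) ` coboundaries2 p G T"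
  by (auto simp: cohomology_class2_def r_coset_def cocycles2_def)

section \<open>Trivial classes in second cohomology\<close>

context
  fixes G :: "'g monoid" and T :: "'g topology" and p :: nat
  assumes topspace_T: "topspace T = carrier G"
    and G_closed: "\<And>g h. g \<in> carrier G \<Longrightarrow> h \<in> carrier G \<Longrightarrow> g \<otimes>\<^bsub>G\<^esub> h \<in> carrier G"
    and p_pos: "p > 0"
begin

text \<open>The cup product lies in its own coset, through the coboundary of the zero cochain; if
  that coset is the group of coboundaries, it is a coboundary.\<close>

lemma cohomology_class2_eq_oneD:
  assumes "cohomology_class2 p G T (cup11 p G \<kappa> \<psi>) = \<one>\<^bsub>H2 p G T\<^esub>"
  obtains \<phi> where "\<phi> \<in> carrier (C1 p T)" "coboundary1 p G \<phi> = cup11 p G \<kappa> \<psi>"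
proof -
  let ?z = "\<lambda>x\<in>carrier G. 0 :: int"
  have "?z \<in> carrier (C1 p T)" using p_pos by (simp add: cochain_iff topspace_T)
      (metis (mono_tags, lifting) openin_topspace topspace_T Collect_cong Collect_mem_eq)
  then have "coboundary1 p G ?z \<in> coboundaries2 p G T" by (simp add: coboundaries2_def)
  moreover have "coboundary1 p G ?z \<otimes>\<^bsub>C2 p T\<^esub> cup11 p G \<kappa> \<psi> = cup11 p G \<kappa> \<psi>"
    by (rule ext) (auto simp: cochain_mult coboundary1_def cup11_def topspace_T G_closed residue_ring_def
        restrict_def)
  ultimately have "cup11 p G \<kappa> \<psi> \<in> cohomology_class2 p G T (cup11 p G \<kappa> \<psi>)"
    unfolding cohomology_class2_altdef by (metis image_eqI)
  then have "cup11 p G \<kappa> \<psi> \<in> coboundaries2 p G T" using assms by (simp add: H2_one)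
  then show ?thesis using that by (auto simp: coboundaries2_def)
qed

lemma cohomology_class2_coboundary:
  assumes \<omega>: "\<omega> \<in> carrier (C1 p T)"
  shows "cohomology_class2 p G T (coboundary1 p G \<omega>) = \<one>\<^bsub>H2 p G T\<^esub>"
proof -
  have add: "coboundary1 p G f \<otimes>\<^bsub>C2 p T\<^esub> coboundary1 p G \<omega>
      = coboundary1 p G (\<lambda>x\<in>topspace T. (f x + \<omega> x) mod int p)" for f
  proof -
    have "((a + b - c) mod int p + (a' + b' - c') mod int p) mod int p
        = ((a + a') mod int p + (b + b') mod int p - (c + c') mod int p) mod int p" for a b c a' b' c'
    proof -
      have "[(a + a') mod int p + (b + b') mod int p - (c + c') mod int p
          = (a + a') + (b + b') - (c + c')] (mod int p)"
        by (intro cong_add cong_diff) (simp_all add: cong_def)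
      then show ?thesis
        unfolding mod_add_eq cong_def by (simp only:) (rule arg_cong[of _ _ "\<lambda>k. k mod int p"], simp)
    qed
    then show ?thesis
      by (intro ext) (auto simp: cochain_mult coboundary1_def topspace_T G_closed restrict_def)
  qed
  have "coboundary1 p G f \<in> (\<lambda>h. h \<otimes>\<^bsub>C2 p T\<^esub> coboundary1 p G \<omega>) ` coboundaries2 p G T"
    if f: "f \<in> carrier (C1 p T)" for f
  proof -
    let ?d = "\<lambda>x\<in>topspace T. (f x - \<omega> x) mod int p"
    have "?d \<in> carrier (C1 p T)" using f \<omega> p_pos by (rule cochain_compose2)
    then have d: "coboundary1 p G ?d \<in> coboundaries2 p G T" by (simp add: coboundaries2_def)
    have "(\<lambda>x\<in>topspace T. (?d x + \<omega> x) mod int p) = f"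
      using f by (auto simp: cochain_iff restrict_def extensional_def mod_simps)
    then have "coboundary1 p G f = coboundary1 p G ?d \<otimes>\<^bsub>C2 p T\<^esub> coboundary1 p G \<omega>"
      by (simp only: add)
    then show ?thesis using d by (rule image_eqI)
  qed
  moreover have "coboundary1 p G f \<otimes>\<^bsub>C2 p T\<^esub> coboundary1 p G \<omega> \<in> coboundaries2 p G T"
    if f: "f \<in> carrier (C1 p T)" for f
    unfolding add coboundaries2_def using cochain_compose2[OF f \<omega> p_pos] by blast
  ultimately show ?thesis
    unfolding H2_one cohomology_class2_altdef by (auto simp: coboundaries2_def)
qed

end

section \<open>Continuous cochains and smooth functions\<close>

lemma galois_group_mult [simp]:
  "Rep_gal g \<otimes>\<^bsub>absolute_galois_group\<^esub> Rep_gal h = Rep_gal (g + h)"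
  by (simp add: absolute_galois_group_def Rep_gal_add)

lemma galois_group_closed:
  "\<sigma> \<in> carrier absolute_galois_group \<Longrightarrow> \<tau> \<in> carrier absolute_galois_group \<Longrightarrow>
    \<sigma> \<otimes>\<^bsub>absolute_galois_group\<^esub> \<tau> \<in> carrier absolute_galois_group"
  by (metis Rep_gal Rep_gal_cases galois_group_mult)

text \<open>Continuity is extracted at the identity only; uniformity over the group comes afterwards
  from the identities that the cochains satisfy.\<close>

lemma cochain_locally_constant:
  fixes f :: "('a::field alg_closure \<Rightarrow> 'a alg_closure) \<Rightarrow> int"
  assumes "f \<in> carrier (C1 p krull_topology)"
  shows "\<exists>V. open_basis V \<and> (\<forall>v\<in>V. f (Rep_gal v) = f (Rep_gal 0))"
proof -
  let ?W = "{\<sigma> \<in> carrier absolute_galois_group. f \<sigma> = f (Rep_gal 0)}"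
  have W: "openin krull_topology ?W" using assms Rep_gal by (auto simp: cochain_iff)
  have "Rep_gal 0 \<in> ?W" using Rep_gal by simp
  from openin_krull_imp[OF W this] obtain S where "finite S \<and> S \<subseteq> sep_closure \<and>
      (\<forall>h. (\<forall>x\<in>S. Rep_gal h x = Rep_gal 0 x) \<longrightarrow> Rep_gal h \<in> ?W)"
    by (elim exE)
  then have S: "finite S" "S \<subseteq> sep_closure"
    "\<And>h. \<forall>x\<in>S. Rep_gal h x = Rep_gal 0 x \<Longrightarrow> f (Rep_gal h) = f (Rep_gal 0)"
    by blast+
  have "f (Rep_gal v) = f (Rep_gal 0)" if "v \<in> fixer S" for v
  proof (rule S(3))
    show "\<forall>x\<in>S. Rep_gal v x = Rep_gal 0 x"
      using that S(2) by (auto simp: fixer_def subset_iff)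
  qed
  then show ?thesis using S(1,2) unfolding open_basis_def by blast
qed

lemma smooth_imp_cochain:
  fixes \<theta> :: "'a::field gal \<Rightarrow> int"
  assumes V: "open_basis V" "\<And>g v. v \<in> V \<Longrightarrow> \<theta> (g + v) = \<theta> g" and p: "p > 0"
  shows "(\<lambda>\<sigma>\<in>carrier absolute_galois_group. \<theta> (Abs_gal \<sigma>) mod int p)
    \<in> carrier (C1 p krull_topology)"
proof -
  let ?G = "carrier (absolute_galois_group :: ('a alg_closure \<Rightarrow> 'a alg_closure) monoid)"
  let ?f = "\<lambda>\<sigma>\<in>?G. \<theta> (Abs_gal \<sigma>) mod int p"
  obtain S where S: "finite S" "S \<subseteq> sep_closure" "V = fixer S"
    using V(1) by (auto simp: open_basis_def)
  have "openin krull_topology {\<tau> \<in> ?G. ?f \<tau> = ?f \<sigma>}" for \<sigma>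
  proof (rule openin_krullI)
    fix g assume g: "Rep_gal g \<in> {\<tau> \<in> ?G. ?f \<tau> = ?f \<sigma>}"
    have \<theta>: "\<theta> h = \<theta> g" if "\<forall>x\<in>S. Rep_gal h x = Rep_gal g x" for h
    proof -
      have "Rep_gal (- g + h) x = x" if "x \<in> S" for x
        by (subst gal_agree_iff) (use that S(2) \<open>\<forall>x\<in>S. Rep_gal h x = Rep_gal g x\<close> in auto)
      then have "- g + h \<in> V" unfolding S(3) fixer_def by blast
      from V(2)[OF this, of g] show ?thesis by simp
    qed
    have f_Rep: "?f (Rep_gal h) = \<theta> h mod int p" for h
      using Rep_gal[of h] by (simp add: Rep_gal_inverse)
    have "?f (Rep_gal g) = ?f \<sigma>" using g by blast
    then have "Rep_gal h \<in> {\<tau> \<in> ?G. ?f \<tau> = ?f \<sigma>}" if "\<forall>x\<in>S. Rep_gal h x = Rep_gal g x" for h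
      using \<theta>[OF that] Rep_gal[of h] f_Rep by (metis (mono_tags, lifting) mem_Collect_eq)
    then show "\<exists>S. finite S \<and> S \<subseteq> sep_closure \<and>
        (\<forall>h. (\<forall>x\<in>S. Rep_gal h x = Rep_gal g x) \<longrightarrow> Rep_gal h \<in> {\<tau> \<in> ?G. ?f \<tau> = ?f \<sigma>})"
      using S(1,2) by (intro exI[of _ S] conjI allI impI)
  qed blast
  then show ?thesis
    unfolding cochain_iff topspace_krull using p
    by (intro conjI ballI) (simp_all only: restrict_extensional, simp_all)
qed

theorem theorem6p6:
  fixes p :: nat
  assumes "Factorial_Ring.prime p"
    and "\<exists>\<zeta> :: 'a::field. primitive_root_of_unity p \<zeta>"
  shows "vanishing_triple_massey_product_property p
           (absolute_galois_group :: ('a alg_closure \<Rightarrow> 'a alg_closure) monoid) krull_topology"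
proof -
  let ?G = "absolute_galois_group :: ('a alg_closure \<Rightarrow> 'a alg_closure) monoid"
  let ?T = "krull_topology :: ('a alg_closure \<Rightarrow> 'a alg_closure) topology"
  have p_pos: "p > 0" using assms(1) by (rule prime_gt_0_nat)
  note G = topspace_krull galois_group_closed p_pos
  obtain z :: 'a where z: "primitive_root_of_unity p z" using assms(2) by blast
  interpret K: kummer_formation unit_power gal_act p "Abs_sep_unit (to_ac z)" open_basis
    by (rule galois_kummer_formation[OF assms(1) z])
  have character: "K.character (\<lambda>g. \<kappa> (Rep_gal g))" if \<kappa>: "\<kappa> \<in> H1 p ?G ?T" for \<kappa>
  proof -
    have range: "0 \<le> \<kappa> (Rep_gal g) \<and> \<kappa> (Rep_gal g) < int p" for g
      using \<kappa> Rep_gal by (auto simp: H1_def cochain_iff)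
    have add: "\<kappa> (Rep_gal (g + h)) = (\<kappa> (Rep_gal g) + \<kappa> (Rep_gal h)) mod int p" for g h
    proof -
      have "\<kappa> \<in> hom ?G (add_monoid (residue_ring (int p)))" using \<kappa> by (simp add: H1_def)
      from hom_mult[OF this Rep_gal Rep_gal, of g h] show ?thesis by (simp add: residue_ring_def)
    qed
    have "[\<kappa> (Rep_gal 0) + \<kappa> (Rep_gal 0) = \<kappa> (Rep_gal 0) + 0] (mod int p)"
      using add[of 0 0] range[of 0] by (simp add: cong_def)
    then have "[\<kappa> (Rep_gal 0) = 0] (mod int p)" by (simp only: cong_add_lcancel)
    then have zero: "\<kappa> (Rep_gal 0) = 0" using range[of 0] by (simp add: cong_def)
    obtain V where V: "open_basis V" "\<forall>v\<in>V. \<kappa> (Rep_gal v) = \<kappa> (Rep_gal 0)"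
      using cochain_locally_constant[of \<kappa> p] \<kappa> unfolding H1_def by blast
    have "\<kappa> (Rep_gal (g + v)) = \<kappa> (Rep_gal g)" if "v \<in> V" for g v
      using V(2) that zero range[of g] by (simp add: add)
    then have "K.smooth (\<lambda>g. \<kappa> (Rep_gal g))" using V(1) unfolding K.smooth_def by blast
    then show ?thesis using range add unfolding K.character_def by blast
  qed
  \<comment> \<open>For v near the identity \<open>\<phi>\<close> and \<open>\<psi>\<close> both
    vanish at v, so the coboundary identity gives the same value of \<open>\<phi>\<close> at g + v
    as at g, for all g at once.\<close>
  have lift: "K.smooth (\<lambda>g. \<phi> (Rep_gal g)) \<and>
      (\<forall>g h. [\<phi> (Rep_gal g) + \<phi> (Rep_gal h) - \<phi> (Rep_gal (g + h)) = \<kappa> (Rep_gal g) * \<psi> (Rep_gal h)] (mod int p))"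
    if \<kappa>: "K.character (\<lambda>g. \<kappa> (Rep_gal g))" and \<psi>: "K.character (\<lambda>g. \<psi> (Rep_gal g))"
      and \<phi>: "\<phi> \<in> carrier (C1 p ?T)" "coboundary1 p ?G \<phi> = cup11 p ?G \<kappa> \<psi>" for \<kappa> \<psi> \<phi>
  proof -
    have cong: "[\<phi> (Rep_gal g) + \<phi> (Rep_gal h) - \<phi> (Rep_gal (g + h)) = \<kappa> (Rep_gal g) * \<psi> (Rep_gal h)] (mod int p)" for g h
      using fun_cong[OF \<phi>(2), of "(Rep_gal g, Rep_gal h)"] Rep_gal[of g] Rep_gal[of h]
      by (simp add: coboundary1_def cup11_def residue_ring_def cong_def)
    have range: "0 \<le> \<phi> (Rep_gal g) \<and> \<phi> (Rep_gal g) < int p" for g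
      using \<phi>(1) Rep_gal by (auto simp: cochain_iff)
    have zero: "\<phi> (Rep_gal 0) = 0"
      using cong[of 0 0] range[of 0] K.character_0[OF \<kappa>] by (simp add: cong_def)
    obtain V where V: "open_basis V" "\<forall>v\<in>V. \<phi> (Rep_gal v) = \<phi> (Rep_gal 0)"
      using cochain_locally_constant[OF \<phi>(1)] by blast
    have "K.smooth (\<lambda>g. \<psi> (Rep_gal g))" by (rule K.character_smooth[OF \<psi>])
    then obtain W where W: "open_basis W" "\<forall>g. \<forall>v\<in>W. \<psi> (Rep_gal (g + v)) = \<psi> (Rep_gal g)"
      unfolding K.smooth_def by blast
    have "\<phi> (Rep_gal (g + v)) = \<phi> (Rep_gal g)" if "v \<in> V \<inter> W" for g v
    proof -
      have "\<psi> (Rep_gal v) = 0" "\<phi> (Rep_gal v) = 0"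
        using that V(2) W(2)[rule_format, of v 0] zero K.character_0[OF \<psi>] by auto
      then have "[\<phi> (Rep_gal g) = \<phi> (Rep_gal (g + v))] (mod int p)"
        using cong[of g v] by (simp add: cong_diff_iff_cong_0)
      then show ?thesis using range[of g] range[of "g + v"] by (simp add: cong_def)
    qed
    then have "K.smooth (\<lambda>g. \<phi> (Rep_gal g))"
      using K.small_Int[OF V(1) W(1)] unfolding K.smooth_def by blast
    then show ?thesis using cong by blast
  qed
  \<comment> \<open>The way back: integer cochains are reduced mod p and made extensional, which
    respects every identity known mod p.\<close>
  define push :: "('a gal \<Rightarrow> int) \<Rightarrow> ('a alg_closure \<Rightarrow> 'a alg_closure) \<Rightarrow> int" where
    "push \<theta> = (\<lambda>\<sigma>\<in>carrier ?G. \<theta> (Abs_gal \<sigma>) mod int p)" for \<theta>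
  have push_C1: "push \<theta> \<in> carrier (C1 p ?T)" if \<theta>: "K.smooth \<theta>" for \<theta>
  proof -
    obtain V where "open_basis V" "\<forall>g. \<forall>v\<in>V. \<theta> (g + v) = \<theta> g"
      using \<theta> unfolding K.smooth_def by blast
    then show ?thesis unfolding push_def using smooth_imp_cochain[of V \<theta> p] p_pos by blast
  qed
  have push_Rep [simp]: "push \<theta> (Rep_gal g) = \<theta> g mod int p" for \<theta> g
    using Rep_gal[of g] by (simp add: push_def Rep_gal_inverse)
  have push_coboundary: "coboundary1 p ?G (push \<theta>)
      = (\<lambda>(\<sigma>, \<tau>) \<in> carrier ?G \<times> carrier ?G. f \<sigma> \<tau> mod int p)"
    if "\<And>g h. [\<theta> g + \<theta> h - \<theta> (g + h) = f (Rep_gal g) (Rep_gal h)] (mod int p)" for \<theta> f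
  proof -
    have "(push \<theta> \<sigma> + push \<theta> \<tau> - push \<theta> (\<sigma> \<otimes>\<^bsub>?G\<^esub> \<tau>)) mod int p = f \<sigma> \<tau> mod int p"
      if \<sigma>\<tau>: "\<sigma> \<in> carrier ?G" "\<tau> \<in> carrier ?G" for \<sigma> \<tau>
    proof -
      obtain g h where "\<sigma> = Rep_gal g" "\<tau> = Rep_gal h" using \<sigma>\<tau> by (metis Rep_gal_cases)
      moreover have "[\<theta> g mod int p + \<theta> h mod int p - \<theta> (g + h) mod int p
          = \<theta> g + \<theta> h - \<theta> (g + h)] (mod int p)"
        by (intro cong_add cong_diff) (simp_all add: cong_def)
      ultimately show ?thesis
        using \<open>\<And>g h. [\<theta> g + \<theta> h - \<theta> (g + h) = f (Rep_gal g) (Rep_gal h)] (mod int p)\<close>[of g h]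
        by (simp add: cong_def)
    qed
    then show ?thesis unfolding coboundary1_def by (intro restrict_ext) auto
  qed
  show ?thesis
    unfolding vanishing_triple_massey_product_property_def
  proof (intro ballI impI)
    fix \<chi>a \<chi>b \<chi>c
    assume \<kappa>: "\<chi>a \<in> H1 p ?G ?T" "\<chi>b \<in> H1 p ?G ?T" "\<chi>c \<in> H1 p ?G ?T"
      and ab: "cohomology_class2 p ?G ?T (cup11 p ?G \<chi>a \<chi>b) = \<one>\<^bsub>H2 p ?G ?T\<^esub>"
      and bc: "cohomology_class2 p ?G ?T (cup11 p ?G \<chi>b \<chi>c) = \<one>\<^bsub>H2 p ?G ?T\<^esub>"
    note \<kappa>' = \<kappa>[THEN character]
    obtain \<phi> where \<phi>: "\<phi> \<in> carrier (C1 p ?T)" "coboundary1 p ?G \<phi> = cup11 p ?G \<chi>a \<chi>b"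
      using cohomology_class2_eq_oneD[OF G ab] by blast
    obtain \<psi> where \<psi>: "\<psi> \<in> carrier (C1 p ?T)" "coboundary1 p ?G \<psi> = cup11 p ?G \<chi>b \<chi>c"
      using cohomology_class2_eq_oneD[OF G bc] by blast
    note \<phi>' = lift[OF \<kappa>'(1,2) \<phi>] and \<psi>' = lift[OF \<kappa>'(2,3) \<psi>]
    obtain f k w where sm: "K.smooth f" "K.smooth k" "K.smooth w"
      and f: "\<And>g h. [f g + f h - f (g + h) = \<chi>a (Rep_gal g) * \<chi>b (Rep_gal h)] (mod int p)"
      and k: "\<And>g h. [k g + k h - k (g + h) = \<chi>b (Rep_gal g) * \<chi>c (Rep_gal h)] (mod int p)"
      and w: "\<And>g h. [w g + w h - w (g + h) = \<chi>a (Rep_gal g) * k h + f g * \<chi>c (Rep_gal h)] (mod int p)"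
      using K.massey_product_vanishes[OF \<kappa>' conjunct1[OF \<phi>'] conjunct1[OF \<psi>']
          conjunct2[OF \<phi>', rule_format] conjunct2[OF \<psi>', rule_format]] by blast
    have ds: "defining_system p ?G ?T \<chi>a \<chi>b \<chi>c (push f) (push k)"
      unfolding defining_system_def cup11_def
      using push_C1 sm push_coboundary[of f "\<lambda>\<sigma> \<tau>. \<chi>a \<sigma> * \<chi>b \<tau>", OF f]
        push_coboundary[of k "\<lambda>\<sigma> \<tau>. \<chi>b \<sigma> * \<chi>c \<tau>", OF k]
      by (simp add: residue_ring_def)
    \<comment> \<open>The Massey cocycle is formed from the reduced cochains, so \<open>k\<close>
      and \<open>f\<close> are replaced by their reductions before pushing \<open>w\<close>.\<close>
    have "[w g + w h - w (g + h)
        = \<chi>a (Rep_gal g) * push k (Rep_gal h) + push f (Rep_gal g) * \<chi>c (Rep_gal h)] (mod int p)" for g h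
    proof -
      have "[\<chi>a (Rep_gal g) * k h + f g * \<chi>c (Rep_gal h)
          = \<chi>a (Rep_gal g) * push k (Rep_gal h) + push f (Rep_gal g) * \<chi>c (Rep_gal h)] (mod int p)"
        by (intro cong_add cong_mult) (simp_all add: cong_def)
      with w[of g h] show ?thesis by (rule cong_trans)
    qed
    from push_coboundary[of w "\<lambda>\<sigma> \<tau>. \<chi>a \<sigma> * push k \<tau> + push f \<sigma> * \<chi>c \<tau>", OF this]
    have "cup11 p ?G \<chi>a (push k) \<otimes>\<^bsub>C2 p ?T\<^esub> cup11 p ?G (push f) \<chi>c = coboundary1 p ?G (push w)"
      by (simp only:) (auto simp: cochain_mult cup11_def residue_ring_def mod_simps restrict_def fun_eq_iff)
    then have "cohomology_class2 p ?G ?T (cup11 p ?G \<chi>a (push k) \<otimes>\<^bsub>C2 p ?T\<^esub> cup11 p ?G (push f) \<chi>c)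
        = \<one>\<^bsub>H2 p ?G ?T\<^esub>"
      using cohomology_class2_coboundary[OF G push_C1[OF sm(3)]] by simp
    then show "\<one>\<^bsub>H2 p ?G ?T\<^esub> \<in> triple_massey_product p ?G ?T \<chi>a \<chi>b \<chi>c"
      unfolding triple_massey_product_def using ds by blast
  qed
qed

end
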